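(* Let $V$ be a bounded operator on $\ell^2(\mathbb{Z})$ for which there exists $\delta>0$ such that $\sup_{(n,m)\in\mathbb{Z}^2}e^{\delta(|n|+|m|)}|V(n,m)|<\infty$, and let $\varepsilon_0\in(0,\delta/8]$ be as described in the context. Then one can choose $\varepsilon_0'\in(0,\varepsilon_0]$ such that $H_V$ has no resonance $z_\mu(k)$, for $\mu\in\{0,4\}$ and $k\in D^*_{\varepsilon_0'}(0)$.
   Context: $H_0$ is the bounded selfadjoint operator on $\ell^2(\mathbb{Z})$ given by $(H_0x)(n)=2x(n)-x(n+1)-x(n-1)$; $\sigma(H_0)=[0,4]$. For bounded $V$, $H_V:=H_0+V$ and $V(n,m)$ denotes the matrix of $V$ in the canonical basis. $J$ is the unitary $(Jx)(n)=(-1)^nx(n)$ and $V_J:=JVJ^{-1}$. $\ell^2_{\pm\delta}(\mathbb{Z})=\{x\in\mathbb{C}^{\mathbb{Z}}:\sum_n e^{\pm\delta|n|}|x(n)|^2<\infty\}$, so $\ell^2_\delta\subset\ell^2\subset\ell^2_{-\delta}$. $D_r(0)=\{k\in\mathbb{C}:|k|<r\}$, $D_r^*(0)=D_r(0)\setminus\{0\}$, $\mathbb{C}^+=\{\operatorname{Im}k>0\}$. $\varepsilon_0\in(0,\delta/8]$ is a fixed number, small enough that for both $\mathbf{V}=V$ and $\mathbf{V}=-V_J$ the function $k\mapsto(H_{\mathbf{V}}-k^2)^{-1}$, with values in $\mathcal{B}(\ell^2_\delta(\mathbb{Z});\ell^2_{-\delta}(\mathbb{Z}))$, admits a meromorphic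 extension from $D^*_{\varepsilon_0}(0)\cap\mathbb{C}^+$ to $D^*_{\varepsilon_0}(0)$ (such a number exists whenever $\delta>0$ is such that $\sup_{(n,m)\in\mathbb{Z}^2}e^{\delta(|n|+|m|)}|V(n,m)|<\infty$). Resonances (parametrized by $k\in D^*_{\varepsilon_0}(0)$): $z_0(k):=k^2$ is a resonance of $H_V$ near $0$ if $k$ is a pole of the meromorphic extension of $k\mapsto(H_V-k^2)^{-1}$; $z_4(k):=4-k^2$ is a resonance of $H_V$ near $4$ if $k$ is a pole of the meromorphic extension of $k\mapsto(H_{-V_J}-k^2)^{-1}$. *)

theory Defs
  imports "HOL-Analysis.Analysis"
begin

text \<open>
  The spaces are carrier sets of complex sequences indexed by the integers. An operator is a
  function on all sequences, of which only the restriction to the domain carrier matters.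
\<close>

definition ell2 :: "real \<Rightarrow> (int \<Rightarrow> complex) set" where
  "ell2 a = {x. (\<lambda>n. exp (a * real_of_int \<bar>n\<bar>) * (cmod (x n))\<^sup>2) summable_on UNIV}"

definition ell2_norm :: "real \<Rightarrow> (int \<Rightarrow> complex) \<Rightarrow> real" where
  "ell2_norm a x = sqrt (\<Sum>\<^sub>\<infinity>n. exp (a * real_of_int \<bar>n\<bar>) * (cmod (x n))\<^sup>2)"

definition bounded_op :: "real \<Rightarrow> real \<Rightarrow> ((int \<Rightarrow> complex) \<Rightarrow> int \<Rightarrow> complex) \<Rightarrow> bool" where
  "bounded_op a b T \<longleftrightarrow>
     (\<forall>x\<in>ell2 a. T x \<in> ell2 b) \<and>
     (\<forall>x\<in>ell2 a. \<forall>y\<in>ell2 a. T (\<lambda>n. x n + y n) = (\<lambda>n. T x n + T y n)) \<and>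
     (\<forall>c. \<forall>x\<in>ell2 a. T (\<lambda>n. c * x n) = (\<lambda>n. c * T x n)) \<and>
     (\<exists>C. \<forall>x\<in>ell2 a. ell2_norm b (T x) \<le> C * ell2_norm a x)"

text \<open>The operator norm; meaningful only for bounded operators.\<close>

definition op_norm :: "real \<Rightarrow> real \<Rightarrow> ((int \<Rightarrow> complex) \<Rightarrow> int \<Rightarrow> complex) \<Rightarrow> real" where
  "op_norm a b T = (SUP x\<in>{x \<in> ell2 a. ell2_norm a x \<le> 1}. ell2_norm b (T x))"

text \<open>Complex differentiability in the operator norm; intended for open \<open>U\<close>.\<close>

definition op_holomorphic_on ::
  "real \<Rightarrow> real \<Rightarrow> (complex \<Rightarrow> (int \<Rightarrow> complex) \<Rightarrow> int \<Rightarrow> complex) \<Rightarrow> complex set \<Rightarrow> bool" where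
  "op_holomorphic_on a b F U \<longleftrightarrow>
     (\<forall>k\<in>U. bounded_op a b (F k) \<and>
        (\<exists>D. bounded_op a b D \<and>
           ((\<lambda>h. op_norm a b (\<lambda>x n. (F (k + h) x n - F k x n) / h - D x n)) \<longlongrightarrow> 0) (at 0)))"

text \<open>
  \<open>G\<close> is holomorphic near \<open>k0\<close> and \<open>F k = G k / (k - k0) ^ m\<close> in a punctured neighbourhood of
  \<open>k0\<close>. The value of \<open>F\<close> at \<open>k0\<close> itself is irrelevant.
\<close>

definition op_laurent_at ::
  "real \<Rightarrow> real \<Rightarrow> (complex \<Rightarrow> (int \<Rightarrow> complex) \<Rightarrow> int \<Rightarrow> complex) \<Rightarrow> complex \<Rightarrow> nat \<Rightarrow>
   (complex \<Rightarrow> (int \<Rightarrow> complex) \<Rightarrow> int \<Rightarrow> complex) \<Rightarrow> bool" where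
  "op_laurent_at a b F k0 m G \<longleftrightarrow>
     (\<exists>r>0. op_holomorphic_on a b G (ball k0 r) \<and>
        (\<forall>k\<in>ball k0 r - {k0}. \<forall>x\<in>ell2 a. F k x = (\<lambda>n. G k x n / (k - k0) ^ m)))"

definition op_meromorphic_on ::
  "real \<Rightarrow> real \<Rightarrow> (complex \<Rightarrow> (int \<Rightarrow> complex) \<Rightarrow> int \<Rightarrow> complex) \<Rightarrow> complex set \<Rightarrow> bool" where
  "op_meromorphic_on a b F U \<longleftrightarrow> (\<forall>k0\<in>U. \<exists>m G. op_laurent_at a b F k0 m G)"

definition op_is_pole ::
  "real \<Rightarrow> real \<Rightarrow> (complex \<Rightarrow> (int \<Rightarrow> complex) \<Rightarrow> int \<Rightarrow> complex) \<Rightarrow> complex \<Rightarrow> bool" where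
  "op_is_pole a b F k0 \<longleftrightarrow>
     (\<exists>m\<ge>1. \<exists>G. op_laurent_at a b F k0 m G \<and> (\<exists>x\<in>ell2 a. G k0 x \<noteq> (\<lambda>n. 0)))"

definition shift_op ::
  "((int \<Rightarrow> complex) \<Rightarrow> int \<Rightarrow> complex) \<Rightarrow> complex \<Rightarrow> (int \<Rightarrow> complex) \<Rightarrow> int \<Rightarrow> complex" where
  "shift_op T z = (\<lambda>x n. T x n - z * x n)"

definition resolvent ::
  "((int \<Rightarrow> complex) \<Rightarrow> int \<Rightarrow> complex) \<Rightarrow> complex \<Rightarrow> (int \<Rightarrow> complex) \<Rightarrow> int \<Rightarrow> complex" where
  "resolvent T z = inv_into (ell2 0) (shift_op T z)"

definition resolvent_set :: "((int \<Rightarrow> complex) \<Rightarrow> int \<Rightarrow> complex) \<Rightarrow> complex set" where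
  "resolvent_set T =
     {z. bij_betw (shift_op T z) (ell2 0) (ell2 0) \<and> bounded_op 0 0 (resolvent T z)}"

definition matrix_entry :: "((int \<Rightarrow> complex) \<Rightarrow> int \<Rightarrow> complex) \<Rightarrow> int \<Rightarrow> int \<Rightarrow> complex" where
  "matrix_entry V n m = V (\<lambda>j. if j = m then 1 else 0) n"

definition H0 :: "(int \<Rightarrow> complex) \<Rightarrow> int \<Rightarrow> complex" where
  "H0 x = (\<lambda>n. 2 * x n - x (n + 1) - x (n - 1))"

definition HV ::
  "((int \<Rightarrow> complex) \<Rightarrow> int \<Rightarrow> complex) \<Rightarrow> (int \<Rightarrow> complex) \<Rightarrow> int \<Rightarrow> complex" where
  "HV V x = (\<lambda>n. H0 x n + V x n)"

definition J :: "(int \<Rightarrow> complex) \<Rightarrow> int \<Rightarrow> complex" where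
  "J x = (\<lambda>n. (-1) powi n * x n)"

definition conj_J ::
  "((int \<Rightarrow> complex) \<Rightarrow> int \<Rightarrow> complex) \<Rightarrow> (int \<Rightarrow> complex) \<Rightarrow> int \<Rightarrow> complex" where
  "conj_J V = J \<circ> V \<circ> inv J"

definition neg_conj_J ::
  "((int \<Rightarrow> complex) \<Rightarrow> int \<Rightarrow> complex) \<Rightarrow> (int \<Rightarrow> complex) \<Rightarrow> int \<Rightarrow> complex" where
  "neg_conj_J V = (\<lambda>x n. - conj_J V x n)"

definition punctured_disc :: "real \<Rightarrow> complex set" where
  "punctured_disc r = ball 0 r - {0}"

text \<open>
  \<open>R\<close> is a meromorphic extension of \<open>k \<mapsto> (H\<^sub>V - k\<^sup>2)\<inverse>\<close> from the upper half of the punctured disc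
  to the whole of it. On the upper half \<open>(H\<^sub>V - k\<^sup>2)\<inverse>\<close> is defined where \<open>k\<^sup>2\<close> is in the resolvent
  set of \<open>H\<^sub>V\<close>; no selfadjointness is assumed, and discrete eigenvalues may occur as poles.
\<close>

definition meromorphic_resolvent_extension ::
  "real \<Rightarrow> real \<Rightarrow> ((int \<Rightarrow> complex) \<Rightarrow> int \<Rightarrow> complex) \<Rightarrow>
   (complex \<Rightarrow> (int \<Rightarrow> complex) \<Rightarrow> int \<Rightarrow> complex) \<Rightarrow> bool" where
  "meromorphic_resolvent_extension \<delta> \<epsilon> V R \<longleftrightarrow>
     op_meromorphic_on \<delta> (-\<delta>) R (punctured_disc \<epsilon>) \<and>
     (\<forall>k\<in>punctured_disc \<epsilon>. Im k > 0 \<and> k\<^sup>2 \<in> resolvent_set (HV V) \<longrightarrow>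
        (\<forall>x\<in>ell2 \<delta>. R k x = resolvent (HV V) (k\<^sup>2) x))"

definition pole_of_extension ::
  "real \<Rightarrow> real \<Rightarrow> ((int \<Rightarrow> complex) \<Rightarrow> int \<Rightarrow> complex) \<Rightarrow> complex \<Rightarrow> bool" where
  "pole_of_extension \<delta> \<epsilon> V k \<longleftrightarrow>
     k \<in> punctured_disc \<epsilon> \<and>
     (\<exists>R. meromorphic_resolvent_extension \<delta> \<epsilon> V R \<and> op_is_pole \<delta> (-\<delta>) R k)"

text \<open>
  \<open>is_resonance \<delta> \<epsilon> V \<mu> k\<close>: the point \<open>z\<^sub>\<mu>(k)\<close> is a resonance of \<open>H\<^sub>V\<close> near the threshold
  \<open>\<mu> \<in> {0, 4}\<close>, where \<open>z\<^sub>0(k) = k\<^sup>2\<close> and \<open>z\<^sub>4(k) = 4 - k\<^sup>2\<close>. This is a property of the parameter \<open>k\<close>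
  rather than of the number \<open>z\<^sub>\<mu>(k)\<close>, which is the same for \<open>k\<close> and \<open>-k\<close>.
\<close>

definition is_resonance ::
  "real \<Rightarrow> real \<Rightarrow> ((int \<Rightarrow> complex) \<Rightarrow> int \<Rightarrow> complex) \<Rightarrow> nat \<Rightarrow> complex \<Rightarrow> bool" where
  "is_resonance \<delta> \<epsilon> V \<mu> k \<longleftrightarrow>
     (\<mu> = 0 \<and> pole_of_extension \<delta> \<epsilon> V k) \<or>
     (\<mu> = 4 \<and> pole_of_extension \<delta> \<epsilon> (neg_conj_J V) k)"

end

(* With k^2 = 2 - zeta - 1/zeta the free resolvent has kernel zeta^(|n-m|+1) / (1 - zeta^2), which
   is meromorphic near zeta = 1 with a simple rank-one pole. Carrying the mean of the source as an
   extra unknown removes this pole and turns (H_V - k^2) u = f into a system (1 + M(zeta)) w = phi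
   on sequences, where M is holomorphic on a disc Omega containing 0 and 1 and has entries bounded
   by alpha_i beta_j with alpha_i beta_j summable. By the analytic Fredholm alternative the system
   is solved by H(zeta) / D(zeta) with H and D holomorphic on Omega. At zeta = 0, that is z = infinity,
   the system is trivially uniquely solvable, so D is not identically zero and has no zeros in
   a punctured neighbourhood of zeta = 1, that is of k = 0. There the matrix elements of any
   meromorphic extension agree with the holomorphic functions H / D by the identity theorem. *)

theory Submission
  imports Defs "HOL-Complex_Analysis.Complex_Analysis" "Jordan_Normal_Form.Determinant"
begin

section \<open>Cramer's rule with holomorphic entries\<close>

text \<open>As \<open>V\<close> need not be selfadjoint, it is not known in advance where H_V - k^2
  is invertible near the threshold. The anchor is therefore zeta = 0, and Omega has to join 0 to a
  full neighbourhood of 1, part of which lies in |zeta| > 1 where the free kernel grows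
  exponentially. The solution u remains an unknown beside the source, so that the growing kernel and
  the decaying potential occupy separate entries, each dominated in suitable weights. Domination by
  alpha_i beta_j turns the kernel into a contraction of a weighted l1 space once finitely many rows
  are removed; a Neumann series and a finite linear system then produce H and D. For |zeta| < 1 the
  system is equivalent to the equation in l2. This is used with data in l2, to place k^2 in the
  resolvent set, and with data in l2_delta, to obtain the formula H / D. An extension is tied to the
  resolvent only where Im k > 0 and k^2 is in the resolvent set, so an open set of such k has to be
  exhibited. The threshold 4 is the same statement for -V_J, whose entries have the same moduli as
  those of V.\<close>

lemma holomorphic_on_det_mat:
  assumes "\<And>i j. i < n \<Longrightarrow> j < n \<Longrightarrow> (\<lambda>z. a z i j) holomorphic_on \<Omega>"
  shows "(\<lambda>z. Determinant.det (Matrix.mat n n (\<lambda>(i, j). a z i j))) holomorphic_on \<Omega>"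
proof -
  have eq: "Determinant.det (Matrix.mat n n (\<lambda>(i, j). a z i j)) =
      (\<Sum>p | p permutes {0..<n}. signof p * (\<Prod>i = 0..<n. a z i (p i)))" for z
    unfolding det_def'[OF mat_carrier]
    by (intro sum.cong arg_cong2[where f = "(*)"] prod.cong refl)
      (auto simp: index_mat permutes_in_image)
  show ?thesis
    unfolding eq using assms
    by (intro holomorphic_intros) (auto simp: permutes_in_image)
qed

text \<open>The entries of the adjugate are signed minors, hence polynomials in the entries of
  \<open>a\<close> and holomorphic even where the determinant \<open>D\<close> vanishes; the entries
  of the inverse matrix may have poles there.\<close>

lemma holomorphic_cramer_nat:
  fixes a :: "complex \<Rightarrow> nat \<Rightarrow> nat \<Rightarrow> complex"
  assumes hol: "\<And>i j. i < n \<Longrightarrow> j < n \<Longrightarrow> (\<lambda>z. a z i j) holomorphic_on \<Omega>"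
  shows "\<exists>D adj. D holomorphic_on \<Omega> \<and> (\<forall>i<n. \<forall>j<n. (\<lambda>z. adj z i j) holomorphic_on \<Omega>) \<and>
    (\<forall>z. \<forall>i<n. \<forall>j<n. (\<Sum>k<n. a z i k * adj z k j) = (if i = j then D z else (0::complex))) \<and>
    (\<forall>z. \<forall>i<n. \<forall>j<n. (\<Sum>k<n. adj z i k * a z k j) = (if i = j then D z else 0)) \<and>
    (\<forall>z. D z = 0 \<longrightarrow> (\<exists>s. (\<exists>i<n. s i \<noteq> 0) \<and> (\<forall>i<n. (\<Sum>k<n. a z i k * s k) = 0)))"
proof -
  define A where "A z = Matrix.mat n n (\<lambda>(i, j). a z i j)" for z
  define D where "D z = Determinant.det (A z)" for z
  define adj where "adj z i j = adj_mat (A z) $$ (i, j)" for z i j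
  have cA: "A z \<in> carrier_mat n n" for z by (simp add: A_def)
  have "D holomorphic_on \<Omega>"
    unfolding D_def A_def by (intro holomorphic_on_det_mat hol)
  moreover have "(\<lambda>z. adj z i j) holomorphic_on \<Omega>" if ij: "i < n" "j < n" for i j
  proof -
    \<comment> \<open>The adjugate is the transposed cofactor matrix, so its entry (i, j) deletes
      row j and column i; the case distinctions skip these two indices.\<close>
    have del: "mat_delete (A z) j i = Matrix.mat (n - 1) (n - 1)
        (\<lambda>(i', j'). a z (if i' < j then i' else Suc i') (if j' < i then j' else Suc j'))" for z
      using ij by (intro eq_matI) (auto simp: mat_delete_def A_def)
    have "adj z i j = (-1) ^ (j + i) * Determinant.det (Matrix.mat (n - 1) (n - 1)
        (\<lambda>(i', j'). a z (if i' < j then i' else Suc i') (if j' < i then j' else Suc j')))" for z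
      using ij cA[of z] by (simp add: adj_def adj_mat_def cofactor_def del)
    then show ?thesis
      by (auto intro!: holomorphic_intros holomorphic_on_det_mat hol)
  qed
  moreover have "(\<Sum>k<n. a z i k * adj z k j) = (if i = j then D z else 0)"
    if "i < n" "j < n" for z i j
  proof -
    have "(A z * adj_mat (A z)) $$ (i, j) = (D z \<cdot>\<^sub>m 1\<^sub>m n) $$ (i, j)"
      using adj_mat(2)[OF cA[of z]] by (simp add: D_def)
    moreover have "(A z * adj_mat (A z)) $$ (i, j) = (\<Sum>k<n. a z i k * adj z k j)"
      using that cA[of z] adj_mat(1)[OF cA[of z]]
      by (auto simp: scalar_prod_def A_def adj_def lessThan_atLeast0 intro!: sum.cong)
    ultimately show ?thesis using that by simp
  qed
  moreover have "(\<Sum>k<n. adj z i k * a z k j) = (if i = j then D z else 0)"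
    if "i < n" "j < n" for z i j
  proof -
    have "(adj_mat (A z) * A z) $$ (i, j) = (D z \<cdot>\<^sub>m 1\<^sub>m n) $$ (i, j)"
      using adj_mat(3)[OF cA[of z]] by (simp add: D_def)
    moreover have "(adj_mat (A z) * A z) $$ (i, j) = (\<Sum>k<n. adj z i k * a z k j)"
      using that cA[of z] adj_mat(1)[OF cA[of z]]
      by (auto simp: scalar_prod_def A_def adj_def lessThan_atLeast0 intro!: sum.cong)
    ultimately show ?thesis using that by simp
  qed
  moreover have "\<exists>s. (\<exists>i<n. s i \<noteq> 0) \<and> (\<forall>i<n. (\<Sum>k<n. a z i k * s k) = 0)" if Dz: "D z = 0" for z
  proof -
    obtain v where v: "v \<in> carrier_vec n" "v \<noteq> 0\<^sub>v n" "A z *\<^sub>v v = 0\<^sub>v n"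
      using Dz det_0_iff_vec_prod_zero_field[OF cA[of z]] by (auto simp: D_def)
    have "(\<Sum>k<n. a z i k * vec_index v k) = 0" if "i < n" for i
    proof -
      have "(\<Sum>k<n. a z i k * vec_index v k) = vec_index (A z *\<^sub>v v) i"
        using that v(1) cA[of z]
        by (auto simp: scalar_prod_def A_def lessThan_atLeast0 intro!: sum.cong)
      then show ?thesis using v(3) that by simp
    qed
    moreover have "\<exists>i<n. vec_index v i \<noteq> 0"
      using v(1,2) by (metis carrier_vecD dim_vec_last eq_vecI index_zero_vec(1,2))
    ultimately show ?thesis by blast
  qed
  ultimately show ?thesis by blast
qed

text \<open>Transport of the matrix statement, whose indices are 0, ..., n - 1, to an arbitrary
  finite index set along a bijection \<open>e\<close>.\<close>

lemma holomorphic_cramer: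
  fixes a :: "complex \<Rightarrow> 'i \<Rightarrow> 'i \<Rightarrow> complex"
  assumes F: "finite F" and hol: "\<And>i j. i \<in> F \<Longrightarrow> j \<in> F \<Longrightarrow> (\<lambda>z. a z i j) holomorphic_on \<Omega>"
  obtains D adj where "D holomorphic_on \<Omega>"
    "\<And>i j. i \<in> F \<Longrightarrow> j \<in> F \<Longrightarrow> (\<lambda>z. adj z i j) holomorphic_on \<Omega>"
    "\<And>z i j. i \<in> F \<Longrightarrow> j \<in> F \<Longrightarrow> (\<Sum>k\<in>F. a z i k * adj z k j) = (if i = j then D z else 0)"
    "\<And>z i j. i \<in> F \<Longrightarrow> j \<in> F \<Longrightarrow> (\<Sum>k\<in>F. adj z i k * a z k j) = (if i = j then D z else 0)"
    "\<And>z. D z = 0 \<Longrightarrow> \<exists>s. (\<exists>i\<in>F. s i \<noteq> 0) \<and> (\<forall>i\<in>F. (\<Sum>k\<in>F. a z i k * s k) = 0)"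
proof -
  define n where "n = card F"
  obtain e where e: "bij_betw e {..<n} F"
    using F by (metis n_def ex_bij_betw_nat_finite lessThan_atLeast0)
  define e' where "e' = inv_into {..<n} e"
  have e'l: "e' i < n" and ee': "e (e' i) = i" if "i \<in> F" for i
    using that e bij_betw_inv_into_right[OF e] bij_betwE[OF bij_betw_inv_into[OF e]]
    by (auto simp: e'_def)
  have e'e: "e' (e k) = k" and eF: "e k \<in> F" if "k < n" for k
    using that e bij_betw_inv_into_left[OF e] bij_betwE[OF e] by (auto simp: e'_def)
  have e'eq: "e' i = e' j \<longleftrightarrow> i = j" if "i \<in> F" "j \<in> F" for i j
    using that ee' by metis
  have sumF: "sum h F = (\<Sum>k<n. h (e k))" for h :: "'i \<Rightarrow> complex"
    by (rule sum.reindex_bij_betw[OF e, symmetric])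
  have hol': "(\<lambda>z. a z (e i) (e j)) holomorphic_on \<Omega>" if "i < n" "j < n" for i j
    using that eF hol by blast
  obtain D b where Db: "D holomorphic_on \<Omega>"
    "\<forall>i<n. \<forall>j<n. (\<lambda>z. b z i j) holomorphic_on \<Omega>"
    "\<forall>z. \<forall>i<n. \<forall>j<n. (\<Sum>k<n. a z (e i) (e k) * b z k j) = (if i = j then D z else (0::complex))"
    "\<forall>z. \<forall>i<n. \<forall>j<n. (\<Sum>k<n. b z i k * a z (e k) (e j)) = (if i = j then D z else 0)"
    "\<forall>z. D z = 0 \<longrightarrow> (\<exists>s. (\<exists>i<n. s i \<noteq> 0) \<and> (\<forall>i<n. (\<Sum>k<n. a z (e i) (e k) * s k) = 0))"
    by (atomize_elim, rule holomorphic_cramer_nat, rule hol')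
  show ?thesis
  proof (rule that[of D "\<lambda>z i j. b z (e' i) (e' j)"])
    show "D holomorphic_on \<Omega>" by (rule Db(1))
    show "(\<lambda>z. b z (e' i) (e' j)) holomorphic_on \<Omega>" if "i \<in> F" "j \<in> F" for i j
      using that e'l Db(2) by blast
    show "(\<Sum>k\<in>F. a z i k * b z (e' k) (e' j)) = (if i = j then D z else 0)"
      if "i \<in> F" "j \<in> F" for z i j
    proof -
      have "(\<Sum>k\<in>F. a z i k * b z (e' k) (e' j)) = (\<Sum>k<n. a z (e (e' i)) (e k) * b z k (e' j))"
        unfolding sumF using that by (intro sum.cong) (auto simp: e'e ee')
      then show ?thesis using Db(3) e'l that e'eq by simp
    qed
    show "(\<Sum>k\<in>F. b z (e' i) (e' k) * a z k j) = (if i = j then D z else 0)"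
      if "i \<in> F" "j \<in> F" for z i j
    proof -
      have "(\<Sum>k\<in>F. b z (e' i) (e' k) * a z k j) = (\<Sum>k<n. b z (e' i) k * a z (e k) (e (e' j)))"
        unfolding sumF using that by (intro sum.cong) (auto simp: e'e ee')
      then show ?thesis using Db(4) e'l that e'eq by simp
    qed
    show "\<exists>s. (\<exists>i\<in>F. s i \<noteq> 0) \<and> (\<forall>i\<in>F. (\<Sum>k\<in>F. a z i k * s k) = 0)" if Dz: "D z = 0" for z
    proof -
      obtain s where s: "\<exists>i<n. s i \<noteq> 0" "\<forall>i<n. (\<Sum>k<n. a z (e i) (e k) * s k) = 0"
        using Db(5) Dz by blast
      have "(\<Sum>k\<in>F. a z i k * s (e' k)) = 0" if "i \<in> F" for i
      proof -
        have "(\<Sum>k\<in>F. a z i k * s (e' k)) = (\<Sum>k<n. a z (e (e' i)) (e k) * s k)"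
          unfolding sumF using that by (intro sum.cong) (auto simp: e'e ee')
        then show ?thesis using s(2) e'l that by simp
      qed
      moreover have "\<exists>i\<in>F. s (e' i) \<noteq> 0" using s(1) eF e'e by metis
      ultimately show ?thesis by (intro exI[of _ "\<lambda>i. s (e' i)"]) blast
    qed
  qed
qed

text \<open>The majorant \<open>B\<close> is independent of z, so the Weierstrass test makes the
  finite partial sums converge uniformly on the domain, and uniform limits of holomorphic functions
  are holomorphic.\<close>

lemma holomorphic_on_infsum:
  fixes f :: "'x \<Rightarrow> complex \<Rightarrow> complex"
  assumes "open \<Omega>" and hol: "\<And>x. x \<in> X \<Longrightarrow> f x holomorphic_on \<Omega>"
    and bnd: "\<And>x z. x \<in> X \<Longrightarrow> z \<in> \<Omega> \<Longrightarrow> cmod (f x z) \<le> B x"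
    and "B summable_on X"
  shows "(\<lambda>z. \<Sum>\<^sub>\<infinity>x\<in>X. f x z) holomorphic_on \<Omega>"
proof -
  have lim: "uniform_limit \<Omega> (\<lambda>A z. \<Sum>x\<in>A. f x z) (\<lambda>z. \<Sum>\<^sub>\<infinity>x\<in>X. f x z) (finite_subsets_at_top X)"
    using bnd assms(4) by (rule Weierstrass_m_test_general)
  have "\<exists>r>0. (\<lambda>z. \<Sum>\<^sub>\<infinity>x\<in>X. f x z) holomorphic_on ball z0 r" if "z0 \<in> \<Omega>" for z0
  proof -
    obtain r where r: "r > 0" "cball z0 r \<subseteq> \<Omega>"
      using assms(1) \<open>z0 \<in> \<Omega>\<close> open_contains_cball by blast
    have "(\<lambda>z. \<Sum>\<^sub>\<infinity>x\<in>X. f x z) holomorphic_on ball z0 r"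
    proof (rule holomorphic_uniform_limit[where f = "\<lambda>A z. \<Sum>x\<in>A. f x z" and F = "finite_subsets_at_top X"])
      show "\<forall>\<^sub>F A in finite_subsets_at_top X. continuous_on (cball z0 r) (\<lambda>z. \<Sum>x\<in>A. f x z) \<and>
          (\<lambda>z. \<Sum>x\<in>A. f x z) holomorphic_on ball z0 r"
      proof (rule eventually_finite_subsets_at_top_weakI)
        fix A assume A: "finite A" "A \<subseteq> X"
        then have "(\<lambda>z. \<Sum>x\<in>A. f x z) holomorphic_on \<Omega>"
          using hol by (intro holomorphic_intros) auto
        then show "continuous_on (cball z0 r) (\<lambda>z. \<Sum>x\<in>A. f x z) \<and>
          (\<lambda>z. \<Sum>x\<in>A. f x z) holomorphic_on ball z0 r"
          using r ball_subset_cball by (meson continuous_on_subset holomorphic_on_imp_continuous_on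
            holomorphic_on_subset order_trans)
      qed
      show "uniform_limit (cball z0 r) (\<lambda>A z. \<Sum>x\<in>A. f x z) (\<lambda>z. \<Sum>\<^sub>\<infinity>x\<in>X. f x z) (finite_subsets_at_top X)"
        using lim r uniform_limit_on_subset by blast
    qed auto
    then show ?thesis using r by blast
  qed
  then show ?thesis
    unfolding holomorphic_on_open[OF assms(1)]
    by (metis centre_in_ball holomorphic_on_open open_ball)
qed

section \<open>Dominated kernels on weighted sequences\<close>

definition kapp :: "('i \<Rightarrow> 'i \<Rightarrow> complex) \<Rightarrow> ('i \<Rightarrow> complex) \<Rightarrow> 'i \<Rightarrow> complex" where
  "kapp A g i = (\<Sum>\<^sub>\<infinity>j. A i j * g j)"

text \<open>Membership in the l1 space with weight \<open>\<beta>\<close>. Infinite sums default to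
  0 where they do not converge, so \<open>wnorm\<close> and \<open>kapp\<close> are informative only
  together with this predicate.\<close>

definition wsum :: "('i \<Rightarrow> real) \<Rightarrow> ('i \<Rightarrow> complex) \<Rightarrow> bool" where
  "wsum \<beta> g \<longleftrightarrow> (\<lambda>j. \<beta> j * cmod (g j)) summable_on UNIV"

definition wnorm :: "('i \<Rightarrow> real) \<Rightarrow> ('i \<Rightarrow> complex) \<Rightarrow> real" where
  "wnorm \<beta> g = (\<Sum>\<^sub>\<infinity>j. \<beta> j * cmod (g j))"

text \<open>The dual of l1 with weight \<open>\<beta>\<close> consists of the sequences bounded by a
  multiple of \<open>\<beta>\<close>.\<close>

lemma has_sum_linear_bound:
  fixes r :: "'i \<Rightarrow> complex"
  assumes r: "\<And>j. cmod (r j) \<le> c * \<beta> j" and g: "wsum \<beta> g"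
  shows "(\<lambda>j. r j * g j) summable_on UNIV" "cmod (\<Sum>\<^sub>\<infinity>j. r j * g j) \<le> c * wnorm \<beta> g"
proof -
  have le: "cmod (r j * g j) \<le> c * (\<beta> j * cmod (g j))" for j
    using mult_right_mono[OF r[of j], of "cmod (g j)"] by (simp add: norm_mult mult.assoc)
  have s: "(\<lambda>j. c * (\<beta> j * cmod (g j))) summable_on UNIV"
    using g unfolding wsum_def by (rule summable_on_cmult_right)
  have abs: "(\<lambda>j. cmod (r j * g j)) summable_on UNIV"
    using s le by (rule Infinite_Sum.abs_summable_on_comparison_test')
  then show "(\<lambda>j. r j * g j) summable_on UNIV" by (rule Infinite_Sum.abs_summable_summable)
  have "cmod (\<Sum>\<^sub>\<infinity>j. r j * g j) \<le> (\<Sum>\<^sub>\<infinity>j. cmod (r j * g j))"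
    using abs by (rule norm_infsum_bound)
  also have "\<dots> \<le> (\<Sum>\<^sub>\<infinity>j. c * (\<beta> j * cmod (g j)))"
    using abs s le by (rule infsum_mono)
  also have "\<dots> = c * wnorm \<beta> g"
    unfolding wnorm_def by (rule infsum_cmult_right')
  finally show "cmod (\<Sum>\<^sub>\<infinity>j. r j * g j) \<le> c * wnorm \<beta> g" .
qed

lemma wsum_dominated:
  assumes "\<And>j. cmod (g j) \<le> \<phi> j" "(\<lambda>j. \<beta> j * \<phi> j) summable_on UNIV" "\<And>j. 0 < \<beta> j"
  shows "wsum \<beta> g" "wnorm \<beta> g \<le> (\<Sum>\<^sub>\<infinity>j. \<beta> j * \<phi> j)"
proof -
  have le: "\<beta> j * cmod (g j) \<le> \<beta> j * \<phi> j" for j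
    using assms(1,3) by (simp add: less_imp_le mult_left_mono)
  show w: "wsum \<beta> g" unfolding wsum_def
    using assms(2) le by (rule summable_on_comparison_test) (simp add: assms(3) less_imp_le)
  show "wnorm \<beta> g \<le> (\<Sum>\<^sub>\<infinity>j. \<beta> j * \<phi> j)"
    unfolding wnorm_def using w[unfolded wsum_def] assms(2) le by (rule infsum_mono)
qed

lemma wnorm_nonneg: "(\<And>j. 0 < \<beta> j) \<Longrightarrow> 0 \<le> wnorm \<beta> g"
  unfolding wnorm_def by (intro infsum_nonneg) (simp add: less_imp_le)

lemma wsum_lincomb:
  assumes "wsum \<beta> f" "wsum \<beta> g" "\<And>j. 0 < \<beta> j"
  shows "wsum \<beta> (\<lambda>j. a * f j + b * g j)"
    and "wnorm \<beta> (\<lambda>j. a * f j + b * g j) \<le> cmod a * wnorm \<beta> f + cmod b * wnorm \<beta> g"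
proof -
  let ?\<phi> = "\<lambda>j. cmod a * cmod (f j) + cmod b * cmod (g j)"
  have le: "cmod (a * f j + b * g j) \<le> ?\<phi> j" for j
    by (metis norm_mult norm_triangle_ineq)
  have eq: "(\<lambda>j. \<beta> j * ?\<phi> j) = (\<lambda>j. cmod a * (\<beta> j * cmod (f j)) + cmod b * (\<beta> j * cmod (g j)))"
    by (auto simp: algebra_simps)
  have sf: "(\<lambda>j. cmod a * (\<beta> j * cmod (f j))) summable_on UNIV"
    and sg: "(\<lambda>j. cmod b * (\<beta> j * cmod (g j))) summable_on UNIV"
    using assms(1,2) unfolding wsum_def by (auto intro: summable_on_cmult_right)
  have s: "(\<lambda>j. \<beta> j * ?\<phi> j) summable_on UNIV"
    unfolding eq using sf sg by (rule summable_on_add)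
  show "wsum \<beta> (\<lambda>j. a * f j + b * g j)" by (rule wsum_dominated(1)[OF le s assms(3)])
  have "wnorm \<beta> (\<lambda>j. a * f j + b * g j) \<le> (\<Sum>\<^sub>\<infinity>j. \<beta> j * ?\<phi> j)"
    by (rule wsum_dominated(2)[OF le s assms(3)])
  also have "\<dots> = cmod a * wnorm \<beta> f + cmod b * wnorm \<beta> g"
    unfolding eq wnorm_def by (subst infsum_add[OF sf sg]) (simp add: infsum_cmult_right')
  finally show "wnorm \<beta> (\<lambda>j. a * f j + b * g j) \<le> cmod a * wnorm \<beta> f + cmod b * wnorm \<beta> g" .
qed

lemma wsum_zero [simp]: "wsum \<beta> (\<lambda>_. 0)" "wnorm \<beta> (\<lambda>_. 0) = 0"
  by (simp_all add: wsum_def wnorm_def)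

lemma wsum_sum:
  assumes "finite F" "\<And>i. i \<in> F \<Longrightarrow> wsum \<beta> (e i)" "\<And>j. 0 < \<beta> j"
  shows "wsum \<beta> (\<lambda>j. \<Sum>i\<in>F. s i * e i j) \<and>
    wnorm \<beta> (\<lambda>j. \<Sum>i\<in>F. s i * e i j) \<le> (\<Sum>i\<in>F. cmod (s i) * wnorm \<beta> (e i))"
  using assms(1,2)
proof (induction F rule: finite_induct)
  case (insert i F)
  then have IH: "wsum \<beta> (\<lambda>j. \<Sum>i\<in>F. s i * e i j)"
    "wnorm \<beta> (\<lambda>j. \<Sum>i\<in>F. s i * e i j) \<le> (\<Sum>i\<in>F. cmod (s i) * wnorm \<beta> (e i))" by auto
  show ?case
    using wsum_lincomb[OF _ IH(1) assms(3), of "e i" "s i" 1] insert IH(2) by (auto intro: order_trans)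
qed auto

text \<open>The entrywise bound splits the two indices: \<open>A\<close> maps weighted l1 into
  sequences dominated by a multiple of \<open>\<alpha>\<close>, and the sum of
  \<open>\<beta> i * \<alpha> i\<close> bounds its operator norm. Being a convergent series, this
  bound becomes small when finitely many rows are dropped.\<close>

locale dominated_kernel =
  fixes A :: "'i \<Rightarrow> 'i \<Rightarrow> complex" and \<alpha> \<beta> :: "'i \<Rightarrow> real"
  assumes dom: "\<And>i j. cmod (A i j) \<le> \<alpha> i * \<beta> j"
    and \<beta>_pos: "\<And>j. 0 < \<beta> j"
    and trace: "(\<lambda>i. \<beta> i * \<alpha> i) summable_on UNIV"
begin

lemma kapp_bound:
  assumes "wsum \<beta> g"
  shows "(\<lambda>j. A i j * g j) summable_on UNIV" "cmod (kapp A g i) \<le> \<alpha> i * wnorm \<beta> g"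
  using has_sum_linear_bound[OF dom assms] by (auto simp: kapp_def)

lemma wsum_kapp:
  assumes "wsum \<beta> g"
  shows "wsum \<beta> (kapp A g)" "wnorm \<beta> (kapp A g) \<le> (\<Sum>\<^sub>\<infinity>i. \<beta> i * \<alpha> i) * wnorm \<beta> g"
proof -
  have s: "(\<lambda>i. \<beta> i * (\<alpha> i * wnorm \<beta> g)) summable_on UNIV"
    using summable_on_cmult_left[OF trace, of "wnorm \<beta> g"] by (simp add: mult.assoc)
  show "wsum \<beta> (kapp A g)"
    by (rule wsum_dominated(1)[OF kapp_bound(2)[OF assms] s \<beta>_pos])
  show "wnorm \<beta> (kapp A g) \<le> (\<Sum>\<^sub>\<infinity>i. \<beta> i * \<alpha> i) * wnorm \<beta> g"
    using wsum_dominated(2)[OF kapp_bound(2)[OF assms] s \<beta>_pos]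
    by (simp add: mult.assoc[symmetric] infsum_cmult_left')
qed

lemma kapp_lincomb:
  assumes "wsum \<beta> f" "wsum \<beta> g"
  shows "kapp A (\<lambda>j. a * f j + b * g j) i = a * kapp A f i + b * kapp A g i"
proof -
  have "kapp A (\<lambda>j. a * f j + b * g j) i = (\<Sum>\<^sub>\<infinity>j. a * (A i j * f j) + b * (A i j * g j))"
    unfolding kapp_def by (intro infsum_cong) (simp add: algebra_simps)
  also have "\<dots> = (\<Sum>\<^sub>\<infinity>j. a * (A i j * f j)) + (\<Sum>\<^sub>\<infinity>j. b * (A i j * g j))"
    by (intro infsum_add summable_on_cmult_right kapp_bound assms)
  finally show ?thesis by (simp add: kapp_def infsum_cmult_right')
qed

lemma kapp_sum:
  assumes "finite F" "\<And>i. i \<in> F \<Longrightarrow> wsum \<beta> (e i)"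
  shows "kapp A (\<lambda>j. \<Sum>i\<in>F. s i * e i j) k = (\<Sum>i\<in>F. s i * kapp A (e i) k)"
  using assms
proof (induction F rule: finite_induct)
  case empty then show ?case by (simp add: kapp_def)
next
  case (insert i F)
  have "wsum \<beta> (\<lambda>j. \<Sum>i\<in>F. s i * e i j)" using wsum_sum[of F \<beta> e s] insert \<beta>_pos by auto
  then show ?case using kapp_lincomb[of "e i" "\<lambda>j. \<Sum>i\<in>F. s i * e i j" "s i" 1 k] insert by simp
qed

text \<open>Take norms in g = f - A g and absorb the last term on the left.\<close>

lemma small_kernel_estimate:
  assumes q: "(\<Sum>\<^sub>\<infinity>i. \<beta> i * \<alpha> i) < 1" and g: "wsum \<beta> g" and f: "wsum \<beta> f"
    and eq: "\<And>i. g i + kapp A g i = f i"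
  shows "wnorm \<beta> g \<le> wnorm \<beta> f / (1 - (\<Sum>\<^sub>\<infinity>i. \<beta> i * \<alpha> i))"
proof -
  have g_eq: "g = (\<lambda>i. 1 * f i + (-1) * kapp A g i)"
    using eq by (auto simp: fun_eq_iff algebra_simps)
  have "wnorm \<beta> g \<le> wnorm \<beta> f + wnorm \<beta> (kapp A g)"
    using wsum_lincomb(2)[OF f wsum_kapp(1)[OF g] \<beta>_pos, of 1 "-1"] g_eq by simp
  also have "\<dots> \<le> wnorm \<beta> f + (\<Sum>\<^sub>\<infinity>i. \<beta> i * \<alpha> i) * wnorm \<beta> g"
    using wsum_kapp(2)[OF g] by simp
  finally show ?thesis using q by (simp add: field_simps)
qed

lemma wnorm_eq_0:
  assumes "wsum \<beta> g" "wnorm \<beta> g \<le> 0"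
  shows "g i = 0"
proof -
  have "\<beta> i * cmod (g i) = 0"
    using assms \<beta>_pos unfolding wsum_def wnorm_def
    by (intro nonneg_infsum_le_0D[of "\<lambda>j. \<beta> j * cmod (g j)" UNIV]) (auto simp: less_imp_le)
  then show ?thesis using \<beta>_pos[of i] by simp
qed

lemma small_kernel_unique:
  assumes q: "(\<Sum>\<^sub>\<infinity>i. \<beta> i * \<alpha> i) < 1" and g: "wsum \<beta> g" and h: "wsum \<beta> h"
    and eq: "\<And>i. g i + kapp A g i = h i + kapp A h i"
  shows "g = h"
proof -
  let ?d = "\<lambda>i. 1 * g i + (-1) * h i"
  have d: "wsum \<beta> ?d" by (rule wsum_lincomb(1)[OF g h \<beta>_pos])
  have "?d i + kapp A ?d i = 0" for i
    unfolding kapp_lincomb[OF g h] using eq[of i] by (simp add: algebra_simps)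
  then have "wnorm \<beta> ?d \<le> 0"
    using small_kernel_estimate[OF q d, of "\<lambda>_. 0"] by simp
  from wnorm_eq_0[OF d this] show ?thesis by (auto simp: fun_eq_iff)
qed

end

text \<open>The majorant is common to all z: it gives weighted summability at each z and, at the
  same time, the hypothesis of the Weierstrass test for sums against the family.\<close>

definition hol_family :: "complex set \<Rightarrow> ('i \<Rightarrow> real) \<Rightarrow> (complex \<Rightarrow> 'i \<Rightarrow> complex) \<Rightarrow> bool" where
  "hol_family \<Omega> \<beta> f \<longleftrightarrow> (\<forall>i. (\<lambda>z. f z i) holomorphic_on \<Omega>) \<and>
     (\<exists>\<phi>. (\<forall>z\<in>\<Omega>. \<forall>i. cmod (f z i) \<le> \<phi> i) \<and> (\<lambda>i. \<beta> i * \<phi> i) summable_on UNIV)"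

lemma hol_family_const: "wsum \<beta> f \<Longrightarrow> hol_family \<Omega> \<beta> (\<lambda>_. f)"
  unfolding hol_family_def wsum_def by (auto intro!: exI[of _ "\<lambda>i. cmod (f i)"])

lemma infsum_nat_Suc:
  fixes f :: "nat \<Rightarrow> complex"
  assumes "f summable_on UNIV"
  shows "infsum f UNIV = f 0 + (\<Sum>\<^sub>\<infinity>k. f (Suc k))"
proof -
  have "infsum f UNIV = infsum f ({0} \<union> range Suc)"
    by (metis UNIV_nat_eq insert_is_Un)
  also have "\<dots> = infsum f {0} + infsum f (range Suc)"
    using assms summable_on_subset_banach by (intro infsum_Un_disjoint) auto
  also have "infsum f (range Suc) = (\<Sum>\<^sub>\<infinity>k. f (Suc k))"
    by (subst infsum_reindex) (auto simp: o_def)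
  finally show ?thesis by simp
qed

locale kernel_family =
  fixes \<Omega> :: "complex set" and M :: "complex \<Rightarrow> 'i \<Rightarrow> 'i \<Rightarrow> complex" and \<alpha> \<beta> :: "'i \<Rightarrow> real"
  assumes open_dom: "open \<Omega>"
    and hol: "\<And>i j. (\<lambda>z. M z i j) holomorphic_on \<Omega>"
    and dom: "\<And>z i j. z \<in> \<Omega> \<Longrightarrow> cmod (M z i j) \<le> \<alpha> i * \<beta> j"
    and \<beta>_pos: "\<And>j. 0 < \<beta> j"
    and \<alpha>_nonneg: "\<And>i. 0 \<le> \<alpha> i"
    and trace: "(\<lambda>i. \<beta> i * \<alpha> i) summable_on UNIV"
begin

lemma dominated: "z \<in> \<Omega> \<Longrightarrow> dominated_kernel (M z) \<alpha> \<beta>"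
  using dom \<beta>_pos trace by unfold_locales

lemma hol_family_wsum:
  assumes "hol_family \<Omega> \<beta> f" "z \<in> \<Omega>"
  shows "wsum \<beta> (f z)"
proof -
  obtain \<phi> where "\<And>i. cmod (f z i) \<le> \<phi> i" "(\<lambda>i. \<beta> i * \<phi> i) summable_on UNIV"
    using assms unfolding hol_family_def by blast
  then show ?thesis using \<beta>_pos by (rule wsum_dominated(1))
qed

lemma hol_family_kapp:
  assumes "hol_family \<Omega> \<beta> f"
  shows "hol_family \<Omega> \<beta> (\<lambda>z. kapp (M z) (f z))"
proof -
  obtain \<phi> where \<phi>: "\<And>z i. z \<in> \<Omega> \<Longrightarrow> cmod (f z i) \<le> \<phi> i" "(\<lambda>i. \<beta> i * \<phi> i) summable_on UNIV"
    and fh: "\<And>i. (\<lambda>z. f z i) holomorphic_on \<Omega>"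
    using assms unfolding hol_family_def by blast
  have "(\<lambda>z. kapp (M z) (f z) i) holomorphic_on \<Omega>" for i
    unfolding kapp_def
  proof (rule holomorphic_on_infsum[OF open_dom])
    show "(\<lambda>z. M z i j * f z j) holomorphic_on \<Omega>" for j
      using hol fh by (intro holomorphic_intros)
    show "cmod (M z i j * f z j) \<le> \<alpha> i * (\<beta> j * \<phi> j)" if "z \<in> \<Omega>" for j z
      using mult_mono[OF dom[OF that, of i j] \<phi>(1)[OF that, of j]] \<alpha>_nonneg[of i] \<beta>_pos[of j]
      by (simp add: norm_mult mult.assoc)
    show "(\<lambda>j. \<alpha> i * (\<beta> j * \<phi> j)) summable_on UNIV"
      using \<phi>(2) by (rule summable_on_cmult_right)
  qed
  moreover have "cmod (kapp (M z) (f z) i) \<le> \<alpha> i * (\<Sum>\<^sub>\<infinity>i. \<beta> i * \<phi> i)" if "z \<in> \<Omega>" for z i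
  proof -
    have w: "wsum \<beta> (f z)" "wnorm \<beta> (f z) \<le> (\<Sum>\<^sub>\<infinity>i. \<beta> i * \<phi> i)"
      using wsum_dominated[OF \<phi>(1)[OF that] \<phi>(2) \<beta>_pos] by auto
    show ?thesis
      using dominated_kernel.kapp_bound(2)[OF dominated[OF that] w(1), of i]
        mult_left_mono[OF w(2) \<alpha>_nonneg[of i]] by linarith
  qed
  moreover have "(\<lambda>i. \<beta> i * (\<alpha> i * (\<Sum>\<^sub>\<infinity>i. \<beta> i * \<phi> i))) summable_on UNIV"
    using summable_on_cmult_left[OF trace] by (simp add: mult.assoc)
  ultimately show ?thesis unfolding hol_family_def
    by (intro conjI allI exI[of _ "\<lambda>i. \<alpha> i * (\<Sum>\<^sub>\<infinity>i. \<beta> i * \<phi> i)"]) auto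
qed

lemma hol_family_uminus: "hol_family \<Omega> \<beta> f \<Longrightarrow> hol_family \<Omega> \<beta> (\<lambda>z i. - f z i)"
  unfolding hol_family_def by (auto intro!: holomorphic_intros)

text \<open>The solution is the sum over k of (-M)^k f. Holomorphy and a majorant uniform in z come
  from the geometric decay of the norms, whose ratio q is the trace bound.\<close>

lemma neumann_series:
  assumes q1: "(\<Sum>\<^sub>\<infinity>i. \<beta> i * \<alpha> i) < 1" and f: "hol_family \<Omega> \<beta> f"
  obtains h where "hol_family \<Omega> \<beta> h" "\<And>z i. z \<in> \<Omega> \<Longrightarrow> h z i + kapp (M z) (h z) i = f z i"
proof -
  define q where "q = (\<Sum>\<^sub>\<infinity>i. \<beta> i * \<alpha> i)"
  have "0 \<le> q" unfolding q_def
    using \<beta>_pos \<alpha>_nonneg by (intro infsum_nonneg mult_nonneg_nonneg) (auto intro: less_imp_le)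
  then have q: "0 \<le> q" "q < 1" using q1 by (auto simp: q_def)
  obtain \<phi> where \<phi>: "\<And>z i. z \<in> \<Omega> \<Longrightarrow> cmod (f z i) \<le> \<phi> i" "(\<lambda>i. \<beta> i * \<phi> i) summable_on UNIV"
    and fh: "\<And>i. (\<lambda>z. f z i) holomorphic_on \<Omega>"
    using f unfolding hol_family_def by blast
  define Q where "Q = (\<Sum>\<^sub>\<infinity>i. \<beta> i * \<phi> i)"
  define t where "t k z = ((\<lambda>g i. - kapp (M z) g i) ^^ k) (f z)" for k z
  \<comment> \<open>The term k = 0 is split off: only the terms with k at least 1 lie in the image
    of the kernel and are therefore bounded pointwise by \<open>\<alpha> i\<close> times a geometric
    sequence. The term f itself has its own majorant.\<close>
  define u where "u k = t (Suc k)" for k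
  have t0: "t 0 = f" by (simp add: t_def fun_eq_iff)
  have tS: "t (Suc k) z = (\<lambda>i. - kapp (M z) (t k z) i)" for k z by (simp add: t_def)
  have t: "hol_family \<Omega> \<beta> (t k)" for k
  proof (induction k)
    case 0 then show ?case using f by (simp add: t0)
  next
    case (Suc k)
    have "t (Suc k) = (\<lambda>z i. - kapp (M z) (t k z) i)" by (simp add: fun_eq_iff tS)
    then show ?case using hol_family_uminus[OF hol_family_kapp[OF Suc]] by simp
  qed
  have tw: "wsum \<beta> (t k z)" if "z \<in> \<Omega>" for k z using hol_family_wsum[OF t that] .
  have tn: "wnorm \<beta> (t k z) \<le> q ^ k * Q" if z: "z \<in> \<Omega>" for k z
  proof (induction k)
    case 0 then show ?case
      using wsum_dominated(2)[OF \<phi>(1)[OF z] \<phi>(2) \<beta>_pos] by (simp add: t0 Q_def)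
  next
    case (Suc k)
    have "wnorm \<beta> (t (Suc k) z) = wnorm \<beta> (kapp (M z) (t k z))"
      by (simp add: tS wnorm_def)
    also have "\<dots> \<le> q * wnorm \<beta> (t k z)"
      using dominated_kernel.wsum_kapp(2)[OF dominated[OF z] tw[OF z]] by (simp add: q_def)
    also have "\<dots> \<le> q * (q ^ k * Q)" using Suc q by (intro mult_left_mono)
    finally show ?case by (simp add: mult.assoc)
  qed
  have ub: "cmod (u k z i) \<le> \<alpha> i * (q ^ k * Q)" if z: "z \<in> \<Omega>" for k z i
    using dominated_kernel.kapp_bound(2)[OF dominated[OF z] tw[OF z], of k i]
      mult_left_mono[OF tn[OF z, of k] \<alpha>_nonneg[of i]]
    by (simp add: u_def tS)
  have geo: "(\<lambda>k. q ^ k) summable_on UNIV"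
    using q by (intro norm_summable_imp_summable_on) (simp add: summable_geometric_iff)
  have us: "(\<lambda>k. c * (q ^ k * Q)) summable_on UNIV" for c
    by (intro summable_on_cmult_right summable_on_cmult_left geo)
  define S where "S = (\<Sum>\<^sub>\<infinity>k. q ^ k * Q)"
  define w where "w z i = (\<Sum>\<^sub>\<infinity>k. u k z i)" for z i
  have usum: "(\<lambda>k. u k z i) summable_on UNIV" if "z \<in> \<Omega>" for z i
    by (rule Infinite_Sum.abs_summable_summable,
        rule Infinite_Sum.abs_summable_on_comparison_test'[OF us[of "\<alpha> i"]]) (rule ub[OF that])
  have wb: "cmod (w z i) \<le> \<alpha> i * S" if z: "z \<in> \<Omega>" for z i
  proof -
    have abs: "(\<lambda>k. cmod (u k z i)) summable_on UNIV"
      using us[of "\<alpha> i"] ub[OF z] by (rule Infinite_Sum.abs_summable_on_comparison_test')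
    have "cmod (w z i) \<le> (\<Sum>\<^sub>\<infinity>k. cmod (u k z i))" unfolding w_def using abs by (rule norm_infsum_bound)
    also have "\<dots> \<le> (\<Sum>\<^sub>\<infinity>k. \<alpha> i * (q ^ k * Q))" using abs us[of "\<alpha> i"] ub[OF z] by (rule infsum_mono)
    finally show ?thesis by (simp add: S_def infsum_cmult_right')
  qed
  have ws: "(\<lambda>i. \<beta> i * (\<alpha> i * S)) summable_on UNIV"
    using summable_on_cmult_left[OF trace, of S] by (simp add: mult.assoc)
  have w: "hol_family \<Omega> \<beta> w"
    unfolding hol_family_def
  proof (intro conjI allI exI[of _ "\<lambda>i. \<alpha> i * S"])
    show "(\<lambda>z. w z i) holomorphic_on \<Omega>" for i
      unfolding w_def
    proof (rule holomorphic_on_infsum[OF open_dom])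
      show "(\<lambda>z. u k z i) holomorphic_on \<Omega>" for k
        using t[of "Suc k"] by (simp add: hol_family_def u_def)
      show "cmod (u k z i) \<le> \<alpha> i * (q ^ k * Q)" if "z \<in> \<Omega>" for k z
        by (rule ub[OF that])
      show "(\<lambda>k. \<alpha> i * (q ^ k * Q)) summable_on UNIV"
        by (rule us)
    qed
    show "\<forall>z\<in>\<Omega>. \<forall>i. cmod (w z i) \<le> \<alpha> i * S" using wb by blast
    show "(\<lambda>i. \<beta> i * (\<alpha> i * S)) summable_on UNIV" by (rule ws)
  qed
  define h where "h z i = 1 * f z i + 1 * w z i" for z i
  have "hol_family \<Omega> \<beta> h"
    unfolding hol_family_def
  proof (intro conjI allI exI[of _ "\<lambda>i. \<phi> i + \<alpha> i * S"])
    show "(\<lambda>z. h z i) holomorphic_on \<Omega>" for i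
      unfolding h_def using w fh[of i]
      by (intro holomorphic_on_add holomorphic_on_mult holomorphic_on_const) (auto simp: hol_family_def)
    show "\<forall>z\<in>\<Omega>. \<forall>i. cmod (h z i) \<le> \<phi> i + \<alpha> i * S"
      using \<phi>(1) wb by (auto simp: h_def intro!: norm_triangle_mono)
    show "(\<lambda>i. \<beta> i * (\<phi> i + \<alpha> i * S)) summable_on UNIV"
      unfolding distrib_left by (rule summable_on_add[OF \<phi>(2) ws])
  qed
  moreover have "h z i + kapp (M z) (h z) i = f z i" if z: "z \<in> \<Omega>" for z i
  proof -
    interpret dominated_kernel "M z" \<alpha> \<beta> using dominated[OF z] .
    have "kapp (M z) (w z) i = (\<Sum>\<^sub>\<infinity>j. \<Sum>\<^sub>\<infinity>k. M z i j * u k z j)"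
      by (simp add: kapp_def w_def infsum_cmult_right')
    also have "\<dots> = (\<Sum>\<^sub>\<infinity>k. \<Sum>\<^sub>\<infinity>j. M z i j * u k z j)"
    proof (rule infsum_swap_banach)
      \<comment> \<open>The majorant is a product of a summable function of j and a geometric
        sequence in k, which justifies exchanging the sums.\<close>
      let ?B = "\<lambda>(j, k). \<alpha> i * (\<beta> j * \<alpha> j) * (q ^ k * Q)"
      have "0 \<le> Q" using tn[OF z, of 0] wnorm_nonneg[of \<beta> "t 0 z"] \<beta>_pos by simp
      have "?B summable_on UNIV \<times> UNIV"
      proof (rule summable_on_SigmaI)
        show "((\<lambda>k. ?B (j, k)) has_sum \<alpha> i * (\<beta> j * \<alpha> j) * S) UNIV" for j
          unfolding S_def prod.case
          by (intro has_sum_cmult_right has_sum_infsum summable_on_cmult_left geo)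
        show "(\<lambda>j. \<alpha> i * (\<beta> j * \<alpha> j) * S) summable_on UNIV"
          by (intro summable_on_cmult_left summable_on_cmult_right trace)
        show "0 \<le> ?B (j, k)" for j k
          using \<open>0 \<le> Q\<close> \<alpha>_nonneg \<beta>_pos q by (auto simp: less_imp_le)
      qed
      moreover have "norm (case x of (j, k) \<Rightarrow> M z i j * u k z j) \<le> ?B x" for x
      proof (cases x)
        case (Pair j k)
        have "cmod (M z i j) * cmod (u k z j) \<le> (\<alpha> i * \<beta> j) * (\<alpha> j * (q ^ k * Q))"
          using dom[of i j] ub[OF z, of k j] \<alpha>_nonneg[of i] \<beta>_pos[of j]
          by (intro mult_mono) auto
        then show ?thesis using Pair by (simp add: norm_mult mult_ac)
      qed
      ultimately show "(\<lambda>(j, k). M z i j * u k z j) summable_on UNIV \<times> UNIV"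
        by (rule Infinite_Sum.abs_summable_summable[OF Infinite_Sum.abs_summable_on_comparison_test'])
    qed
    also have "\<dots> = - (\<Sum>\<^sub>\<infinity>k. u (Suc k) z i)"
      by (simp only: u_def tS kapp_def infsum_uminus mult_minus_right minus_minus)
    finally have Mw: "kapp (M z) (w z) i = - (\<Sum>\<^sub>\<infinity>k. u (Suc k) z i)" .
    have "w z i = u 0 z i + (\<Sum>\<^sub>\<infinity>k. u (Suc k) z i)"
      unfolding w_def by (rule infsum_nat_Suc[OF usum[OF z]])
    moreover have "u 0 z i = - kapp (M z) (f z) i" by (simp add: u_def tS t0)
    moreover have "kapp (M z) (h z) i = kapp (M z) (f z) i + kapp (M z) (w z) i"
      using kapp_lincomb[OF hol_family_wsum[OF f z] hol_family_wsum[OF w z], of 1 1 i]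
      by (simp add: h_def[abs_def])
    ultimately show ?thesis using Mw by (simp add: h_def)
  qed
  ultimately show ?thesis using that by blast
qed

end

section \<open>The analytic Fredholm alternative\<close>

context kernel_family
begin

lemma exists_small_tail:
  obtains F where "finite F" "(\<Sum>\<^sub>\<infinity>i. \<beta> i * (if i \<in> F then 0 else \<alpha> i)) < 1"
proof -
  let ?s = "\<lambda>i. \<beta> i * \<alpha> i"
  have "\<forall>\<^sub>F F in finite_subsets_at_top UNIV. dist (sum ?s F) (infsum ?s UNIV) < 1"
    using infsum_tendsto[OF trace] by (rule tendstoD) simp
  then obtain F where F: "finite F" "dist (sum ?s F) (infsum ?s UNIV) < 1"
    unfolding eventually_finite_subsets_at_top by blast
  have "(\<Sum>\<^sub>\<infinity>i. \<beta> i * (if i \<in> F then 0 else \<alpha> i)) = infsum ?s (UNIV - F)"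
    by (intro infsum_cong_neutral) auto
  also have "\<dots> = infsum ?s UNIV - infsum ?s F"
    using F trace by (intro infsum_Diff) auto
  finally show ?thesis
    using F that by (auto simp: dist_real_def infsum_finite)
qed

text \<open>
  Outside finitely many rows the kernel is a contraction; eliminating the remaining rows by the
  Neumann series leaves a finite linear system, to which Cramer's rule applies.
\<close>

lemma fredholm_alternative:
  obtains D :: "complex \<Rightarrow> complex" and c :: "complex \<Rightarrow> real" where
    "D holomorphic_on \<Omega>"
    "\<And>z. z \<in> \<Omega> \<Longrightarrow> D z = 0 \<Longrightarrow>
       \<exists>g. wsum \<beta> g \<and> g \<noteq> (\<lambda>_. 0) \<and> (\<forall>i. g i + kapp (M z) g i = 0)"
    "\<And>z g. z \<in> \<Omega> \<Longrightarrow> D z \<noteq> 0 \<Longrightarrow> wsum \<beta> g \<Longrightarrow> (\<And>i. g i + kapp (M z) g i = 0) \<Longrightarrow>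
       g = (\<lambda>_. 0)"
    "\<And>f. wsum \<beta> f \<Longrightarrow> \<exists>H. (\<forall>i. (\<lambda>z. H z i) holomorphic_on \<Omega>) \<and>
       (\<forall>z\<in>\<Omega>. wsum \<beta> (H z) \<and> wnorm \<beta> (H z) \<le> c z * wnorm \<beta> f \<and>
         (\<forall>i. H z i + kapp (M z) (H z) i = D z * f i))"
proof -
  obtain F where F: "finite F" "(\<Sum>\<^sub>\<infinity>i. \<beta> i * (if i \<in> F then 0 else \<alpha> i)) < 1"
    by (rule exists_small_tail)
  \<comment> \<open>Rows and not columns are removed: this sets \<open>\<alpha> i\<close> to 0 on F
    while the weight \<open>\<beta>\<close>, and with it the space, is unchanged.\<close>
  define \<alpha>1 where "\<alpha>1 i = (if i \<in> F then 0 else \<alpha> i)" for i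
  define M1 where "M1 z i j = (if i \<in> F then 0 else M z i j)" for z i j
  define q where "q = (\<Sum>\<^sub>\<infinity>i. \<beta> i * \<alpha>1 i)"
  have q: "q < 1" using F(2) by (simp add: q_def \<alpha>1_def)
  interpret small: kernel_family \<Omega> M1 \<alpha>1 \<beta>
  proof
    show "(\<lambda>z. M1 z i j) holomorphic_on \<Omega>" for i j
      using hol by (cases "i \<in> F") (auto simp: M1_def)
    show "(\<lambda>i. \<beta> i * \<alpha>1 i) summable_on UNIV"
      using trace by (rule summable_on_comparison_test)
        (use \<beta>_pos \<alpha>_nonneg in \<open>auto simp: \<alpha>1_def less_imp_le\<close>)
  qed (use open_dom \<beta>_pos \<alpha>_nonneg dom in \<open>auto simp: \<alpha>1_def M1_def\<close>)
  have split: "kapp (M z) g i = kapp (M1 z) g i + (if i \<in> F then kapp (M z) g i else 0)" for z g i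
    by (simp add: kapp_def M1_def)
  define \<delta> where "\<delta> j i = (if i = j then 1 else 0 :: complex)" for j i :: 'i
  have "wsum \<beta> (\<delta> j)" for j
  proof -
    have "(\<lambda>i. \<beta> i * cmod (\<delta> j i)) summable_on UNIV \<longleftrightarrow> (\<lambda>i. \<beta> i * cmod (\<delta> j i)) summable_on {j}"
      by (intro summable_on_cong_neutral) (auto simp: \<delta>_def)
    then show ?thesis by (simp add: wsum_def)
  qed
  \<comment> \<open>\<open>E j z\<close> will be the inverse of 1 + \<open>M1 z\<close> applied to
    the unit vector at j.\<close>
  then have "\<exists>h. hol_family \<Omega> \<beta> h \<and> (\<forall>z\<in>\<Omega>. \<forall>i. h z i + kapp (M1 z) (h z) i = \<delta> j i)" for j
    using small.neumann_series[OF q[unfolded q_def] hol_family_const[of \<beta> "\<delta> j"]] by metis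
  then obtain E where E: "\<And>j. hol_family \<Omega> \<beta> (E j)"
    and E_eq: "\<And>j z i. z \<in> \<Omega> \<Longrightarrow> E j z i + kapp (M1 z) (E j z) i = \<delta> j i"
    by metis
  have Ew: "wsum \<beta> (E j z)" if "z \<in> \<Omega>" for j z using hol_family_wsum[OF E that] .
  \<comment> \<open>The reduced unknowns are the numbers s_i = \<open>kapp (M z) g i\<close> for i
    in F. A homogeneous solution has (1 + M1) g equal to minus s on F and 0 elsewhere, so g is minus
    the sum of s_j \<open>E j z\<close>. Inserting this into row i gives s_i plus the sum of B_ij
    s_j equal to 0, the system with matrix \<open>a\<close>. The combination \<open>G s z\<close>
    below is this g.\<close>
  define B where "B z i j = kapp (M z) (E j z) i" for z i j
  define a where "a z i j = (if i = j then 1 else 0) + B z i j" for z i j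
  have "(\<lambda>z. B z i j) holomorphic_on \<Omega>" for i j
    using hol_family_kapp[OF E[of j]] by (simp add: hol_family_def B_def)
  then have ah: "(\<lambda>z. a z i j) holomorphic_on \<Omega>" for i j
    unfolding a_def by (intro holomorphic_intros)
  obtain D adj where D: "D holomorphic_on \<Omega>"
    and adj: "\<And>i j. i \<in> F \<Longrightarrow> j \<in> F \<Longrightarrow> (\<lambda>z. adj z i j) holomorphic_on \<Omega>"
    and cramer1: "\<And>z i j. i \<in> F \<Longrightarrow> j \<in> F \<Longrightarrow> (\<Sum>k\<in>F. a z i k * adj z k j) = (if i = j then D z else 0)"
    and cramer2: "\<And>z i j. i \<in> F \<Longrightarrow> j \<in> F \<Longrightarrow> (\<Sum>k\<in>F. adj z i k * a z k j) = (if i = j then D z else 0)"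
    and sing: "\<And>z. D z = 0 \<Longrightarrow> \<exists>s. (\<exists>i\<in>F. s i \<noteq> 0) \<and> (\<forall>i\<in>F. (\<Sum>k\<in>F. a z i k * s k) = 0)"
    using holomorphic_cramer[where a = a, OF F(1) ah] by blast
  have a_sum: "(\<Sum>k\<in>F. a z i k * s k) = s i + (\<Sum>k\<in>F. s k * B z i k)" if "i \<in> F" for z s i
  proof -
    have "(\<Sum>k\<in>F. a z i k * s k) = (\<Sum>k\<in>F. (if i = k then s k else 0) + s k * B z i k)"
      by (intro sum.cong) (auto simp: a_def algebra_simps)
    then show ?thesis using that F(1) by (simp add: sum.distrib)
  qed
  define G where "G s z i = (\<Sum>j\<in>F. - s j * E j z i)" for s z i
  have Gw: "wsum \<beta> (G s z)" "wnorm \<beta> (G s z) \<le> (\<Sum>j\<in>F. cmod (s j) * wnorm \<beta> (E j z))"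
    if "z \<in> \<Omega>" for s z
    using wsum_sum[OF F(1) Ew[OF that] \<beta>_pos, where s = "\<lambda>j. - s j"] by (auto simp: G_def[abs_def])
  have G_M: "kapp (M z) (G s z) i = - (\<Sum>j\<in>F. s j * B z i j)" if "z \<in> \<Omega>" for s z i
    using dominated_kernel.kapp_sum[OF dominated[OF that] F(1) Ew[OF that], where s = "\<lambda>j. - s j"]
    by (simp add: G_def[abs_def] B_def sum_negf)
  have G_M1: "G s z i + kapp (M1 z) (G s z) i = (if i \<in> F then - s i else 0)" if "z \<in> \<Omega>" for s z i
  proof -
    have "G s z i + kapp (M1 z) (G s z) i = (\<Sum>j\<in>F. - s j * (E j z i + kapp (M1 z) (E j z) i))"
      using dominated_kernel.kapp_sum[OF small.dominated[OF that] F(1) Ew[OF that], where s = "\<lambda>j. - s j"]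
      by (simp add: G_def[abs_def] sum.distrib[symmetric] distrib_left)
    also have "\<dots> = (\<Sum>j\<in>F. if j = i then - s i else 0)"
      by (intro sum.cong) (auto simp: E_eq[OF that] \<delta>_def)
    finally show ?thesis using F(1) by (simp add: sum.delta)
  qed
  show ?thesis
  \<comment> \<open>The constant must not depend on f, since it later yields boundedness of the
    resolvent. The factor 1 / (1 - q) bounds \<open>S\<close> by f; the sum bounds the correction
    \<open>G\<close> through the entries of \<open>adj\<close>, the row bounds
    \<open>\<alpha> k\<close> and the norms of \<open>E j z\<close>.\<close>
  proof (rule that[of D "\<lambda>z. (cmod (D z) + (\<Sum>j\<in>F. (\<Sum>k\<in>F. cmod (adj z j k) * \<alpha> k) * wnorm \<beta> (E j z))) / (1 - q)"])
    show "D holomorphic_on \<Omega>" by (rule D)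
  next
    fix z assume z: "z \<in> \<Omega>" and Dz: "D z = 0"
    obtain s where s: "\<exists>i\<in>F. s i \<noteq> 0" "\<And>i. i \<in> F \<Longrightarrow> (\<Sum>k\<in>F. a z i k * s k) = 0"
      using sing[OF Dz] by blast
    have Ms: "kapp (M z) (G s z) i = s i" if "i \<in> F" for i
      using s(2)[OF that] a_sum[OF that, of z s] G_M[OF z, of s i] by (simp add: add_eq_0_iff)
    have "G s z i + kapp (M z) (G s z) i = 0" for i
      using split[of z "G s z" i] G_M1[OF z, of s i] Ms[of i] by (cases "i \<in> F") auto
    moreover have "G s z \<noteq> (\<lambda>_. 0)"
    proof
      assume "G s z = (\<lambda>_. 0)"
      then have "kapp (M z) (G s z) i = 0" for i by (simp add: kapp_def)
      then show False using Ms s(1) by auto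
    qed
    ultimately show "\<exists>g. wsum \<beta> g \<and> g \<noteq> (\<lambda>_. 0) \<and> (\<forall>i. g i + kapp (M z) g i = 0)"
      using Gw(1)[OF z] by blast
  next
    fix z g assume z: "z \<in> \<Omega>" and Dz: "D z \<noteq> 0" and g: "wsum \<beta> g"
      and eq: "\<And>i. g i + kapp (M z) g i = 0"
    define s where "s = kapp (M z) g"
    have "g i + kapp (M1 z) g i = G s z i + kapp (M1 z) (G s z) i" for i
    proof -
      have "g i = - kapp (M z) g i" using eq[of i] by (simp add: eq_neg_iff_add_eq_0)
      moreover have "kapp (M1 z) g i = (if i \<in> F then 0 else kapp (M z) g i)"
        by (simp add: kapp_def M1_def)
      ultimately show ?thesis
        using G_M1[OF z, of s i] by (cases "i \<in> F") (simp_all add: s_def)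
    qed
    then have gG: "g = G s z"
      by (rule dominated_kernel.small_kernel_unique[OF small.dominated[OF z] q[unfolded q_def] g Gw(1)[OF z]])
    have as: "(\<Sum>k\<in>F. a z i k * s k) = 0" if "i \<in> F" for i
    proof -
      have "s i = kapp (M z) (G s z) i" by (subst gG[symmetric]) (simp add: s_def)
      then show ?thesis unfolding a_sum[OF that] G_M[OF z] by simp
    qed
    \<comment> \<open>Multiply a s = 0 from the left by the adjugate, which gives D s = 0.\<close>
    have "s k = 0" if k: "k \<in> F" for k
    proof -
      have "D z * s k = (\<Sum>j\<in>F. (if k = j then D z else 0) * s j)"
        using k F(1) by (simp add: if_distrib[of "\<lambda>x. x * _"] cong: if_cong)
      also have "\<dots> = (\<Sum>j\<in>F. \<Sum>i\<in>F. adj z k i * a z i j * s j)"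
        using cramer2[OF k] by (intro sum.cong) (auto simp flip: sum_distrib_right)
      also have "\<dots> = (\<Sum>i\<in>F. adj z k i * (\<Sum>j\<in>F. a z i j * s j))"
        by (subst sum.swap) (simp add: sum_distrib_left mult.assoc)
      also have "\<dots> = 0" using as by simp
      finally show ?thesis using Dz by simp
    qed
    then show "g = (\<lambda>_. 0)" unfolding gG by (simp add: G_def fun_eq_iff)
  next
    fix f assume f: "wsum \<beta> f"
    obtain S where S: "hol_family \<Omega> \<beta> S"
      and S_eq: "\<And>z i. z \<in> \<Omega> \<Longrightarrow> S z i + kapp (M1 z) (S z) i = f i"
      using small.neumann_series[OF q[unfolded q_def] hol_family_const[OF f]] by metis
    define b where "b z i = kapp (M z) (S z) i" for z i
    have bh: "(\<lambda>z. b z i) holomorphic_on \<Omega>" for i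
      using hol_family_kapp[OF S] by (simp add: hol_family_def b_def)
    \<comment> \<open>With data f the reduced system is a s = b. The vector \<open>\<sigma>\<close>
      = adj b satisfies a sigma = D b, so it is D times the solution, formed without division.
      Accordingly \<open>H\<close> is D times the solution of the full system:
      \<open>D z * S z i\<close> accounts for f and \<open>G (\<sigma> z) z\<close> for the rows in
      F.\<close>
    define \<sigma> where "\<sigma> z i = (\<Sum>k\<in>F. adj z i k * b z k)" for z i
    have \<sigma>h: "(\<lambda>z. \<sigma> z i) holomorphic_on \<Omega>" if "i \<in> F" for i
      unfolding \<sigma>_def by (intro holomorphic_intros adj bh that)
    define H where "H z i = D z * S z i + 1 * G (\<sigma> z) z i" for z i
    show "\<exists>H. (\<forall>i. (\<lambda>z. H z i) holomorphic_on \<Omega>) \<and>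
       (\<forall>z\<in>\<Omega>. wsum \<beta> (H z) \<and> wnorm \<beta> (H z) \<le> (cmod (D z) + (\<Sum>j\<in>F. (\<Sum>k\<in>F. cmod (adj z j k) * \<alpha> k) *
           wnorm \<beta> (E j z))) / (1 - q) * wnorm \<beta> f \<and>
         (\<forall>i. H z i + kapp (M z) (H z) i = D z * f i))"
    proof (intro exI[of _ H] conjI allI ballI)
      fix i
      have "(\<lambda>z. S z i) holomorphic_on \<Omega>" "\<And>j. (\<lambda>z. E j z i) holomorphic_on \<Omega>"
        using S E by (auto simp: hol_family_def)
      then show "(\<lambda>z. H z i) holomorphic_on \<Omega>"
        unfolding H_def G_def using D \<sigma>h
        by (intro holomorphic_on_add holomorphic_on_mult holomorphic_on_const holomorphic_on_sum
            holomorphic_on_minus)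
    next
      fix z assume z: "z \<in> \<Omega>"
      interpret K: dominated_kernel "M z" \<alpha> \<beta> using dominated[OF z] .
      interpret K1: dominated_kernel "M1 z" \<alpha>1 \<beta> using small.dominated[OF z] .
      have Sw: "wsum \<beta> (S z)" using hol_family_wsum[OF S z] .
      have H_abs: "H z = (\<lambda>i. D z * S z i + 1 * G (\<sigma> z) z i)" by (simp add: H_def fun_eq_iff)
      show "wsum \<beta> (H z)" unfolding H_abs by (rule wsum_lincomb(1)[OF Sw Gw(1)[OF z] \<beta>_pos])
      have Sn: "wnorm \<beta> (S z) \<le> wnorm \<beta> f / (1 - q)"
        unfolding q_def by (rule K1.small_kernel_estimate[OF q[unfolded q_def] Sw f S_eq[OF z]])
      have \<sigma>b: "cmod (\<sigma> z j) \<le> (\<Sum>k\<in>F. cmod (adj z j k) * \<alpha> k) * wnorm \<beta> (S z)" for j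
      proof -
        have "cmod (\<sigma> z j) \<le> (\<Sum>k\<in>F. cmod (adj z j k * b z k))"
          unfolding \<sigma>_def by (rule norm_sum)
        also have "\<dots> \<le> (\<Sum>k\<in>F. cmod (adj z j k) * (\<alpha> k * wnorm \<beta> (S z)))"
          using K.kapp_bound(2)[OF Sw] by (intro sum_mono) (auto simp: norm_mult b_def intro: mult_left_mono)
        finally show ?thesis by (simp add: sum_distrib_right mult.assoc)
      qed
      define C where "C = (\<Sum>j\<in>F. (\<Sum>k\<in>F. cmod (adj z j k) * \<alpha> k) * wnorm \<beta> (E j z))"
      have "wnorm \<beta> (G (\<sigma> z) z) \<le> (\<Sum>j\<in>F. cmod (\<sigma> z j) * wnorm \<beta> (E j z))"
        by (rule Gw(2)[OF z])
      also have "\<dots> \<le> (\<Sum>j\<in>F. (\<Sum>k\<in>F. cmod (adj z j k) * \<alpha> k) * wnorm \<beta> (S z) * wnorm \<beta> (E j z))"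
        using \<sigma>b wnorm_nonneg[OF \<beta>_pos] by (intro sum_mono mult_right_mono)
      also have "\<dots> = C * wnorm \<beta> (S z)"
        unfolding C_def by (subst sum_distrib_right, intro sum.cong refl) (simp only: mult_ac)
      finally have "wnorm \<beta> (G (\<sigma> z) z) \<le> C * wnorm \<beta> (S z)" .
      then have "wnorm \<beta> (H z) \<le> (cmod (D z) + C) * wnorm \<beta> (S z)"
        unfolding H_abs using wsum_lincomb(2)[OF Sw Gw(1)[OF z] \<beta>_pos, of "D z" 1 "\<sigma> z"]
        by (simp add: distrib_right)
      also have "\<dots> \<le> (cmod (D z) + C) * (wnorm \<beta> f / (1 - q))"
        unfolding C_def using Sn \<alpha>_nonneg wnorm_nonneg[OF \<beta>_pos]
        by (intro mult_left_mono add_nonneg_nonneg sum_nonneg mult_nonneg_nonneg) auto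
      finally show "wnorm \<beta> (H z) \<le> (cmod (D z) + (\<Sum>j\<in>F. (\<Sum>k\<in>F. cmod (adj z j k) * \<alpha> k) *
           wnorm \<beta> (E j z))) / (1 - q) * wnorm \<beta> f" by (simp add: C_def)
      fix i
      have MH: "kapp (M z) (H z) i = D z * b z i - (\<Sum>j\<in>F. \<sigma> z j * B z i j)"
        unfolding H_abs K.kapp_lincomb[OF Sw Gw(1)[OF z]] G_M[OF z] by (simp add: b_def)
      have M1H: "H z i + kapp (M1 z) (H z) i = D z * f i + (if i \<in> F then - \<sigma> z i else 0)"
        unfolding H_abs K1.kapp_lincomb[OF Sw Gw(1)[OF z]]
        using S_eq[OF z, of i] G_M1[OF z, of "\<sigma> z" i] by (simp add: algebra_simps flip: distrib_left)
      have "kapp (M z) (H z) i = \<sigma> z i" if i: "i \<in> F"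
      proof -
        have "(\<Sum>j\<in>F. a z i j * \<sigma> z j) = (\<Sum>j\<in>F. \<Sum>k\<in>F. a z i j * adj z j k * b z k)"
          by (simp add: \<sigma>_def sum_distrib_left mult.assoc)
        also have "\<dots> = (\<Sum>k\<in>F. (\<Sum>j\<in>F. a z i j * adj z j k) * b z k)"
          by (subst sum.swap) (simp add: sum_distrib_right)
        also have "\<dots> = (\<Sum>k\<in>F. (if i = k then D z else 0) * b z k)"
          using cramer1[OF i] by (intro sum.cong) auto
        also have "\<dots> = D z * b z i"
          using i F(1) by (simp add: if_distrib[of "\<lambda>x. x * _"] cong: if_cong)
        finally show ?thesis unfolding MH using a_sum[OF i, of z "\<sigma> z"] by (simp add: algebra_simps)
      qed
      then show "H z i + kapp (M z) (H z) i = D z * f i"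
        using split[of z "H z" i] M1H by (cases "i \<in> F") (auto simp: algebra_simps)
    qed
  qed
qed

end

section \<open>Operators between weighted sequence spaces\<close>

abbreviation ell2_term :: "real \<Rightarrow> (int \<Rightarrow> complex) \<Rightarrow> int \<Rightarrow> real" where
  "ell2_term a x n \<equiv> exp (a * real_of_int \<bar>n\<bar>) * (cmod (x n))\<^sup>2"

lemma ell2_norm_nonneg: "0 \<le> ell2_norm a x"
  unfolding ell2_norm_def by (intro real_sqrt_ge_zero infsum_nonneg) simp

lemma ell2_norm_sq: "(ell2_norm a x)\<^sup>2 = (\<Sum>\<^sub>\<infinity>n. ell2_term a x n)"
  unfolding ell2_norm_def by (intro real_sqrt_pow2 infsum_nonneg) simp

lemma ell2_dominated:
  assumes "\<And>n. ell2_term a x n \<le> B n" "B summable_on UNIV"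
  shows "x \<in> ell2 a" "(ell2_norm a x)\<^sup>2 \<le> (\<Sum>\<^sub>\<infinity>n. B n)"
proof -
  have s: "ell2_term a x summable_on UNIV"
    using assms(2,1) by (rule summable_on_comparison_test) simp
  then show "x \<in> ell2 a" by (simp add: ell2_def)
  show "(ell2_norm a x)\<^sup>2 \<le> (\<Sum>\<^sub>\<infinity>n. B n)"
    unfolding ell2_norm_sq using s assms(2,1) by (rule infsum_mono)
qed

lemma ell2_coord_bound:
  assumes "x \<in> ell2 a"
  shows "cmod (x n) \<le> exp (- a * real_of_int \<bar>n\<bar> / 2) * ell2_norm a x"
proof -
  have "sum (ell2_term a x) {n} \<le> (\<Sum>\<^sub>\<infinity>n. ell2_term a x n)"
    using assms by (intro finite_sum_le_infsum) (auto simp: ell2_def)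
  then have "ell2_term a x n \<le> (ell2_norm a x)\<^sup>2" by (simp add: ell2_norm_sq)
  moreover have "ell2_term a x n = (exp (a * real_of_int \<bar>n\<bar> / 2) * cmod (x n))\<^sup>2"
    by (simp add: power_mult_distrib flip: exp_double)
  ultimately have "exp (a * real_of_int \<bar>n\<bar> / 2) * cmod (x n) \<le> ell2_norm a x"
    using ell2_norm_nonneg by (metis power2_le_imp_le)
  then have "exp (- a * real_of_int \<bar>n\<bar> / 2) * (exp (a * real_of_int \<bar>n\<bar> / 2) * cmod (x n)) \<le>
      exp (- a * real_of_int \<bar>n\<bar> / 2) * ell2_norm a x"
    by (intro mult_left_mono) auto
  then show ?thesis by (simp add: exp_minus field_simps)
qed

lemma ell2_scale:
  assumes "x \<in> ell2 a"
  shows "(\<lambda>n. c * x n) \<in> ell2 a" "ell2_norm a (\<lambda>n. c * x n) = cmod c * ell2_norm a x"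
proof -
  have eq: "ell2_term a (\<lambda>n. c * x n) = (\<lambda>n. (cmod c)\<^sup>2 * ell2_term a x n)"
    by (auto simp: norm_mult power_mult_distrib)
  then show "(\<lambda>n. c * x n) \<in> ell2 a"
    using assms by (auto simp: ell2_def intro: summable_on_cmult_right)
  show "ell2_norm a (\<lambda>n. c * x n) = cmod c * ell2_norm a x"
    unfolding ell2_norm_def eq infsum_cmult_right' by (simp add: real_sqrt_mult)
qed

text \<open>The factor 2 comes from (a + b)^2 <= 2 a^2 + 2 b^2; only boundedness of operators is at
  stake, so the size of the constant is immaterial.\<close>

lemma ell2_add:
  assumes "x \<in> ell2 a" "y \<in> ell2 a"
  shows "(\<lambda>n. x n + y n) \<in> ell2 a"
    and "ell2_norm a (\<lambda>n. x n + y n) \<le> 2 * (ell2_norm a x + ell2_norm a y)"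
proof -
  have le: "ell2_term a (\<lambda>n. x n + y n) n \<le> 2 * ell2_term a x n + 2 * ell2_term a y n" for n
  proof -
    have "(cmod (x n + y n))\<^sup>2 \<le> (cmod (x n) + cmod (y n))\<^sup>2"
      by (intro power_mono norm_triangle_ineq) simp
    also have "\<dots> \<le> 2 * (cmod (x n))\<^sup>2 + 2 * (cmod (y n))\<^sup>2"
      using sum_squares_bound[of "cmod (x n)" "cmod (y n)"] by (simp add: power2_sum)
    finally have "exp (a * real_of_int \<bar>n\<bar>) * (cmod (x n + y n))\<^sup>2 \<le>
        exp (a * real_of_int \<bar>n\<bar>) * (2 * (cmod (x n))\<^sup>2 + 2 * (cmod (y n))\<^sup>2)"
      by (rule mult_left_mono) simp
    then show ?thesis by (simp add: algebra_simps)
  qed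
  have sx: "(\<lambda>n. 2 * ell2_term a x n) summable_on UNIV"
    and sy: "(\<lambda>n. 2 * ell2_term a y n) summable_on UNIV"
    using assms by (auto simp: ell2_def intro: summable_on_cmult_right)
  note d = ell2_dominated[OF le summable_on_add[OF sx sy]]
  show "(\<lambda>n. x n + y n) \<in> ell2 a" by (rule d(1))
  have "(ell2_norm a (\<lambda>n. x n + y n))\<^sup>2 \<le> 2 * (ell2_norm a x)\<^sup>2 + 2 * (ell2_norm a y)\<^sup>2"
    using d(2) unfolding infsum_add[OF sx sy] by (simp add: ell2_norm_sq infsum_cmult_right')
  also have "\<dots> \<le> (2 * (ell2_norm a x + ell2_norm a y))\<^sup>2"
    using ell2_norm_nonneg[of a x] ell2_norm_nonneg[of a y]
    by (simp add: power_mult_distrib power2_sum)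
  finally show "ell2_norm a (\<lambda>n. x n + y n) \<le> 2 * (ell2_norm a x + ell2_norm a y)"
    by (rule power2_le_imp_le) (simp add: ell2_norm_nonneg)
qed

lemma bounded_op_bound:
  assumes "bounded_op a b T"
  obtains C where "0 \<le> C" "\<And>x. x \<in> ell2 a \<Longrightarrow> ell2_norm b (T x) \<le> C * ell2_norm a x"
proof -
  obtain C where C: "\<And>x. x \<in> ell2 a \<Longrightarrow> ell2_norm b (T x) \<le> C * ell2_norm a x"
    using assms unfolding bounded_op_def by blast
  show ?thesis
  proof (rule that[of "\<bar>C\<bar>"])
    fix x assume "x \<in> ell2 a"
    then show "ell2_norm b (T x) \<le> \<bar>C\<bar> * ell2_norm a x"
      using C mult_right_mono[OF abs_ge_self[of C] ell2_norm_nonneg[of a x]] by fastforce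
  qed simp
qed

lemma bounded_op_lincomb:
  assumes S: "bounded_op a b S" and T: "bounded_op a b T"
  shows "bounded_op a b (\<lambda>x n. c * S x n + d * T x n)"
proof -
  obtain C where C: "\<And>x. x \<in> ell2 a \<Longrightarrow> ell2_norm b (S x) \<le> C * ell2_norm a x"
    using bounded_op_bound[OF S] by blast
  obtain D where D: "\<And>x. x \<in> ell2 a \<Longrightarrow> ell2_norm b (T x) \<le> D * ell2_norm a x"
    using bounded_op_bound[OF T] by blast
  have ST: "S x \<in> ell2 b" "T x \<in> ell2 b" if "x \<in> ell2 a" for x
    using S T that by (auto simp: bounded_op_def)
  have "ell2_norm b (\<lambda>n. c * S x n + d * T x n) \<le> (2 * (cmod c * C + cmod d * D)) * ell2_norm a x"
    if x: "x \<in> ell2 a" for x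
  proof -
    have "ell2_norm b (\<lambda>n. c * S x n + d * T x n) \<le>
        2 * (cmod c * ell2_norm b (S x) + cmod d * ell2_norm b (T x))"
      using ell2_add(2)[OF ell2_scale(1)[OF ST(1)[OF x]] ell2_scale(1)[OF ST(2)[OF x]], of c d]
      by (simp add: ell2_scale(2)[OF ST(1)[OF x]] ell2_scale(2)[OF ST(2)[OF x]])
    also have "\<dots> \<le> 2 * (cmod c * (C * ell2_norm a x) + cmod d * (D * ell2_norm a x))"
      by (intro mult_left_mono add_mono C D x) auto
    finally show ?thesis by (simp add: algebra_simps)
  qed
  moreover have "(\<lambda>n. c * S x n + d * T x n) \<in> ell2 b" if "x \<in> ell2 a" for x
    by (intro ell2_add(1) ell2_scale(1) ST that)
  moreover have "c * S (\<lambda>n. x n + y n) n + d * T (\<lambda>n. x n + y n) n =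
      (c * S x n + d * T x n) + (c * S y n + d * T y n)" if "x \<in> ell2 a" "y \<in> ell2 a" for x y n
    using S T that by (simp add: bounded_op_def algebra_simps)
  moreover have "c * S (\<lambda>n. e * x n) n + d * T (\<lambda>n. e * x n) n = e * (c * S x n + d * T x n)"
    if "x \<in> ell2 a" for x n e
    using S T that by (simp add: bounded_op_def algebra_simps)
  ultimately show ?thesis unfolding bounded_op_def by blast
qed

lemma op_norm_bound:
  assumes T: "bounded_op a b T" and x: "x \<in> ell2 a"
  shows "ell2_norm b (T x) \<le> op_norm a b T * ell2_norm a x"
proof (cases "ell2_norm a x = 0")
  case True
  then show ?thesis using bounded_op_bound[OF T] x by (metis mult_zero_right)
next
  case False
  define r where "r = ell2_norm a x"
  have r: "r > 0" using False ell2_norm_nonneg[of a x] by (simp add: r_def)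
  obtain C where C: "0 \<le> C" "\<And>x. x \<in> ell2 a \<Longrightarrow> ell2_norm b (T x) \<le> C * ell2_norm a x"
    using bounded_op_bound[OF T] by blast
  let ?y = "\<lambda>n. complex_of_real (1 / r) * x n"
  have y: "?y \<in> ell2 a" "ell2_norm a ?y \<le> 1"
    using ell2_scale[OF x, of "complex_of_real (1 / r)"] r by (auto simp: r_def norm_divide)
  have "T ?y = (\<lambda>n. complex_of_real (1 / r) * T x n)"
    using T x unfolding bounded_op_def by blast
  moreover have "T x \<in> ell2 b" using T x by (simp add: bounded_op_def)
  ultimately have "ell2_norm b (T ?y) = ell2_norm b (T x) / r"
    using ell2_scale(2)[of "T x" b "complex_of_real (1 / r)"] r by (simp add: norm_divide)
  moreover have "ell2_norm b (T ?y) \<le> op_norm a b T"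
    unfolding op_norm_def
  proof (rule cSUP_upper)
    show "bdd_above ((\<lambda>x. ell2_norm b (T x)) ` {x \<in> ell2 a. ell2_norm a x \<le> 1})"
    proof (rule bdd_aboveI2)
      fix x assume "x \<in> {x \<in> ell2 a. ell2_norm a x \<le> 1}"
      then show "ell2_norm b (T x) \<le> C"
        using C(2)[of x] mult_left_mono[of "ell2_norm a x" 1 C] C(1) by auto
    qed
  qed (use y in simp)
  ultimately show ?thesis using r by (simp add: r_def field_simps)
qed

text \<open>Evaluating at x and taking the coordinate n is bounded by the operator norm up to a
  constant depending on x and n, so difference quotients converging in operator norm converge in
  each coordinate.\<close>

lemma op_holomorphic_on_coordinate:
  assumes "op_holomorphic_on a b G U" "open U" and x: "x \<in> ell2 a"
  shows "(\<lambda>k. G k x n) holomorphic_on U"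
  unfolding holomorphic_on_open[OF assms(2)]
proof (intro ballI)
  fix k assume k: "k \<in> U"
  have Gb: "bounded_op a b (G k')" if "k' \<in> U" for k'
    using assms(1) that by (simp add: op_holomorphic_on_def)
  obtain D where D: "bounded_op a b D"
    and lim: "((\<lambda>h. op_norm a b (\<lambda>x n. (G (k + h) x n - G k x n) / h - D x n)) \<longlongrightarrow> 0) (at 0)"
    using assms(1) k unfolding op_holomorphic_on_def by blast
  have "((\<lambda>h. (G (k + h) x n - G k x n) / h - D x n) \<longlongrightarrow> 0) (at 0)"
  proof (rule Lim_null_comparison)
    show "((\<lambda>h. exp (- b * real_of_int \<bar>n\<bar> / 2) *
        (op_norm a b (\<lambda>x n. (G (k + h) x n - G k x n) / h - D x n) * ell2_norm a x)) \<longlongrightarrow> 0) (at 0)"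
      using tendsto_mult_right_zero[OF tendsto_mult_left_zero[OF lim]] .
    obtain r where r: "r > 0" "ball k r \<subseteq> U" using assms(2) k open_contains_ball by blast
    show "\<forall>\<^sub>F h in at 0. cmod ((G (k + h) x n - G k x n) / h - D x n) \<le>
        exp (- b * real_of_int \<bar>n\<bar> / 2) *
        (op_norm a b (\<lambda>x n. (G (k + h) x n - G k x n) / h - D x n) * ell2_norm a x)"
      unfolding eventually_at
    proof (intro exI[of _ r] conjI ballI impI)
      fix h :: complex assume h: "h \<noteq> 0 \<and> dist h 0 < r"
      then have "k + h \<in> U" using r by (auto simp: dist_norm subset_iff)
      let ?T = "\<lambda>x n. (G (k + h) x n - G k x n) / h - D x n"
      have T_eq: "?T = (\<lambda>x n. 1 * (1 / h * G (k + h) x n + (- 1 / h) * G k x n) + (- 1) * D x n)"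
        by (simp add: fun_eq_iff diff_divide_distrib)
      have T: "bounded_op a b ?T"
        unfolding T_eq
        by (rule bounded_op_lincomb[OF bounded_op_lincomb[OF Gb[OF \<open>k + h \<in> U\<close>] Gb[OF k]] D])
      then have "?T x \<in> ell2 b" using x by (simp add: bounded_op_def)
      then show "cmod (?T x n) \<le>
          exp (- b * real_of_int \<bar>n\<bar> / 2) * (op_norm a b ?T * ell2_norm a x)"
        by (rule order_trans[OF ell2_coord_bound mult_left_mono[OF op_norm_bound[OF T x]]]) simp
    qed (use r in simp)
  qed
  then have "((\<lambda>h. (G (k + h) x n - G k x n) / h) \<longlongrightarrow> D x n) (at 0)"
    by (simp add: LIM_zero_iff)
  then show "\<exists>f'. ((\<lambda>k. G k x n) has_field_derivative f') (at k)"
    unfolding DERIV_def by blast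
qed

section \<open>Excluding poles by the identity theorem\<close>

lemma open_eventually_at: "open {z :: 'a :: t1_space. eventually P (at z)}"
proof (rule Topological_Spaces.openI)
  fix z assume "z \<in> {z. eventually P (at z)}"
  then obtain S where S: "open S" "z \<in> S" "\<And>x. x \<in> S \<Longrightarrow> x \<noteq> z \<Longrightarrow> P x"
    unfolding eventually_at_topological by auto
  have "eventually P (at y)" if "y \<in> S" for y
  proof (cases "y = z")
    case False
    then show ?thesis unfolding eventually_at_topological
      using S that by (intro exI[of _ "S - {z}"]) (auto intro: open_delete)
  qed (use S in \<open>auto simp: eventually_at_topological\<close>)
  then show "\<exists>T. open T \<and> z \<in> T \<and> T \<subseteq> {z. eventually P (at z)}" using S by blast
qed

text \<open>An identity theorem for each matrix element of R, with a holomorphic F that may depend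
  on x and n. If R and F agree near k0, then G x n equals F times (k - k0)^m and tends to 0 at k0
  because m is at least 1, against the choice of x and n.\<close>

lemma not_op_is_pole:
  assumes mer: "op_meromorphic_on a b R W'" and W: "open W" "connected W" "W \<subseteq> W'"
    and ext: "\<And>x n. x \<in> ell2 a \<Longrightarrow> \<exists>F V. F holomorphic_on W \<and> open V \<and> V \<noteq> {} \<and> V \<subseteq> W \<and>
       (\<forall>k\<in>V. R k x n = F k)"
    and k0: "k0 \<in> W"
  shows "\<not> op_is_pole a b R k0"
proof
  assume "op_is_pole a b R k0"
  then obtain m G x where m: "m \<ge> 1" and G: "op_laurent_at a b R k0 m G"
    and x: "x \<in> ell2 a" and Gx: "G k0 x \<noteq> (\<lambda>n. 0)"
    unfolding op_is_pole_def by blast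
  then obtain n where n: "G k0 x n \<noteq> 0" by auto
  obtain F V where F: "F holomorphic_on W" and V: "open V" "V \<noteq> {}" "V \<subseteq> W"
    and FV: "\<And>k. k \<in> V \<Longrightarrow> R k x n = F k" using ext[OF x, of n] by blast
  \<comment> \<open>The value of R at a point carries no information, so agreement is tested on
    punctured neighbourhoods. The sets \<open>?Z\<close> and \<open>?N\<close> are open and
    disjoint, they cover W, and \<open>?Z\<close> contains V; connectedness of W then forces k0 into
    \<open>?Z\<close>.\<close>
  let ?Z = "{k. \<forall>\<^sub>F w in at k. R w x n = F w}" and ?N = "{k. \<forall>\<^sub>F w in at k. R w x n \<noteq> F w}"
  have "W \<subseteq> ?Z \<union> ?N"
  proof
    fix k assume k: "k \<in> W"
    obtain m' G' where "op_laurent_at a b R k m' G'"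
      using mer k W(3) unfolding op_meromorphic_on_def by blast
    then obtain r where r: "r > 0" "op_holomorphic_on a b G' (ball k r)"
      and RG: "\<And>w. w \<in> ball k r - {k} \<Longrightarrow> R w x n = G' w x n / (w - k) ^ m'"
      using x unfolding op_laurent_at_def by fastforce
    obtain s where s: "s > 0" "ball k s \<subseteq> W" using W(1) k open_contains_ball by blast
    define d where "d = min r s"
    have d: "d > 0" "ball k d \<subseteq> ball k r" "ball k d \<subseteq> W"
      using r s by (auto simp: d_def)
    \<comment> \<open>Clearing the denominator gives a scalar holomorphic function on a disc: it
      vanishes identically or has isolated zeros, which decides between \<open>?Z\<close> and
      \<open>?N\<close>.\<close>
    define \<phi> where "\<phi> w = G' w x n - F w * (w - k) ^ m'" for w
    have "(\<lambda>w. G' w x n) holomorphic_on ball k d"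
      using op_holomorphic_on_coordinate[OF r(2) open_ball x] d(2) holomorphic_on_subset by blast
    then have \<phi>: "\<phi> holomorphic_on ball k d"
      unfolding \<phi>_def using holomorphic_on_subset[OF F d(3)] by (intro holomorphic_intros)
    have iff: "R w x n = F w \<longleftrightarrow> \<phi> w = 0" if "w \<in> ball k d" "w \<noteq> k" for w
      using RG[of w] that d(2) by (auto simp: \<phi>_def field_simps)
    have near: "\<forall>\<^sub>F w in at k. w \<in> ball k d \<and> w \<noteq> k"
      using d(1) by (simp add: eventually_at dist_commute) blast
    show "k \<in> ?Z \<union> ?N"
    proof (cases "\<forall>w\<in>ball k d. \<phi> w = 0")
      case True
      have "\<forall>\<^sub>F w in at k. R w x n = F w"
        using near by eventually_elim (use iff True in blast)
      then show ?thesis by simp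
    next
      case False
      then obtain \<beta> where "\<beta> \<in> ball k d" "\<phi> \<beta> \<noteq> 0" by blast
      then have "\<forall>\<^sub>F w in at k. \<phi> w \<noteq> 0 \<and> w \<in> ball k d"
        using \<phi> d(1) by (intro non_zero_neighbour_alt) auto
      then have "\<forall>\<^sub>F w in at k. R w x n \<noteq> F w"
        using near by eventually_elim (use iff in blast)
      then show ?thesis by simp
    qed
  qed
  moreover have "?Z \<inter> ?N \<inter> W = {}"
  proof -
    have False if "\<forall>\<^sub>F w in at k. R w x n = F w" "\<forall>\<^sub>F w in at k. R w x n \<noteq> F w" for k :: complex
      using eventually_conj[OF that] by (simp add: trivial_limit_at_iff)
    then show ?thesis by blast
  qed
  moreover have "V \<subseteq> ?Z"
    using V(1) FV by (auto simp: eventually_at_topological)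
  ultimately have "k0 \<in> ?Z"
    using connectedD[OF W(2), of ?Z ?N] open_eventually_at V(2,3) k0 by blast
  then have RF: "\<forall>\<^sub>F w in at k0. R w x n = F w" by simp
  obtain r where r: "r > 0" "op_holomorphic_on a b G (ball k0 r)"
    and RG': "\<forall>w\<in>ball k0 r - {k0}. \<forall>x\<in>ell2 a. R w x = (\<lambda>n. G w x n / (w - k0) ^ m)"
    using G unfolding op_laurent_at_def by blast
  have RG: "R w x n = G w x n / (w - k0) ^ m" if "w \<in> ball k0 r - {k0}" for w
    using bspec[OF bspec[OF RG' that] x] by (rule fun_cong)
  have "\<forall>\<^sub>F w in at k0. w \<in> ball k0 r - {k0}"
    using r(1) by (simp add: eventually_at dist_commute) blast
  then have ev: "\<forall>\<^sub>F w in at k0. G w x n = F w * (w - k0) ^ m"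
    using RF
  proof eventually_elim
    case (elim w)
    then have "w \<noteq> k0" "G w x n / (w - k0) ^ m = F w" using RG[of w] by auto
    then show ?case by (auto simp: field_simps)
  qed
  have "isCont F k0"
    using F W(1) k0 holomorphic_on_imp_continuous_on continuous_on_interior interior_open by metis
  then have "(F \<longlongrightarrow> F k0) (at k0)" by (simp add: isCont_def)
  then have "((\<lambda>w. F w * (w - k0) ^ m) \<longlongrightarrow> F k0 * (k0 - k0) ^ m) (at k0)"
    by (intro tendsto_intros)
  then have "((\<lambda>w. G w x n) \<longlongrightarrow> 0) (at k0)"
    using m ev by (simp add: filterlim_cong[OF refl refl ev] power_0_left)
  moreover have "isCont (\<lambda>w. G w x n) k0"
    using op_holomorphic_on_coordinate[OF r(2) open_ball x] r(1) holomorphic_on_imp_continuous_on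
      continuous_on_eq_continuous_at[OF open_ball] by (metis centre_in_ball)
  then have "((\<lambda>w. G w x n) \<longlongrightarrow> G k0 x n) (at k0)" by (simp add: isCont_def)
  ultimately show False using n tendsto_unique[of "at k0"] by (metis trivial_limit_at)
qed

section \<open>The free resolvent\<close>

lemma summable_on_power_nat_abs:
  fixes r :: real
  assumes "0 \<le> r" "r < 1"
  shows "(\<lambda>n::int. r ^ nat \<bar>n\<bar>) summable_on UNIV"
proof -
  have geo: "(\<lambda>k. r ^ k) summable_on UNIV"
    using assms by (intro norm_summable_imp_summable_on) (simp add: summable_geometric_iff)
  have UN: "(UNIV :: int set) = range int \<union> range (\<lambda>k. - int k - 1)"
  proof -
    have "n \<in> range int \<union> range (\<lambda>k. - int k - 1)" for n :: int
    proof (cases "0 \<le> n")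
      case True then show ?thesis by (metis UnI1 nat_0_le rangeI)
    next
      case False
      then have "n = - int (nat (- n - 1)) - 1" by simp
      then show ?thesis by blast
    qed
    then show ?thesis by blast
  qed
  have "(\<lambda>n. r ^ nat \<bar>n\<bar>) summable_on range int"
    by (subst summable_on_reindex) (auto simp: o_def geo)
  moreover have "(\<lambda>n. r ^ nat \<bar>n\<bar>) summable_on range (\<lambda>k. - int k - 1)"
  proof (subst summable_on_reindex)
    have "(\<lambda>n. r ^ nat \<bar>n\<bar>) \<circ> (\<lambda>k. - int k - 1) = (\<lambda>k. r * r ^ k)"
    proof
      fix k
      have "nat \<bar>- int k - 1\<bar> = Suc k" by simp
      then show "((\<lambda>n. r ^ nat \<bar>n\<bar>) \<circ> (\<lambda>k. - int k - 1)) k = r * r ^ k"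
        unfolding o_def by (metis power_Suc)
    qed
    then show "((\<lambda>n. r ^ nat \<bar>n\<bar>) \<circ> (\<lambda>k. - int k - 1)) summable_on UNIV"
      using geo by (simp add: summable_on_cmult_right)
  qed (auto simp: inj_on_def)
  ultimately show ?thesis
    unfolding UN by (intro summable_on_Un_disjoint) auto
qed

lemma summable_on_exp_abs:
  assumes "c < 0"
  shows "(\<lambda>n::int. exp (c * real_of_int \<bar>n\<bar>)) summable_on UNIV"
proof -
  have "exp (c * real_of_int \<bar>n\<bar>) = exp c ^ nat \<bar>n\<bar>" for n :: int
    by (simp add: exp_of_nat_mult[symmetric] mult.commute)
  then show ?thesis using summable_on_power_nat_abs[of "exp c"] assms by simp
qed

text \<open>Cauchy-Schwarz with a as weight, from the factorisation of a y into sqrt(a) and sqrt(a)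
  y. The weight will be the modulus of a convolution kernel.\<close>

lemma infsum_Cauchy_Schwarz:
  fixes a y :: "'x \<Rightarrow> real"
  assumes a: "\<And>n. 0 \<le> a n" "a summable_on UNIV" and y: "\<And>n. 0 \<le> y n"
    and ay: "(\<lambda>n. a n * y n) summable_on UNIV" and ay2: "(\<lambda>n. a n * (y n)\<^sup>2) summable_on UNIV"
  shows "(\<Sum>\<^sub>\<infinity>n. a n * y n)\<^sup>2 \<le> (\<Sum>\<^sub>\<infinity>n. a n) * (\<Sum>\<^sub>\<infinity>n. a n * (y n)\<^sup>2)"
proof -
  let ?P = "(\<Sum>\<^sub>\<infinity>n. a n) * (\<Sum>\<^sub>\<infinity>n. a n * (y n)\<^sup>2)"
  have P: "0 \<le> ?P" using a by (intro mult_nonneg_nonneg infsum_nonneg) auto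
  have "(\<Sum>\<^sub>\<infinity>n. a n * y n) \<le> sqrt ?P"
  proof (rule infsum_le_finite_sums[OF ay])
    fix F :: "'x set" assume F: "finite F" "F \<subseteq> UNIV"
    have "(\<Sum>n\<in>F. a n * y n)\<^sup>2 = (\<Sum>n\<in>F. sqrt (a n) * (sqrt (a n) * y n))\<^sup>2"
      using a(1) by (simp add: mult.assoc[symmetric])
    also have "\<dots> \<le> (\<Sum>n\<in>F. (sqrt (a n))\<^sup>2) * (\<Sum>n\<in>F. (sqrt (a n) * y n)\<^sup>2)"
      by (rule Cauchy_Schwarz_ineq_sum)
    also have "\<dots> = (\<Sum>n\<in>F. a n) * (\<Sum>n\<in>F. a n * (y n)\<^sup>2)"
      using a(1) by (simp add: power_mult_distrib)
    also have "\<dots> \<le> ?P"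
      using a ay2 F by (intro mult_mono finite_sum_le_infsum infsum_nonneg sum_nonneg) auto
    finally show "(\<Sum>n\<in>F. a n * y n) \<le> sqrt ?P" by (rule real_le_rsqrt)
  qed
  moreover have "0 \<le> (\<Sum>\<^sub>\<infinity>n. a n * y n)" using a y by (intro infsum_nonneg) auto
  ultimately show ?thesis using P by (metis power_mono real_sqrt_pow2)
qed

section \<open>Convolution with a summable kernel on l2\<close>

definition conv :: "(int \<Rightarrow> complex) \<Rightarrow> (int \<Rightarrow> complex) \<Rightarrow> int \<Rightarrow> complex" where
  "conv a x n = (\<Sum>\<^sub>\<infinity>m. a (n - m) * x m)"

lemma infsum_shift_reflect:
  fixes f :: "int \<Rightarrow> 'b :: {comm_monoid_add, t2_space}"
  shows "(\<lambda>m. f (n - m)) summable_on UNIV \<longleftrightarrow> f summable_on UNIV"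
    and "(\<Sum>\<^sub>\<infinity>m. f (n - m)) = infsum f UNIV"
proof -
  have b: "bij_betw (\<lambda>m. n - m) UNIV (UNIV :: int set)"
    by (rule bij_betwI[of _ _ _ "\<lambda>m. n - m"]) auto
  show "(\<lambda>m. f (n - m)) summable_on UNIV \<longleftrightarrow> f summable_on UNIV"
    by (rule summable_on_reindex_bij_betw[OF b])
  show "(\<Sum>\<^sub>\<infinity>m. f (n - m)) = infsum f UNIV"
    by (rule infsum_reindex_bij_betw[OF b])
qed

lemma infsum_shift:
  fixes f :: "int \<Rightarrow> 'b :: {comm_monoid_add, t2_space}"
  shows "(\<lambda>m. f (m - n)) summable_on UNIV \<longleftrightarrow> f summable_on UNIV"
    and "(\<Sum>\<^sub>\<infinity>m. f (m - n)) = infsum f UNIV"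
proof -
  have b: "bij_betw (\<lambda>m. m - n) UNIV (UNIV :: int set)"
    by (rule bij_betwI[of _ _ _ "\<lambda>m. m + n"]) auto
  show "(\<lambda>m. f (m - n)) summable_on UNIV \<longleftrightarrow> f summable_on UNIV"
    by (rule summable_on_reindex_bij_betw[OF b])
  show "(\<Sum>\<^sub>\<infinity>m. f (m - n)) = infsum f UNIV"
    by (rule infsum_reindex_bij_betw[OF b])
qed

lemma has_sum_diff:
  fixes f g :: "'x \<Rightarrow> complex"
  assumes "(f has_sum a) A" "(g has_sum b) A"
  shows "((\<lambda>x. f x - g x) has_sum (a - b)) A"
  using has_sum_add[OF assms(1) has_sum_uminus[THEN iffD2], of g "- b"] assms(2) by simp

lemma ell2_0_coord: "x \<in> ell2 0 \<Longrightarrow> cmod (x n) \<le> ell2_norm 0 x"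
  using ell2_coord_bound[of x 0 n] by simp

lemma conv_abs_summable:
  assumes a: "(\<lambda>n. cmod (a n)) summable_on UNIV" and x: "x \<in> ell2 0"
  shows "(\<lambda>m. cmod (a (n - m)) * cmod (x m)) summable_on UNIV" "(\<lambda>m. a (n - m) * x m) summable_on UNIV"
proof -
  have "(\<lambda>m. cmod (a (n - m)) * ell2_norm 0 x) summable_on UNIV"
    using infsum_shift_reflect(1)[of "\<lambda>n. cmod (a n)"] a by (intro summable_on_cmult_left) simp
  then show *: "(\<lambda>m. cmod (a (n - m)) * cmod (x m)) summable_on UNIV"
  proof (rule summable_on_comparison_test)
    show "cmod (a (n - m)) * cmod (x m) \<le> cmod (a (n - m)) * ell2_norm 0 x" for m
      by (rule mult_left_mono[OF ell2_0_coord[OF x]]) simp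
  qed simp
  show "(\<lambda>m. a (n - m) * x m) summable_on UNIV"
    by (rule Infinite_Sum.abs_summable_summable) (use * in \<open>simp add: norm_mult\<close>)
qed

text \<open>Young's inequality for l1 * l2: Cauchy-Schwarz with weight |a(n - m)| bounds each
  coordinate, and exchanging the sums evaluates the double sum.\<close>

lemma conv_ell2:
  assumes a: "(\<lambda>n. cmod (a n)) summable_on UNIV" and x: "x \<in> ell2 0"
  shows "conv a x \<in> ell2 0" "ell2_norm 0 (conv a x) \<le> (\<Sum>\<^sub>\<infinity>n. cmod (a n)) * ell2_norm 0 x"
proof -
  define S where "S = (\<Sum>\<^sub>\<infinity>n. cmod (a n))"
  have S: "0 \<le> S" unfolding S_def by (intro infsum_nonneg) auto
  let ?f = "\<lambda>n m. cmod (a (n - m)) * (cmod (x m))\<^sup>2"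
  have x2: "(\<lambda>m. (cmod (x m))\<^sup>2) summable_on UNIV" using x by (simp add: ell2_def)
  \<comment> \<open>Summing over n first is easy, because every inner sum is a translate of the l1
    norm of a; the other order is obtained by swapping.\<close>
  have "(\<lambda>(m, n). ?f n m) summable_on (UNIV \<times> UNIV)"
  proof (rule summable_on_SigmaI)
    show "((\<lambda>n. case (m, n) of (m, n) \<Rightarrow> ?f n m) has_sum S * (cmod (x m))\<^sup>2) UNIV" for m
      unfolding prod.case S_def
      using has_sum_infsum[OF infsum_shift(1)[of "\<lambda>n. cmod (a n)" m, THEN iffD2, OF a]]
      by (intro has_sum_cmult_left) (simp add: infsum_shift(2)[of "\<lambda>n. cmod (a n)"])
    show "(\<lambda>m. S * (cmod (x m))\<^sup>2) summable_on UNIV"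
      using x2 by (rule summable_on_cmult_right)
  qed auto
  then have ff: "(\<lambda>(n, m). ?f n m) summable_on (UNIV \<times> UNIV)"
    by (subst summable_on_swap) (simp add: case_prod_unfold)
  have fn: "(\<lambda>m. ?f n m) summable_on UNIV" for n
  proof -
    have "(\<lambda>m. (ell2_norm 0 x)\<^sup>2 * cmod (a (n - m))) summable_on UNIV"
      using infsum_shift_reflect(1)[of "\<lambda>n. cmod (a n)"] a by (intro summable_on_cmult_right) simp
    then show ?thesis
    proof (rule summable_on_comparison_test)
      show "?f n m \<le> (ell2_norm 0 x)\<^sup>2 * cmod (a (n - m))" for m
        using mult_left_mono[OF power_mono[OF ell2_0_coord[OF x, of m], of 2], of "cmod (a (n - m))"]
        by (simp add: mult.commute)
    qed auto
  qed
  have bound: "ell2_term 0 (conv a x) n \<le> S * (\<Sum>\<^sub>\<infinity>m. ?f n m)" for n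
  proof -
    have abs: "(\<lambda>m. cmod (a (n - m) * x m)) summable_on UNIV"
      using conv_abs_summable(1)[OF a x] by (simp add: norm_mult)
    have "cmod (conv a x n) \<le> (\<Sum>\<^sub>\<infinity>m. cmod (a (n - m)) * cmod (x m))"
      unfolding conv_def using norm_infsum_bound[OF abs] by (simp add: norm_mult)
    then have "(cmod (conv a x n))\<^sup>2 \<le> (\<Sum>\<^sub>\<infinity>m. cmod (a (n - m)) * cmod (x m))\<^sup>2"
      by (intro power_mono) auto
    also have "\<dots> \<le> (\<Sum>\<^sub>\<infinity>m. cmod (a (n - m))) * (\<Sum>\<^sub>\<infinity>m. ?f n m)"
      using infsum_shift_reflect(1)[of "\<lambda>n. cmod (a n)"] a conv_abs_summable(1)[OF a x] fn
      by (intro infsum_Cauchy_Schwarz) auto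
    also have "(\<Sum>\<^sub>\<infinity>m. cmod (a (n - m))) = S"
      unfolding S_def by (rule infsum_shift_reflect(2))
    finally show ?thesis by simp
  qed
  have Bs: "(\<lambda>n. S * (\<Sum>\<^sub>\<infinity>m. ?f n m)) summable_on UNIV"
    using summable_on_Sigma_banach[OF ff] by (intro summable_on_cmult_right) simp
  show "conv a x \<in> ell2 0" by (rule ell2_dominated(1)[OF bound Bs])
  have "(ell2_norm 0 (conv a x))\<^sup>2 \<le> S * (\<Sum>\<^sub>\<infinity>n. \<Sum>\<^sub>\<infinity>m. ?f n m)"
    using ell2_dominated(2)[OF bound Bs] by (simp add: infsum_cmult_right')
  also have "(\<Sum>\<^sub>\<infinity>n. \<Sum>\<^sub>\<infinity>m. ?f n m) = (\<Sum>\<^sub>\<infinity>m. \<Sum>\<^sub>\<infinity>n. ?f n m)"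
    by (rule infsum_swap_banach[OF ff])
  also have "\<dots> = S * (ell2_norm 0 x)\<^sup>2"
    unfolding infsum_cmult_left' infsum_shift(2)[of "\<lambda>n. cmod (a n)"] S_def
    by (simp add: infsum_cmult_right' ell2_norm_sq)
  also have "S * (S * (ell2_norm 0 x)\<^sup>2) = (S * ell2_norm 0 x)\<^sup>2"
    by (simp add: power2_eq_square)
  finally have "ell2_norm 0 (conv a x) \<le> S * ell2_norm 0 x"
    by (rule power2_le_imp_le) (use S ell2_norm_nonneg in simp)
  then show "ell2_norm 0 (conv a x) \<le> (\<Sum>\<^sub>\<infinity>n. cmod (a n)) * ell2_norm 0 x" by (simp add: S_def)
qed

section \<open>The Green function of the free operator\<close>

definition free_green :: "complex \<Rightarrow> int \<Rightarrow> complex" where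
  "free_green \<zeta> n = \<zeta> ^ Suc (nat \<bar>n\<bar>) / (1 - \<zeta>\<^sup>2)"

lemma one_minus_sq_neq_0: "cmod \<zeta> < 1 \<Longrightarrow> 1 - \<zeta>\<^sup>2 \<noteq> 0"
  by (auto simp: power2_eq_1_iff)

lemma free_green_summable:
  assumes "cmod \<zeta> < 1"
  shows "(\<lambda>n. cmod (free_green \<zeta> n)) summable_on UNIV"
proof -
  have "(\<lambda>n::int. cmod \<zeta> / cmod (1 - \<zeta>\<^sup>2) * cmod \<zeta> ^ nat \<bar>n\<bar>) summable_on UNIV"
    using assms by (intro summable_on_cmult_right summable_on_power_nat_abs) auto
  then show ?thesis by (simp add: free_green_def norm_divide norm_mult norm_power)
qed

text \<open>Away from n = 0 the powers of zeta solve the recurrence with characteristic roots zeta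
  and 1 / zeta. At n = 0 the numerators leave zeta (zeta + 1 / zeta) - 2 zeta^2 = 1 - zeta^2, which
  is why this is the normalising denominator.\<close>

lemma free_green_eq:
  assumes "\<zeta> \<noteq> 0" "cmod \<zeta> < 1"
  shows "(\<zeta> + 1 / \<zeta>) * free_green \<zeta> n - free_green \<zeta> (n + 1) - free_green \<zeta> (n - 1) =
    (if n = 0 then 1 else 0)"
proof -
  have ne: "1 - \<zeta>\<^sup>2 \<noteq> 0" using assms(2) by (rule one_minus_sq_neq_0)
  have rec: "(\<zeta> + 1 / \<zeta>) * (\<zeta> ^ Suc (Suc j) / c) - \<zeta> ^ Suc (Suc (Suc j)) / c - \<zeta> ^ Suc j / c = 0" for j c
    using assms(1) by (cases "c = 0") (auto simp: field_simps)
  consider "n = 0" | j where "n = int (Suc j)" | j where "n = - int (Suc j)"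
  proof (cases n rule: int_cases3)
    case zero
    then show ?thesis using that by blast
  next
    case (pos k)
    then obtain j where "k = Suc j" using gr0_conv_Suc by auto
    then show ?thesis using that(2) pos by blast
  next
    case (neg k)
    then obtain j where "k = Suc j" using gr0_conv_Suc by auto
    then show ?thesis using that(3) neg by blast
  qed
  then show ?thesis
  proof cases
    case 1
    then show ?thesis using ne assms(1) by (simp add: free_green_def field_simps power2_eq_square)
  next
    case (2 j)
    have "nat \<bar>n\<bar> = Suc j" "nat \<bar>n + 1\<bar> = Suc (Suc j)" "nat \<bar>n - 1\<bar> = j" "n \<noteq> 0" using 2 by auto
    then show ?thesis using rec[of j] by (simp only: free_green_def if_False)
  next
    case (3 j)
    have "nat \<bar>n\<bar> = Suc j" "nat \<bar>n + 1\<bar> = j" "nat \<bar>n - 1\<bar> = Suc (Suc j)" "n \<noteq> 0" using 3 by auto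
    then show ?thesis using rec[of j] by (simp only: free_green_def if_False) (simp add: diff_diff_eq add.commute)
  qed
qed

lemma conv_free_green_right_inverse:
  assumes \<zeta>: "\<zeta> \<noteq> 0" "cmod \<zeta> < 1" and x: "x \<in> ell2 0"
  shows "shift_op H0 (2 - \<zeta> - 1 / \<zeta>) (conv (free_green \<zeta>) x) = x"
proof
  fix n
  let ?g = "free_green \<zeta>"
  note s = conv_abs_summable(2)[OF free_green_summable[OF \<zeta>(2)] x]
  have "shift_op H0 (2 - \<zeta> - 1 / \<zeta>) (conv ?g x) n =
      (\<zeta> + 1 / \<zeta>) * conv ?g x n - conv ?g x (n + 1) - conv ?g x (n - 1)"
    by (simp add: shift_op_def H0_def algebra_simps)
  also have "\<dots> = (\<Sum>\<^sub>\<infinity>m. (\<zeta> + 1 / \<zeta>) * (?g (n - m) * x m)) - (\<Sum>\<^sub>\<infinity>m. ?g (n + 1 - m) * x m) -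
      (\<Sum>\<^sub>\<infinity>m. ?g (n - 1 - m) * x m)"
    unfolding conv_def by (simp only: infsum_cmult_right')
  also have "\<dots> = (\<Sum>\<^sub>\<infinity>m. (\<zeta> + 1 / \<zeta>) * (?g (n - m) * x m) - ?g (n + 1 - m) * x m - ?g (n - 1 - m) * x m)"
    by (intro infsumI[symmetric] has_sum_diff has_sum_infsum summable_on_cmult_right s)
  also have "\<dots> = (\<Sum>\<^sub>\<infinity>m. if m = n then x n else 0)"
  proof (rule infsum_cong)
    fix m
    have "(\<zeta> + 1 / \<zeta>) * (?g (n - m) * x m) - ?g (n + 1 - m) * x m - ?g (n - 1 - m) * x m =
        ((\<zeta> + 1 / \<zeta>) * ?g (n - m) - ?g (n - m + 1) - ?g (n - m - 1)) * x m"
      by (simp add: algebra_simps)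
    then show "(\<zeta> + 1 / \<zeta>) * (?g (n - m) * x m) - ?g (n + 1 - m) * x m - ?g (n - 1 - m) * x m =
        (if m = n then x n else 0)"
      unfolding free_green_eq[OF \<zeta>] by simp
  qed
  also have "\<dots> = (\<Sum>\<^sub>\<infinity>m\<in>{n}. x n)"
    by (rule infsum_cong_neutral) auto
  finally show "shift_op H0 (2 - \<zeta> - 1 / \<zeta>) (conv ?g x) n = x n" by simp
qed

lemma ell2_0_shift:
  assumes "x \<in> ell2 0"
  shows "(\<lambda>n. x (n + 1)) \<in> ell2 0" "(\<lambda>n. x (n - 1)) \<in> ell2 0"
  using assms infsum_shift(1)[of "\<lambda>n. (cmod (x n))\<^sup>2" 1] infsum_shift(1)[of "\<lambda>n. (cmod (x n))\<^sup>2" "-1"]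
  by (simp_all add: ell2_def)

lemma shift_op_H0_ell2:
  assumes "x \<in> ell2 0"
  shows "shift_op H0 z x \<in> ell2 0"
proof -
  have "shift_op H0 z x = (\<lambda>n. ((2 - z) * x n + (-1) * x (n + 1)) + (-1) * x (n - 1))"
    by (simp add: shift_op_def H0_def fun_eq_iff algebra_simps)
  then show ?thesis
    using assms by (simp only:) (intro ell2_add(1) ell2_scale(1) ell2_0_shift)
qed

text \<open>Convolution commutes with both shifts, hence with the free operator, so the claim
  reduces to the right inverse.\<close>

lemma conv_free_green_left_inverse:
  assumes \<zeta>: "\<zeta> \<noteq> 0" "cmod \<zeta> < 1" and x: "x \<in> ell2 0"
  shows "conv (free_green \<zeta>) (shift_op H0 (2 - \<zeta> - 1 / \<zeta>) x) = x"
proof -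
  let ?g = "free_green \<zeta>"
  note gs = free_green_summable[OF \<zeta>(2)]
  have "conv ?g (shift_op H0 (2 - \<zeta> - 1 / \<zeta>) x) n = shift_op H0 (2 - \<zeta> - 1 / \<zeta>) (conv ?g x) n" for n
  proof -
    have p: "(\<Sum>\<^sub>\<infinity>m. ?g (n - m) * x (m + 1)) = conv ?g x (n + 1)"
      unfolding conv_def using infsum_shift(2)[of "\<lambda>m. ?g (n + 1 - m) * x m" "-1"]
      by (simp add: algebra_simps)
    have q: "(\<Sum>\<^sub>\<infinity>m. ?g (n - m) * x (m - 1)) = conv ?g x (n - 1)"
      unfolding conv_def using infsum_shift(2)[of "\<lambda>m. ?g (n - 1 - m) * x m" "1"]
      by (simp add: algebra_simps)
    have "conv ?g (shift_op H0 (2 - \<zeta> - 1 / \<zeta>) x) n =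
        (\<Sum>\<^sub>\<infinity>m. (\<zeta> + 1 / \<zeta>) * (?g (n - m) * x m) - ?g (n - m) * x (m + 1) - ?g (n - m) * x (m - 1))"
      unfolding conv_def shift_op_def H0_def by (intro infsum_cong) (simp add: algebra_simps)
    also have "\<dots> = (\<Sum>\<^sub>\<infinity>m. (\<zeta> + 1 / \<zeta>) * (?g (n - m) * x m)) - (\<Sum>\<^sub>\<infinity>m. ?g (n - m) * x (m + 1)) -
        (\<Sum>\<^sub>\<infinity>m. ?g (n - m) * x (m - 1))"
      by (intro infsumI has_sum_diff has_sum_infsum summable_on_cmult_right
          conv_abs_summable(2)[OF gs] x ell2_0_shift)
    also have "\<dots> = (\<zeta> + 1 / \<zeta>) * conv ?g x n - conv ?g x (n + 1) - conv ?g x (n - 1)"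
      unfolding p q by (simp add: conv_def infsum_cmult_right')
    finally show ?thesis by (simp add: shift_op_def H0_def algebra_simps)
  qed
  then show ?thesis using conv_free_green_right_inverse[OF \<zeta> x] by (metis ext)
qed

section \<open>Bounded operators and the spectral parameter\<close>

lemma ell2_tail_tendsto_0:
  assumes x: "x \<in> ell2 0"
  shows "((\<lambda>A. ell2_norm 0 (\<lambda>n. if n \<in> A then 0 else x n)) \<longlongrightarrow> 0) (finite_subsets_at_top UNIV)"
proof -
  let ?s = "\<lambda>n. (cmod (x n))\<^sup>2"
  have s: "?s summable_on UNIV" using x by (simp add: ell2_def)
  have "((\<lambda>A. sqrt (infsum ?s UNIV - sum ?s A)) \<longlongrightarrow> sqrt (infsum ?s UNIV - infsum ?s UNIV))
      (finite_subsets_at_top UNIV)"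
    by (intro tendsto_intros infsum_tendsto s)
  then have lim: "((\<lambda>A. sqrt (infsum ?s UNIV - sum ?s A)) \<longlongrightarrow> 0) (finite_subsets_at_top UNIV)"
    by simp
  have "\<forall>\<^sub>F A in finite_subsets_at_top UNIV. sqrt (infsum ?s UNIV - sum ?s A) =
      ell2_norm 0 (\<lambda>n. if n \<in> A then 0 else x n)"
  proof (rule eventually_finite_subsets_at_top_weakI)
    fix A :: "int set" assume A: "finite A"
    have "(\<Sum>\<^sub>\<infinity>n. (cmod (if n \<in> A then 0 else x n))\<^sup>2) = infsum ?s (UNIV - A)"
      by (intro infsum_cong_neutral) auto
    also have "\<dots> = infsum ?s UNIV - infsum ?s A"
      using A s by (intro infsum_Diff) auto
    finally show "sqrt (infsum ?s UNIV - sum ?s A) = ell2_norm 0 (\<lambda>n. if n \<in> A then 0 else x n)"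
      using A by (simp add: ell2_norm_def)
  qed
  then show ?thesis using lim by (rule Lim_transform_eventually[rotated])
qed

lemma ell2_finite_support:
  assumes "finite A"
  shows "(\<lambda>n. if n \<in> A then x n else 0) \<in> ell2 a"
proof -
  have "ell2_term a (\<lambda>n. if n \<in> A then x n else 0) summable_on UNIV \<longleftrightarrow>
      ell2_term a (\<lambda>n. if n \<in> A then x n else 0) summable_on A"
    by (rule summable_on_cong_neutral) auto
  then show ?thesis using assms by (simp add: ell2_def)
qed

lemma bounded_op_simps:
  assumes "bounded_op a b T" "x \<in> ell2 a"
  shows "T x \<in> ell2 b"
    and "y \<in> ell2 a \<Longrightarrow> T (\<lambda>n. x n + y n) = (\<lambda>n. T x n + T y n)"
    and "T (\<lambda>n. c * x n) = (\<lambda>n. c * T x n)"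
  using assms by (auto simp: bounded_op_def)

lemma bounded_op_finite_support:
  assumes V: "bounded_op 0 0 V" and "finite A"
  shows "V (\<lambda>n. if n \<in> A then x n else 0) n = (\<Sum>m\<in>A. matrix_entry V n m * x m)"
  using assms(2)
proof (induction A rule: finite_induct)
  case empty
  have "(\<lambda>n. 0) \<in> ell2 0" using ell2_finite_support[of "{}"] by simp
  then have "V (\<lambda>n. 0 * 0) = (\<lambda>n. 0 * V (\<lambda>n. 0) n)"
    by (rule bounded_op_simps(3)[OF V])
  then show ?case by simp
next
  case (insert m A)
  let ?e = "\<lambda>j. if j = m then 1 else 0 :: complex"
  have e: "?e \<in> ell2 0" using ell2_finite_support[of "{m}" "\<lambda>_. 1" 0] by simp
  have eq: "(\<lambda>n. if n \<in> insert m A then x n else 0) = (\<lambda>n. x m * ?e n + (if n \<in> A then x n else 0))"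
    using insert(2) by auto
  have "V (\<lambda>n. x m * ?e n + (if n \<in> A then x n else 0)) =
      (\<lambda>n. V (\<lambda>n. x m * ?e n) n + V (\<lambda>n. if n \<in> A then x n else 0) n)"
    by (rule bounded_op_simps(2)[OF V ell2_scale(1)[OF e] ell2_finite_support[OF insert(1)]])
  moreover have "V (\<lambda>n. x m * ?e n) = (\<lambda>n. x m * V ?e n)"
    by (rule bounded_op_simps(3)[OF V e])
  ultimately show ?case
    unfolding eq using insert by (simp add: matrix_entry_def)
qed

text \<open>Linearity gives the matrix formula on finitely supported sequences; truncations to
  finite sets converge in l2 along the net of finite sets, and boundedness carries the formula to
  the limit.\<close>

lemma bounded_op_has_sum:
  assumes V: "bounded_op 0 0 V" and x: "x \<in> ell2 0"
  shows "((\<lambda>m. matrix_entry V n m * x m) has_sum V x n) UNIV"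
proof -
  obtain C where C: "\<And>x. x \<in> ell2 0 \<Longrightarrow> ell2_norm 0 (V x) \<le> C * ell2_norm 0 x"
    using bounded_op_bound[OF V] by blast
  have "((\<lambda>A. V x n - (\<Sum>m\<in>A. matrix_entry V n m * x m)) \<longlongrightarrow> 0) (finite_subsets_at_top UNIV)"
  proof (rule Lim_null_comparison)
    show "((\<lambda>A. C * ell2_norm 0 (\<lambda>n. if n \<in> A then 0 else x n)) \<longlongrightarrow> 0) (finite_subsets_at_top UNIV)"
      using tendsto_mult_right_zero[OF ell2_tail_tendsto_0[OF x]] .
    show "\<forall>\<^sub>F A in finite_subsets_at_top UNIV.
        cmod (V x n - (\<Sum>m\<in>A. matrix_entry V n m * x m)) \<le>
        C * ell2_norm 0 (\<lambda>n. if n \<in> A then 0 else x n)"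
    proof (rule eventually_finite_subsets_at_top_weakI)
      fix A :: "int set" assume A: "finite A"
      let ?y = "\<lambda>n. if n \<in> A then x n else 0" and ?t = "\<lambda>n. if n \<in> A then 0 else x n"
      have y: "?y \<in> ell2 0" using A by (rule ell2_finite_support)
      have "?t = (\<lambda>n. x n + (-1) * ?y n)" by auto
      then have t: "?t \<in> ell2 0" using ell2_add(1)[OF x ell2_scale(1)[OF y, of "-1"]] by simp
      have "V (\<lambda>n. ?y n + ?t n) = (\<lambda>n. V ?y n + V ?t n)"
        by (rule bounded_op_simps(2)[OF V y t])
      moreover have "(\<lambda>n. ?y n + ?t n) = x" by auto
      ultimately have "V x n - (\<Sum>m\<in>A. matrix_entry V n m * x m) = V ?t n"
        using bounded_op_finite_support[OF V A] by simp
      moreover have "V ?t \<in> ell2 0" by (rule bounded_op_simps(1)[OF V t])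
      then have "cmod (V ?t n) \<le> ell2_norm 0 (V ?t)" by (rule ell2_0_coord)
      ultimately show "cmod (V x n - (\<Sum>m\<in>A. matrix_entry V n m * x m)) \<le> C * ell2_norm 0 ?t"
        using C[OF t] by simp
    qed
  qed
  then have "((\<lambda>A. V x n - (V x n - (\<Sum>m\<in>A. matrix_entry V n m * x m))) \<longlongrightarrow> V x n - 0)
      (finite_subsets_at_top UNIV)"
    by (intro tendsto_diff tendsto_const)
  then show ?thesis by (simp add: has_sum_def)
qed

text \<open>By injectivity the preimage supplied by \<open>surj\<close> is the value of the inverse,
  so its bound with a constant C independent of f is the boundedness of the inverse.\<close>

lemma bounded_op_inv_into:
  assumes T: "\<And>x. x \<in> ell2 0 \<Longrightarrow> T x \<in> ell2 0"
    and lin: "\<And>x y c d. x \<in> ell2 0 \<Longrightarrow> y \<in> ell2 0 \<Longrightarrow>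
      T (\<lambda>n. c * x n + d * y n) = (\<lambda>n. c * T x n + d * T y n)"
    and inj: "\<And>x. x \<in> ell2 0 \<Longrightarrow> T x = (\<lambda>_. 0) \<Longrightarrow> x = (\<lambda>_. 0)"
    and surj: "\<And>f. f \<in> ell2 0 \<Longrightarrow> \<exists>u\<in>ell2 0. T u = f \<and> ell2_norm 0 u \<le> C * ell2_norm 0 f"
  shows "bij_betw T (ell2 0) (ell2 0)" "bounded_op 0 0 (inv_into (ell2 0) T)"
    and "\<And>u. u \<in> ell2 0 \<Longrightarrow> inv_into (ell2 0) T (T u) = u"
proof -
  have inj_T: "inj_on T (ell2 0)"
  proof (rule inj_onI)
    fix x y assume xy: "x \<in> ell2 0" "y \<in> ell2 0" "T x = T y"
    let ?d = "\<lambda>n. 1 * x n + (-1) * y n"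
    have "?d \<in> ell2 0" by (intro ell2_add(1) ell2_scale(1) xy)
    moreover have "T ?d = (\<lambda>_. 0)" unfolding lin[OF xy(1,2)] using xy(3) by simp
    ultimately have "?d = (\<lambda>_. 0)" by (rule inj)
    then show "x = y" by (auto simp: fun_eq_iff)
  qed
  then show bij: "bij_betw T (ell2 0) (ell2 0)"
    unfolding bij_betw_def using T surj by (auto simp: image_iff)
  show inv: "inv_into (ell2 0) T (T u) = u" if "u \<in> ell2 0" for u
    using inv_into_f_f[OF inj_T that] .
  let ?S = "inv_into (ell2 0) T"
  have S: "?S f \<in> ell2 0" "T (?S f) = f" "ell2_norm 0 (?S f) \<le> C * ell2_norm 0 f" if "f \<in> ell2 0" for f
    using surj[OF that] inv by auto
  have "?S (\<lambda>n. f n + g n) = (\<lambda>n. ?S f n + ?S g n)" if "f \<in> ell2 0" "g \<in> ell2 0" for f g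
    using lin[OF S(1)[OF that(1)] S(1)[OF that(2)], of 1 1] inv[OF ell2_add(1)[OF S(1)[OF that(1)] S(1)[OF that(2)]]]
    by (simp add: S(2)[OF that(1)] S(2)[OF that(2)])
  moreover have "?S (\<lambda>n. c * f n) = (\<lambda>n. c * ?S f n)" if "f \<in> ell2 0" for c f
    using lin[OF S(1)[OF that] S(1)[OF that], of c 0] inv[OF ell2_scale(1)[OF S(1)[OF that], of c]]
    by (simp add: S(2)[OF that])
  ultimately show "bounded_op 0 0 ?S"
    unfolding bounded_op_def using S by blast
qed

text \<open>The branch with value \<open>1\<close> at \<open>k = 0\<close> of the solution \<open>\<zeta> = e\<^sup>i\<^sup>\<theta>\<close> of \<open>k = 2 sin (\<theta> / 2)\<close>.\<close>

definition uniformizer :: "complex \<Rightarrow> complex" where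
  "uniformizer k = (csqrt (1 - k\<^sup>2 / 4) + \<i> * k / 2)\<^sup>2"

lemma uniformizer_eq: "uniformizer k \<noteq> 0" "k\<^sup>2 = 2 - uniformizer k - 1 / uniformizer k"
proof -
  define s where "s = csqrt (1 - k\<^sup>2 / 4)"
  have s2: "s\<^sup>2 = 1 - k\<^sup>2 / 4" by (simp add: s_def)
  \<comment> \<open>The product is s^2 + k^2 / 4, so the inverse of zeta is the square of the
    conjugate factor, and zeta + 1 / zeta is a sum of two squares in which the mixed terms
    cancel.\<close>
  have ss: "(s + \<i> * k / 2) * (s - \<i> * k / 2) = 1"
    using s2 by (simp add: algebra_simps power2_eq_square)
  then have ne: "s + \<i> * k / 2 \<noteq> 0" by auto
  then show "uniformizer k \<noteq> 0" by (simp add: uniformizer_def s_def)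
  have "1 / uniformizer k = (s - \<i> * k / 2)\<^sup>2"
    using ss ne by (simp add: uniformizer_def s_def[symmetric] divide_eq_eq flip: power_mult_distrib)
      (simp add: mult.commute)
  moreover have "(s + \<i> * k / 2)\<^sup>2 + (s - \<i> * k / 2)\<^sup>2 = 2 - k\<^sup>2"
    by (simp add: power2_sum power2_diff s2 power_mult_distrib power_divide)
  ultimately show "k\<^sup>2 = 2 - uniformizer k - 1 / uniformizer k"
    by (simp add: uniformizer_def s_def[symmetric] algebra_simps)
qed

lemma uniformizer_0 [simp]: "uniformizer 0 = 1"
  by (simp add: uniformizer_def)

lemma uniformizer_neq_1: "k \<noteq> 0 \<Longrightarrow> uniformizer k \<noteq> 1"
  using uniformizer_eq(2)[of k] by auto

lemma uniformizer_holomorphic: "uniformizer holomorphic_on ball 0 1"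
proof -
  have "1 - k\<^sup>2 / 4 \<notin> \<real>\<^sub>\<le>\<^sub>0" if "k \<in> ball 0 1" for k :: complex
  proof -
    have "cmod (k\<^sup>2 / 4) < 1"
      using that power_less_one_iff[of "cmod k" 2] by (simp add: norm_divide norm_power)
    then have "Re (k\<^sup>2 / 4) < 1" using complex_Re_le_cmod order_le_less_trans by blast
    then show ?thesis by (auto simp: complex_nonpos_Reals_iff)
  qed
  then show ?thesis unfolding uniformizer_def by (intro holomorphic_intros) auto
qed

text \<open>For k = i t the value is the square of sqrt(1 + t^2 / 4) - t / 2, a number strictly
  between 0 and 1. This fixes the branch: the positive imaginary axis corresponds to |zeta| < 1,
  where the convolution formula is the true free resolvent.\<close>

lemma norm_uniformizer_imaginary:
  fixes t :: real
  assumes "t > 0"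
  shows "cmod (uniformizer (\<i> * of_real t)) < 1"
proof -
  define s where "s = sqrt (1 + t\<^sup>2 / 4)"
  have "1 - (\<i> * complex_of_real t)\<^sup>2 / 4 = of_real (1 + t\<^sup>2 / 4)"
    by (simp add: power_mult_distrib)
  moreover have "csqrt (of_real (1 + t\<^sup>2 / 4)) = of_real s"
    unfolding s_def by (intro csqrt_of_real_nonneg[THEN trans]) auto
  ultimately have "uniformizer (\<i> * of_real t) = of_real ((s - t / 2)\<^sup>2)"
    by (simp add: uniformizer_def mult.assoc[symmetric] power2_eq_square)
  then have "cmod (uniformizer (\<i> * of_real t)) = (s - t / 2)\<^sup>2"
    by (simp only: norm_of_real) simp
  moreover have "t / 2 < s" unfolding s_def by (rule real_less_rsqrt) (simp add: power_divide)
  moreover have "s < 1 + t / 2"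
    unfolding s_def using assms by (intro real_less_lsqrt) (auto simp: power2_sum power_divide)
  ultimately show ?thesis by (simp add: power_less_one_iff)
qed

section \<open>Conjugation by J, which exchanges the two thresholds\<close>

lemma powi_minus_one: "(-1 :: complex) powi n * (-1) powi n = 1" "cmod ((-1) powi n) = 1"
  by (auto simp: norm_power_int power_int_minus_one_mult_self)

lemma J_involution: "J (J x) = x" "inv_into UNIV J = J"
proof -
  show JJ: "J (J x) = x" for x
    by (simp add: J_def fun_eq_iff powi_minus_one mult.assoc[symmetric])
  show "inv_into UNIV J = J" by (rule inv_equality) (rule JJ)+
qed

lemma J_ell2: "x \<in> ell2 a \<Longrightarrow> J x \<in> ell2 a" "ell2_norm a (J x) = ell2_norm a x"
  by (simp_all add: ell2_def ell2_norm_def J_def norm_mult powi_minus_one)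

lemma neg_conj_J_eq: "neg_conj_J V x n = - ((-1) powi n * V (J x) n)"
  by (simp add: neg_conj_J_def conj_J_def J_involution) (simp add: J_def)

lemma bounded_op_neg_conj_J:
  assumes V: "bounded_op a b V"
  shows "bounded_op a b (neg_conj_J V)"
proof -
  have eq: "neg_conj_J V x = (\<lambda>n. (-1) * J (V (J x)) n)" for x
    by (auto simp: neg_conj_J_eq fun_eq_iff J_def)
  have VJ: "V (J x) \<in> ell2 b" if "x \<in> ell2 a" for x
    by (rule bounded_op_simps(1)[OF V J_ell2(1)[OF that]])
  obtain C where C: "\<And>x. x \<in> ell2 a \<Longrightarrow> ell2_norm b (V x) \<le> C * ell2_norm a x"
    using bounded_op_bound[OF V] by blast
  have "neg_conj_J V x \<in> ell2 b" if "x \<in> ell2 a" for x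
    unfolding eq by (intro ell2_scale(1) J_ell2(1) VJ that)
  moreover have "ell2_norm b (neg_conj_J V x) \<le> C * ell2_norm a x" if "x \<in> ell2 a" for x
    unfolding eq ell2_scale(2)[OF J_ell2(1)[OF VJ[OF that]]]
    using C[OF J_ell2(1)[OF that]] by (simp add: J_ell2(2))
  moreover have "neg_conj_J V (\<lambda>n. x n + y n) = (\<lambda>n. neg_conj_J V x n + neg_conj_J V y n)"
    if "x \<in> ell2 a" "y \<in> ell2 a" for x y
  proof -
    have "J (\<lambda>n. x n + y n) = (\<lambda>n. J x n + J y n)" by (simp add: J_def algebra_simps)
    moreover have "V (\<lambda>n. J x n + J y n) = (\<lambda>n. V (J x) n + V (J y) n)"
      by (rule bounded_op_simps(2)[OF V J_ell2(1)[OF that(1)] J_ell2(1)[OF that(2)]])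
    ultimately show ?thesis by (simp add: neg_conj_J_eq[abs_def] algebra_simps)
  qed
  moreover have "neg_conj_J V (\<lambda>n. c * x n) = (\<lambda>n. c * neg_conj_J V x n)" if "x \<in> ell2 a" for x c
  proof -
    have "J (\<lambda>n. c * x n) = (\<lambda>n. c * J x n)" by (simp add: J_def mult_ac)
    moreover have "V (\<lambda>n. c * J x n) = (\<lambda>n. c * V (J x) n)"
      by (rule bounded_op_simps(3)[OF V J_ell2(1)[OF that]])
    ultimately show ?thesis by (simp add: neg_conj_J_eq[abs_def] mult.left_commute)
  qed
  ultimately show ?thesis unfolding bounded_op_def by blast
qed

text \<open>J is diagonal with entries of modulus 1, so the conjugation changes only phases and the
  decay hypothesis passes to -V_J.\<close>

lemma norm_matrix_entry_neg_conj_J: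
  assumes V: "bounded_op 0 0 V"
  shows "cmod (matrix_entry (neg_conj_J V) n m) = cmod (matrix_entry V n m)"
proof -
  let ?e = "\<lambda>j. if j = m then 1 else 0 :: complex"
  have e: "?e \<in> ell2 0" using ell2_finite_support[of "{m}" "\<lambda>_. 1" 0] by simp
  have "J ?e = (\<lambda>j. (-1) powi m * ?e j)" by (auto simp: J_def)
  moreover have "V (\<lambda>j. (-1) powi m * ?e j) = (\<lambda>n. (-1) powi m * V ?e n)"
    by (rule bounded_op_simps(3)[OF V e])
  ultimately show ?thesis
    by (simp add: matrix_entry_def neg_conj_J_eq norm_mult powi_minus_one)
qed

section \<open>The Fredholm system of the perturbed operator\<close>

text \<open>
  The unknowns are the source \<open>g = (H\<^sub>0 - z) u\<close> (up to the inhomogeneity), the solution \<open>u\<close> itself, and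
  the number \<open>\<tau> = (\<Sum>j. g j) / (1 - \<zeta>\<^sup>2)\<close>, which carries the pole of the free resolvent. The rows of
  the system are \<open>g + V u\<close>, \<open>u - K g - \<tau>\<close> and \<open>(1 - \<zeta>\<^sup>2) \<tau> - (\<Sum>j. g j)\<close>, where \<open>K\<close> is the regular part
  of the free resolvent; see \<open>free_green_split\<close>.
\<close>

datatype idx = Src int | Sol int | Mean

lemma UNIV_idx: "UNIV = range Src \<union> (range Sol \<union> {Mean})"
proof -
  have "x \<in> range Src \<union> (range Sol \<union> {Mean})" for x by (cases x) auto
  then show ?thesis by blast
qed

lemma summable_on_idx:
  fixes f :: "idx \<Rightarrow> 'b :: banach"
  shows "f summable_on UNIV \<longleftrightarrow> (\<lambda>n. f (Src n)) summable_on UNIV \<and> (\<lambda>n. f (Sol n)) summable_on UNIV"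
proof -
  have Src: "f summable_on range Src \<longleftrightarrow> (\<lambda>n. f (Src n)) summable_on UNIV"
    by (subst summable_on_reindex) (auto simp: inj_on_def o_def)
  have Sol: "f summable_on range Sol \<longleftrightarrow> (\<lambda>n. f (Sol n)) summable_on UNIV"
    by (subst summable_on_reindex) (auto simp: inj_on_def o_def)
  show ?thesis
  proof
    assume "f summable_on UNIV"
    then show "(\<lambda>n. f (Src n)) summable_on UNIV \<and> (\<lambda>n. f (Sol n)) summable_on UNIV"
      unfolding Src[symmetric] Sol[symmetric] using summable_on_subset_banach by blast
  next
    assume "(\<lambda>n. f (Src n)) summable_on UNIV \<and> (\<lambda>n. f (Sol n)) summable_on UNIV"
    then show "f summable_on UNIV"
      unfolding Src[symmetric] Sol[symmetric] UNIV_idx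
      by (intro summable_on_Un_disjoint) auto
  qed
qed

lemma infsum_idx:
  fixes f :: "idx \<Rightarrow> 'b :: banach"
  assumes "f summable_on UNIV"
  shows "infsum f UNIV = (\<Sum>\<^sub>\<infinity>n. f (Src n)) + (\<Sum>\<^sub>\<infinity>n. f (Sol n)) + f Mean"
proof -
  have s: "f summable_on A" for A using assms summable_on_subset_banach by blast
  have "infsum f UNIV = infsum f (range Src) + (infsum f (range Sol) + infsum f {Mean})"
    unfolding UNIV_idx by (subst infsum_Un_disjoint; (subst infsum_Un_disjoint)?) (auto intro: s)
  moreover have "infsum f (range Src) = (\<Sum>\<^sub>\<infinity>n. f (Src n))"
    by (subst infsum_reindex) (auto simp: inj_on_def o_def)
  moreover have "infsum f (range Sol) = (\<Sum>\<^sub>\<infinity>n. f (Sol n))"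
    by (subst infsum_reindex) (auto simp: inj_on_def o_def)
  ultimately show ?thesis by (simp add: add.assoc)
qed

text \<open>This is M in 1 + M, so the identity part is left out; in the mean row 1 - zeta^2 leaves
  -zeta^2. The entry from sources to solutions is (1 - zeta^(p+1)) / (1 - zeta^2) with p = |m - j|
  after cancelling 1 - zeta, hence regular at zeta = 1; it is the negative of the regular part of
  the free resolvent.\<close>

fun sys :: "(int \<Rightarrow> int \<Rightarrow> complex) \<Rightarrow> complex \<Rightarrow> idx \<Rightarrow> idx \<Rightarrow> complex" where
  "sys v \<zeta> (Src n) (Sol m) = v n m"
| "sys v \<zeta> (Sol m) (Src j) = (\<Sum>l\<le>nat \<bar>m - j\<bar>. \<zeta> ^ l) / (1 + \<zeta>)"
| "sys v \<zeta> (Sol m) Mean = - 1"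
| "sys v \<zeta> Mean (Src j) = - 1"
| "sys v \<zeta> Mean Mean = - \<zeta>\<^sup>2"
| "sys v \<zeta> _ _ = 0"

locale decaying_potential =
  fixes V :: "(int \<Rightarrow> complex) \<Rightarrow> int \<Rightarrow> complex" and \<delta> Cv :: real
  assumes V_op: "bounded_op 0 0 V" and \<delta>_pos: "\<delta> > 0"
    and V_decay: "\<And>n m. cmod (matrix_entry V n m) \<le>
      Cv * (exp (- \<delta> * real_of_int \<bar>n\<bar>) * exp (- \<delta> * real_of_int \<bar>m\<bar>))"
begin

abbreviation v :: "int \<Rightarrow> int \<Rightarrow> complex" where "v \<equiv> matrix_entry V"

text \<open>The largest |zeta| allowed in \<open>\<Omega>\<close>. The exponent
  \<open>\<delta> / 4\<close> leaves room twice: the growth r^|n| is beaten by the decay exp(-delta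
  |n|) of the potential, and by the decay exp(-delta |n| / 2) of the coordinates of data in
  \<open>ell2 \<delta>\<close>.\<close>

definition r :: real where "r = exp (\<delta> / 4)"

text \<open>The disc \<open>\<Omega>\<close> reaches from -eta to 1 + eta. The bound r - 1 keeps
  |zeta| <= r; the bound 1 / 2 keeps the pole of the entries at zeta = -1 at distance at least 1 /
  2.\<close>

definition \<eta> :: real where "\<eta> = min (1 / 2) (r - 1)"

definition \<Omega> :: "complex set" where "\<Omega> = ball (1 / 2) (1 / 2 + \<eta>)"

text \<open>In the solution rows, 2 bounds 1 / |1 + zeta| and r / (r - 1) comes from the geometric
  sum. In the mean row, r^2 + 1 dominates both zeta^2 and the entries -1.\<close>

fun \<alpha> :: "idx \<Rightarrow> real" where
  "\<alpha> (Src n) = Cv * exp (- \<delta> * real_of_int \<bar>n\<bar>)"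
| "\<alpha> (Sol m) = 2 * r / (r - 1) * exp (\<delta> / 4 * real_of_int \<bar>m\<bar>)"
| "\<alpha> Mean = r\<^sup>2 + 1"

fun \<beta> :: "idx \<Rightarrow> real" where
  "\<beta> (Src j) = exp (\<delta> / 4 * real_of_int \<bar>j\<bar>)"
| "\<beta> (Sol m) = exp (- \<delta> * real_of_int \<bar>m\<bar>)"
| "\<beta> Mean = 1"

lemma r_gt_1: "r > 1"
  unfolding r_def using \<delta>_pos by simp

lemma \<eta>: "0 < \<eta>" "\<eta> \<le> 1 / 2" "\<eta> \<le> r - 1"
  using r_gt_1 by (auto simp: \<eta>_def min_def)

lemma Cv_nonneg: "0 \<le> Cv"
proof -
  have "0 \<le> Cv * (exp 0 * exp 0)" using order_trans[OF norm_ge_zero V_decay[of 0 0]] by simp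
  then show ?thesis by simp
qed

lemma \<Omega>_facts: "open \<Omega>" "connected \<Omega>" "0 \<in> \<Omega>" "1 \<in> \<Omega>"
  using \<eta> by (auto simp: \<Omega>_def dist_norm norm_divide)

lemma \<Omega>_bounds:
  assumes "\<zeta> \<in> \<Omega>"
  shows "cmod \<zeta> \<le> r" "1 / 2 \<le> cmod (1 + \<zeta>)"
proof -
  have d: "cmod (\<zeta> - 1 / 2) < 1 / 2 + \<eta>" using assms by (simp add: \<Omega>_def dist_norm norm_minus_commute)
  have "cmod \<zeta> \<le> cmod (\<zeta> - 1 / 2) + cmod (1 / 2)"
    using norm_triangle_ineq[of "\<zeta> - 1 / 2" "1 / 2"] by simp
  then show "cmod \<zeta> \<le> r" using d \<eta>(3) by (simp add: norm_divide)
  have "cmod (3 / 2) \<le> cmod (1 + \<zeta>) + cmod (\<zeta> - 1 / 2)"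
    using norm_triangle_ineq4[of "1 + \<zeta>" "\<zeta> - 1 / 2"] by simp
  then show "1 / 2 \<le> cmod (1 + \<zeta>)" using d \<eta>(2) by (simp add: norm_divide)
qed

lemma r_power: "r ^ nat \<bar>n\<bar> = exp (\<delta> / 4 * real_of_int \<bar>n\<bar>)"
  by (simp add: r_def exp_of_nat_mult[symmetric] mult.commute)

lemma geometric_bound:
  assumes "\<zeta> \<in> \<Omega>"
  shows "cmod ((\<Sum>l\<le>nat \<bar>m - j\<bar>. \<zeta> ^ l) / (1 + \<zeta>)) \<le> \<alpha> (Sol m) * \<beta> (Src j)"
proof -
  let ?p = "nat \<bar>m - j\<bar>"
  have "cmod (\<Sum>l\<le>?p. \<zeta> ^ l) \<le> (\<Sum>l\<le>?p. r ^ l)"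
    using \<Omega>_bounds(1)[OF assms] by (intro sum_norm_le) (simp add: norm_power power_mono)
  also have "\<dots> = (r ^ Suc ?p - 1) / (r - 1)"
    using geometric_sum[of r "Suc ?p"] r_gt_1 by (simp add: lessThan_Suc_atMost)
  also have "\<dots> \<le> r * r ^ ?p / (r - 1)"
    using r_gt_1 by (intro divide_right_mono) auto
  \<comment> \<open>The triangle inequality |m - j| <= |m| + |j| separates the variables, at the
    price of growth in both; the weights absorb it.\<close>
  also have "\<dots> \<le> r * (r ^ nat \<bar>m\<bar> * r ^ nat \<bar>j\<bar>) / (r - 1)"
    using r_gt_1 by (intro divide_right_mono mult_left_mono) (auto simp flip: power_add intro!: power_increasing)
  finally have num: "cmod (\<Sum>l\<le>?p. \<zeta> ^ l) \<le> r * (r ^ nat \<bar>m\<bar> * r ^ nat \<bar>j\<bar>) / (r - 1)" .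
  have "cmod ((\<Sum>l\<le>?p. \<zeta> ^ l) / (1 + \<zeta>)) = cmod (\<Sum>l\<le>?p. \<zeta> ^ l) / cmod (1 + \<zeta>)"
    by (rule norm_divide)
  also have "\<dots> \<le> (r * (r ^ nat \<bar>m\<bar> * r ^ nat \<bar>j\<bar>) / (r - 1)) / (1 / 2)"
    using num \<Omega>_bounds(2)[OF assms] r_gt_1 by (intro frac_le) auto
  also have "\<dots> = \<alpha> (Sol m) * \<beta> (Src j)"
    by (simp add: r_power)
  finally show ?thesis .
qed

sublocale kernel_family \<Omega> "sys v" \<alpha> \<beta>
proof
  show "open \<Omega>" by (rule \<Omega>_facts)
  show "(\<lambda>\<zeta>. sys v \<zeta> i j) holomorphic_on \<Omega>" for i j
  proof (cases "(v, 0::complex, i, j)" rule: sys.cases)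
    case (2 v' \<zeta> m j')
    have "1 + \<zeta> \<noteq> 0" if "\<zeta> \<in> \<Omega>" for \<zeta> using \<Omega>_bounds(2)[OF that] by auto
    then show ?thesis using 2 by (auto intro!: holomorphic_intros)
  qed (auto intro!: holomorphic_intros)
  show "0 < \<beta> j" for j by (cases j) auto
  show \<alpha>0: "0 \<le> \<alpha> i" for i using r_gt_1 Cv_nonneg by (cases i) auto
  show "cmod (sys v \<zeta> i j) \<le> \<alpha> i * \<beta> j" if \<zeta>: "\<zeta> \<in> \<Omega>" for \<zeta> i j
  proof (cases i)
    case (Src n)
    then show ?thesis
      using V_decay[of n] Cv_nonneg by (cases j) (auto simp: mult.assoc)
  next
    case (Sol m)
    show ?thesis
    proof (cases j)
      case (Src j')
      then show ?thesis using Sol geometric_bound[OF \<zeta>, of m j'] by simp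
    next
      case (Sol m')
      have "0 \<le> \<alpha> (Sol m) * \<beta> (Sol m')"
        using \<alpha>0[of "Sol m"] by (rule mult_nonneg_nonneg) simp
      then show ?thesis using Sol \<open>i = Sol m\<close> by simp
    next
      case Mean
      have "1 * 1 \<le> 2 * r / (r - 1) * exp (\<delta> / 4 * real_of_int \<bar>m\<bar>)"
        using r_gt_1 \<delta>_pos by (intro mult_mono) auto
      then show ?thesis using Sol Mean by simp
    qed
  next
    case Mean
    have r2: "1 \<le> r\<^sup>2 + 1" by simp
    show ?thesis
    proof (cases j)
      case (Src j')
      have "1 * 1 \<le> (r\<^sup>2 + 1) * exp (\<delta> / 4 * real_of_int \<bar>j'\<bar>)"
        using \<delta>_pos by (intro mult_mono) auto
      then show ?thesis using Src Mean by simp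
    next
      case (Sol m)
      then show ?thesis using Mean by simp
    next
      case Mean
      have "(cmod \<zeta>)\<^sup>2 \<le> r\<^sup>2" using \<Omega>_bounds(1)[OF \<zeta>] by (intro power_mono) auto
      then show ?thesis using Mean \<open>i = Mean\<close> by (simp add: norm_power)
    qed
  qed
  show "(\<lambda>i. \<beta> i * \<alpha> i) summable_on UNIV"
    unfolding summable_on_idx
  proof
    \<comment> \<open>In both families the product of the weights has the exponent delta / 4 - delta
      = - 3 delta / 4.\<close>
    have e: "(\<lambda>n::int. c * exp (- (3 * \<delta> / 4) * real_of_int \<bar>n\<bar>)) summable_on UNIV" for c
      using \<delta>_pos by (intro summable_on_cmult_right summable_on_exp_abs) simp
    have "\<beta> (Src n) * \<alpha> (Src n) = Cv * exp (- (3 * \<delta> / 4) * real_of_int \<bar>n\<bar>)" for n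
      by (simp add: field_simps flip: exp_add)
    then show "(\<lambda>n. \<beta> (Src n) * \<alpha> (Src n)) summable_on UNIV" using e by (simp only:)
    have "\<beta> (Sol n) * \<alpha> (Sol n) = 2 * r / (r - 1) * exp (- (3 * \<delta> / 4) * real_of_int \<bar>n\<bar>)" for n
      by (simp add: field_simps flip: exp_add)
    then show "(\<lambda>n. \<beta> (Sol n) * \<alpha> (Sol n)) summable_on UNIV" using e by (simp only:)
  qed
qed

lemma kapp_rows:
  assumes "\<zeta> \<in> \<Omega>" "wsum \<beta> w"
  shows "kapp (sys v \<zeta>) w (Src n) = (\<Sum>\<^sub>\<infinity>m. v n m * w (Sol m))"
    and "kapp (sys v \<zeta>) w (Sol m) = (\<Sum>\<^sub>\<infinity>j. (\<Sum>l\<le>nat \<bar>m - j\<bar>. \<zeta> ^ l) / (1 + \<zeta>) * w (Src j)) - w Mean"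
    and "kapp (sys v \<zeta>) w Mean = - (\<Sum>\<^sub>\<infinity>j. w (Src j)) - \<zeta>\<^sup>2 * w Mean"
proof -
  note s = dominated_kernel.kapp_bound(1)[OF dominated[OF assms(1)] assms(2)]
  show "kapp (sys v \<zeta>) w (Src n) = (\<Sum>\<^sub>\<infinity>m. v n m * w (Sol m))"
    unfolding kapp_def infsum_idx[OF s] by simp
  show "kapp (sys v \<zeta>) w (Sol m) = (\<Sum>\<^sub>\<infinity>j. (\<Sum>l\<le>nat \<bar>m - j\<bar>. \<zeta> ^ l) / (1 + \<zeta>) * w (Src j)) - w Mean"
    unfolding kapp_def infsum_idx[OF s] by simp
  show "kapp (sys v \<zeta>) w Mean = - (\<Sum>\<^sub>\<infinity>j. w (Src j)) - \<zeta>\<^sup>2 * w Mean"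
    unfolding kapp_def infsum_idx[OF s] by (simp add: infsum_uminus)
qed

text \<open>The weight is at least 1 on sources, so the source part lies in plain l1, where its mean
  is defined, and hence in l2.\<close>

lemma wsum_Src:
  assumes "wsum \<beta> w"
  shows "(\<lambda>n. w (Src n)) summable_on UNIV" "(\<lambda>n. w (Src n)) \<in> ell2 0"
    and "ell2_norm 0 (\<lambda>n. w (Src n)) \<le> wnorm \<beta> w"
proof -
  have sb: "(\<lambda>n. \<beta> (Src n) * cmod (w (Src n))) summable_on UNIV"
    using assms unfolding wsum_def summable_on_idx by blast
  have le: "cmod (w (Src n)) \<le> \<beta> (Src n) * cmod (w (Src n))" for n
  proof -
    have "1 \<le> \<beta> (Src n)" using \<delta>_pos by simp
    from mult_right_mono[OF this norm_ge_zero] show ?thesis by simp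
  qed
  have abs: "(\<lambda>n. cmod (w (Src n))) summable_on UNIV"
    using sb le by (rule Infinite_Sum.abs_summable_on_comparison_test')
  then show "(\<lambda>n. w (Src n)) summable_on UNIV" by (rule Infinite_Sum.abs_summable_summable)
  define N where "N = (\<Sum>\<^sub>\<infinity>n. cmod (w (Src n)))"
  have wN: "cmod (w (Src n)) \<le> N" for n
    using finite_sum_le_infsum[OF abs, of "{n}"] by (simp add: N_def)
  have t: "ell2_term 0 (\<lambda>n. w (Src n)) n \<le> N * cmod (w (Src n))" for n
    using mult_right_mono[OF wN[of n] norm_ge_zero[of "w (Src n)"]] by (simp add: power2_eq_square)
  note d = ell2_dominated[OF t summable_on_cmult_right[OF abs]]
  show "(\<lambda>n. w (Src n)) \<in> ell2 0" by (rule d(1))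
  have N0: "0 \<le> N" unfolding N_def by (intro infsum_nonneg) simp
  have "(ell2_norm 0 (\<lambda>n. w (Src n)))\<^sup>2 \<le> N\<^sup>2"
    using d(2) by (simp add: infsum_cmult_right' N_def power2_eq_square)
  then have "ell2_norm 0 (\<lambda>n. w (Src n)) \<le> N" using N0 by (rule power2_le_imp_le)
  also have "N \<le> (\<Sum>\<^sub>\<infinity>n. \<beta> (Src n) * cmod (w (Src n)))"
    unfolding N_def using abs sb le by (rule infsum_mono)
  also have "\<dots> \<le> wnorm \<beta> w"
  proof -
    have "0 \<le> (\<Sum>\<^sub>\<infinity>n. \<beta> (Sol n) * cmod (w (Sol n)))" by (intro infsum_nonneg) simp
    then show ?thesis
      unfolding wnorm_def using infsum_idx[OF assms[unfolded wsum_def]] by simp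
  qed
  finally show "ell2_norm 0 (\<lambda>n. w (Src n)) \<le> wnorm \<beta> w" .
qed

lemma free_green_split:
  assumes "\<zeta> \<in> \<Omega>" "cmod \<zeta> < 1"
  shows "free_green \<zeta> n = 1 / (1 - \<zeta>\<^sup>2) - (\<Sum>l\<le>nat \<bar>n\<bar>. \<zeta> ^ l) / (1 + \<zeta>)"
proof -
  have ne: "1 + \<zeta> \<noteq> 0" "1 - \<zeta> \<noteq> 0" using \<Omega>_bounds(2)[OF assms(1)] assms(2) by auto
  have "(1 - \<zeta>) * (\<Sum>l\<le>nat \<bar>n\<bar>. \<zeta> ^ l) = 1 - \<zeta> ^ Suc (nat \<bar>n\<bar>)"
    by (rule sum_gp_basic)
  then have "\<zeta> ^ Suc (nat \<bar>n\<bar>) = 1 - (1 - \<zeta>) * (\<Sum>l\<le>nat \<bar>n\<bar>. \<zeta> ^ l)" by simp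
  moreover have "1 - \<zeta>\<^sup>2 = (1 - \<zeta>) * (1 + \<zeta>)" by (simp add: power2_eq_square algebra_simps)
  ultimately show ?thesis
    unfolding free_green_def using ne by (simp only: diff_divide_distrib) simp
qed

lemma conv_free_green_eq:
  assumes \<zeta>: "\<zeta> \<in> \<Omega>" "cmod \<zeta> < 1" and w: "wsum \<beta> w"
  shows "conv (free_green \<zeta>) (\<lambda>j. w (Src j)) m =
    (\<Sum>\<^sub>\<infinity>j. w (Src j)) / (1 - \<zeta>\<^sup>2) - (\<Sum>\<^sub>\<infinity>j. (\<Sum>l\<le>nat \<bar>m - j\<bar>. \<zeta> ^ l) / (1 + \<zeta>) * w (Src j))"
proof -
  have s: "(\<lambda>j. sys v \<zeta> (Sol m) (Src j) * w (Src j)) summable_on UNIV"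
    using dominated_kernel.kapp_bound(1)[OF dominated[OF \<zeta>(1)] w, of "Sol m"]
    unfolding summable_on_idx by blast
  have "conv (free_green \<zeta>) (\<lambda>j. w (Src j)) m =
      (\<Sum>\<^sub>\<infinity>j. 1 / (1 - \<zeta>\<^sup>2) * w (Src j) - sys v \<zeta> (Sol m) (Src j) * w (Src j))"
    unfolding conv_def free_green_split[OF \<zeta>] by (intro infsum_cong) (simp add: left_diff_distrib)
  also have "\<dots> = (\<Sum>\<^sub>\<infinity>j. 1 / (1 - \<zeta>\<^sup>2) * w (Src j)) - (\<Sum>\<^sub>\<infinity>j. sys v \<zeta> (Sol m) (Src j) * w (Src j))"
    by (intro infsumI has_sum_diff has_sum_infsum summable_on_cmult_right wsum_Src(1)[OF w] s)
  finally show ?thesis unfolding infsum_cmult_right' by simp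
qed

lemma V_eq: "x \<in> ell2 0 \<Longrightarrow> V x n = (\<Sum>\<^sub>\<infinity>m. v n m * x m)"
  using bounded_op_has_sum[OF V_op, of x n] by (simp add: infsumI)

end

section \<open>The Fredholm system and the equation in l2\<close>

context decaying_potential
begin

text \<open>Since 0^0 = 1, every geometric sum equals 1 at zeta = 0, so the solution rows see only
  the total mass S of the source. The mean row says tau = S, which cancels this term; thus u = 0,
  then g = -V u = 0, then tau = 0.\<close>

lemma system_at_0:
  assumes w: "wsum \<beta> w" and eq: "\<And>i. w i + kapp (sys v 0) w i = 0"
  shows "w = (\<lambda>_. 0)"
proof -
  note rows = kapp_rows[OF \<Omega>_facts(3) w]
  let ?S = "\<Sum>\<^sub>\<infinity>j. w (Src j)"
  have "(\<Sum>l\<le>p. (0 :: complex) ^ l) = 1" for p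
    by (induction p) auto
  then have "w (Sol m) + ?S - w Mean = 0" for m
    using eq[of "Sol m"] by (simp add: rows(2) algebra_simps)
  moreover have M: "w Mean = ?S" using eq[of Mean] by (simp add: rows(3))
  ultimately have Sol: "w (Sol m) = 0" for m by simp
  then have Src: "w (Src n) = 0" for n using eq[of "Src n"] by (simp add: rows(1))
  then have "w Mean = 0" using M by simp
  then show ?thesis using Src Sol by (metis (full_types) idx.exhaust)
qed

text \<open>Eliminating the mean puts the singular part back, so that the regular part and tau
  recombine to the full free resolvent.\<close>

lemma Sol_eq_conv:
  assumes \<zeta>: "\<zeta> \<in> \<Omega>" "cmod \<zeta> < 1" and w: "wsum \<beta> w"
    and Sol: "w (Sol m) + kapp (sys v \<zeta>) w (Sol m) = b"
    and Mean: "w Mean + kapp (sys v \<zeta>) w Mean = 0"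
  shows "w (Sol m) = b + conv (free_green \<zeta>) (\<lambda>j. w (Src j)) m"
proof -
  note rows = kapp_rows[OF \<zeta>(1) w]
  have "(1 - \<zeta>\<^sup>2) * w Mean = (\<Sum>\<^sub>\<infinity>j. w (Src j))"
    using Mean by (simp add: rows(3) algebra_simps)
  then have "w Mean = (\<Sum>\<^sub>\<infinity>j. w (Src j)) / (1 - \<zeta>\<^sup>2)"
    using one_minus_sq_neq_0[OF \<zeta>(2)] by (simp add: field_simps)
  then show ?thesis
    using Sol unfolding rows(2) conv_free_green_eq[OF \<zeta> w] by (simp add: algebra_simps)
qed

lemma shift_op_HV: "shift_op (HV V) z x n = shift_op H0 z x n + V x n"
  by (simp add: shift_op_def HV_def)

lemma shift_op_HV_ell2: "x \<in> ell2 0 \<Longrightarrow> shift_op (HV V) z x \<in> ell2 0"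
  unfolding shift_op_HV[abs_def] by (intro ell2_add(1) shift_op_H0_ell2 bounded_op_simps(1)[OF V_op])

lemma shift_op_HV_lincomb:
  assumes "x \<in> ell2 0" "y \<in> ell2 0"
  shows "shift_op (HV V) z (\<lambda>n. c * x n + d * y n) =
    (\<lambda>n. c * shift_op (HV V) z x n + d * shift_op (HV V) z y n)"
proof -
  have "V (\<lambda>n. c * x n + d * y n) = (\<lambda>n. c * V x n + d * V y n)"
    using bounded_op_simps(2)[OF V_op ell2_scale(1)[OF assms(1)] ell2_scale(1)[OF assms(2)], of c d]
    by (simp add: bounded_op_simps(3)[OF V_op] assms)
  then show ?thesis
    by (simp add: shift_op_HV[abs_def] shift_op_def H0_def algebra_simps)
qed

text \<open>Needed because an l2 solution only becomes a solution of the system once its source -V u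
  is known to lie in the weighted space.\<close>

lemma V_decay_bound:
  assumes x: "x \<in> ell2 0"
  obtains B where "\<And>n. cmod (V x n) \<le> B * exp (- \<delta> * real_of_int \<bar>n\<bar>)"
proof -
  let ?b = "\<lambda>m::int. exp (- \<delta> * real_of_int \<bar>m\<bar>)"
  have "wsum ?b x"
  proof (rule wsum_dominated(1))
    show "cmod (x m) \<le> ell2_norm 0 x" for m by (rule ell2_0_coord[OF x])
    show "(\<lambda>m. ?b m * ell2_norm 0 x) summable_on UNIV"
      using \<delta>_pos by (intro summable_on_cmult_left summable_on_exp_abs) simp
  qed simp
  then have "cmod (\<Sum>\<^sub>\<infinity>m. v n m * x m) \<le> Cv * ?b n * wnorm ?b x" for n
    using V_decay[of n] by (intro has_sum_linear_bound(2)) (simp add: mult.assoc)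
  then show ?thesis
    using that[of "Cv * wnorm ?b x"] by (simp add: V_eq[OF x] mult_ac)
qed

text \<open>General data f in l2 do not decay enough for the source rows, whose weight grows. Their
  free solution is placed in the solution rows instead, where the weight decays and every l2
  sequence is admissible.\<close>

lemma Sol_rhs:
  assumes b: "b \<in> ell2 0"
  defines "\<phi> \<equiv> (\<lambda>i. case i of Sol m \<Rightarrow> b m | _ \<Rightarrow> 0)"
  shows "wsum \<beta> \<phi>" "wnorm \<beta> \<phi> \<le> (\<Sum>\<^sub>\<infinity>m::int. exp (- \<delta> * real_of_int \<bar>m\<bar>)) * ell2_norm 0 b"
proof -
  let ?b = "\<lambda>m::int. exp (- \<delta> * real_of_int \<bar>m\<bar>)"
  have le: "?b m * cmod (b m) \<le> ?b m * ell2_norm 0 b" for m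
    using ell2_0_coord[OF b] by (intro mult_left_mono) auto
  have s: "(\<lambda>m. ?b m * ell2_norm 0 b) summable_on UNIV"
    using \<delta>_pos by (intro summable_on_cmult_left summable_on_exp_abs) simp
  have sb: "(\<lambda>m. ?b m * cmod (b m)) summable_on UNIV"
    using s le by (rule summable_on_comparison_test) simp
  then show w: "wsum \<beta> \<phi>"
    unfolding wsum_def summable_on_idx by (simp add: \<phi>_def)
  have "wnorm \<beta> \<phi> = (\<Sum>\<^sub>\<infinity>m. ?b m * cmod (b m))"
    unfolding wnorm_def infsum_idx[OF w[unfolded wsum_def]] by (simp add: \<phi>_def)
  also have "\<dots> \<le> (\<Sum>\<^sub>\<infinity>m. ?b m * ell2_norm 0 b)"
    using sb s le by (rule infsum_mono)
  finally show "wnorm \<beta> \<phi> \<le> (\<Sum>\<^sub>\<infinity>m::int. ?b m) * ell2_norm 0 b"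
    by (simp only: infsum_cmult_left')
qed

text \<open>Data in \<open>ell2 \<delta>\<close> do fit the source rows. The right-hand side is then
  independent of zeta, as the holomorphic solution formula requires.\<close>

lemma Src_rhs:
  assumes f: "f \<in> ell2 \<delta>"
  shows "wsum \<beta> (\<lambda>i. case i of Src n \<Rightarrow> f n | _ \<Rightarrow> 0)"
proof -
  have "(\<lambda>n. exp (\<delta> / 4 * real_of_int \<bar>n\<bar>) * cmod (f n)) summable_on UNIV"
  proof (rule summable_on_comparison_test)
    show "(\<lambda>n::int. exp (- (\<delta> / 4) * real_of_int \<bar>n\<bar>) * ell2_norm \<delta> f) summable_on UNIV"
      using \<delta>_pos by (intro summable_on_cmult_left summable_on_exp_abs) simp
    show "exp (\<delta> / 4 * real_of_int \<bar>n\<bar>) * cmod (f n) \<le> exp (- (\<delta> / 4) * real_of_int \<bar>n\<bar>) * ell2_norm \<delta> f" for n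
    proof -
      have "exp (\<delta> / 4 * real_of_int \<bar>n\<bar>) * cmod (f n) \<le>
          exp (\<delta> / 4 * real_of_int \<bar>n\<bar>) * (exp (- \<delta> * real_of_int \<bar>n\<bar> / 2) * ell2_norm \<delta> f)"
        by (intro mult_left_mono ell2_coord_bound f) simp
      also have "\<dots> = exp (- (\<delta> / 4) * real_of_int \<bar>n\<bar>) * ell2_norm \<delta> f"
        by (simp add: mult.assoc[symmetric] flip: exp_add)
      finally show ?thesis .
    qed
  qed simp
  then show ?thesis unfolding wsum_def summable_on_idx by simp
qed

text \<open>Serves both placements of the data: h = f, a = 0 for f in l2, and h = 0, a = f for f in
  \<open>ell2 \<delta>\<close>.\<close>

lemma solution_solves:
  assumes \<zeta>: "\<zeta> \<in> \<Omega>" "\<zeta> \<noteq> 0" "cmod \<zeta> < 1" and w: "wsum \<beta> w" and h: "h \<in> ell2 0"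
    and Src: "\<And>n. w (Src n) + kapp (sys v \<zeta>) w (Src n) = a n"
    and Sol: "\<And>m. w (Sol m) + kapp (sys v \<zeta>) w (Sol m) = conv (free_green \<zeta>) h m"
    and Mean: "w Mean + kapp (sys v \<zeta>) w Mean = 0"
  shows "(\<lambda>n. w (Sol n)) \<in> ell2 0"
    and "shift_op (HV V) (2 - \<zeta> - 1 / \<zeta>) (\<lambda>n. w (Sol n)) = (\<lambda>n. h n + a n)"
    and "ell2_norm 0 (\<lambda>n. w (Sol n)) \<le> 2 * (\<Sum>\<^sub>\<infinity>n. cmod (free_green \<zeta> n)) * (ell2_norm 0 h + wnorm \<beta> w)"
proof -
  let ?z = "2 - \<zeta> - 1 / \<zeta>" and ?g = "\<lambda>n. w (Src n)" and ?u = "\<lambda>n. w (Sol n)"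
  note g = wsum_Src(2)[OF w] and gs = free_green_summable[OF \<zeta>(3)]
  have u_eq: "?u = (\<lambda>n. conv (free_green \<zeta>) h n + conv (free_green \<zeta>) ?g n)"
    using Sol_eq_conv[OF \<zeta>(1,3) w Sol Mean] by (rule ext)
  note ch = conv_ell2[OF gs h] and cg = conv_ell2[OF gs g]
  show u: "?u \<in> ell2 0" unfolding u_eq by (rule ell2_add(1)[OF ch(1) cg(1)])
  have "shift_op H0 ?z ?u n = shift_op H0 ?z (conv (free_green \<zeta>) h) n + shift_op H0 ?z (conv (free_green \<zeta>) ?g) n" for n
    unfolding u_eq by (simp add: shift_op_def H0_def algebra_simps add_divide_distrib)
  then have "shift_op H0 ?z ?u n = h n + w (Src n)" for n
    by (simp add: conv_free_green_right_inverse[OF \<zeta>(2,3)] h g)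
  moreover have "w (Src n) + V ?u n = a n" for n
    using Src[of n] by (simp add: V_eq[OF u] kapp_rows(1)[OF \<zeta>(1) w])
  ultimately show "shift_op (HV V) ?z ?u = (\<lambda>n. h n + a n)"
    by (simp add: fun_eq_iff shift_op_HV add.assoc)
  have "ell2_norm 0 ?u \<le> 2 * (ell2_norm 0 (conv (free_green \<zeta>) h) + ell2_norm 0 (conv (free_green \<zeta>) ?g))"
    unfolding u_eq by (rule ell2_add(2)[OF ch(1) cg(1)])
  also have "\<dots> \<le> 2 * ((\<Sum>\<^sub>\<infinity>n. cmod (free_green \<zeta> n)) * ell2_norm 0 h +
      (\<Sum>\<^sub>\<infinity>n. cmod (free_green \<zeta> n)) * ell2_norm 0 ?g)"
    using ch(2) cg(2) by (intro mult_left_mono add_mono) auto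
  also have "\<dots> = 2 * (\<Sum>\<^sub>\<infinity>n. cmod (free_green \<zeta> n)) * (ell2_norm 0 h + ell2_norm 0 ?g)"
    by (simp add: algebra_simps)
  also have "\<dots> \<le> 2 * (\<Sum>\<^sub>\<infinity>n. cmod (free_green \<zeta> n)) * (ell2_norm 0 h + wnorm \<beta> w)"
    using wsum_Src(3)[OF w] by (intro mult_left_mono add_mono mult_nonneg_nonneg infsum_nonneg) auto
  finally show "ell2_norm 0 ?u \<le> 2 * (\<Sum>\<^sub>\<infinity>n. cmod (free_green \<zeta> n)) * (ell2_norm 0 h + wnorm \<beta> w)" .
qed

text \<open>For injectivity: an l2 null vector together with its source and the mean of that source
  is a null vector of the system, hence 0 where D does not vanish.\<close>

lemma null_solution:
  assumes \<zeta>: "\<zeta> \<in> \<Omega>" "\<zeta> \<noteq> 0" "cmod \<zeta> < 1" and u: "u \<in> ell2 0"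
    and eq: "shift_op (HV V) (2 - \<zeta> - 1 / \<zeta>) u = (\<lambda>_. 0)"
  obtains w where "wsum \<beta> w" "\<And>i. w i + kapp (sys v \<zeta>) w i = 0" "\<And>n. w (Sol n) = u n"
proof -
  define g where "g = shift_op H0 (2 - \<zeta> - 1 / \<zeta>) u"
  have gV: "g n = - V u n" for n
    using fun_cong[OF eq, of n] by (simp add: g_def shift_op_HV add_eq_0_iff2)
  have ug: "u = conv (free_green \<zeta>) g"
    unfolding g_def by (rule conv_free_green_left_inverse[OF \<zeta>(2,3) u, symmetric])
  define w where "w = (\<lambda>i. case i of Src n \<Rightarrow> g n | Sol n \<Rightarrow> u n | Mean \<Rightarrow> (\<Sum>\<^sub>\<infinity>j. g j) / (1 - \<zeta>\<^sup>2))"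
  obtain B where B: "\<And>n. cmod (V u n) \<le> B * exp (- \<delta> * real_of_int \<bar>n\<bar>)"
    using V_decay_bound[OF u] by blast
  have ws: "wsum \<beta> w"
    unfolding wsum_def summable_on_idx
  proof
    have "(\<lambda>n. exp (\<delta> / 4 * real_of_int \<bar>n\<bar>) * cmod (g n)) summable_on UNIV"
    proof (rule summable_on_comparison_test)
      show "(\<lambda>n::int. B * exp (- (3 * \<delta> / 4) * real_of_int \<bar>n\<bar>)) summable_on UNIV"
        using \<delta>_pos by (intro summable_on_cmult_right summable_on_exp_abs) simp
      show "exp (\<delta> / 4 * real_of_int \<bar>n\<bar>) * cmod (g n) \<le> B * exp (- (3 * \<delta> / 4) * real_of_int \<bar>n\<bar>)" for n
      proof -
        have "exp (\<delta> / 4 * real_of_int \<bar>n\<bar>) * cmod (g n) \<le>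
            exp (\<delta> / 4 * real_of_int \<bar>n\<bar>) * (B * exp (- \<delta> * real_of_int \<bar>n\<bar>))"
          using B[of n] by (intro mult_left_mono) (auto simp: gV)
        also have "\<dots> = B * (exp (\<delta> / 4 * real_of_int \<bar>n\<bar>) * exp (- \<delta> * real_of_int \<bar>n\<bar>))"
          by simp
        also have "\<dots> = B * exp (- (3 * \<delta> / 4) * real_of_int \<bar>n\<bar>)"
          unfolding exp_add[symmetric] by (simp add: field_simps)
        finally show ?thesis .
      qed
    qed simp
    then show "(\<lambda>n. \<beta> (Src n) * cmod (w (Src n))) summable_on UNIV" by (simp add: w_def)
    have "(\<lambda>n. \<beta> (Sol n) * cmod (case Sol n of Sol m \<Rightarrow> u m | _ \<Rightarrow> 0)) summable_on UNIV"
      using Sol_rhs(1)[OF u] unfolding wsum_def summable_on_idx by blast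
    then show "(\<lambda>n. \<beta> (Sol n) * cmod (w (Sol n))) summable_on UNIV" by (simp add: w_def)
  qed
  note rows = kapp_rows[OF \<zeta>(1) ws]
  have "w i + kapp (sys v \<zeta>) w i = 0" for i
  proof (cases i)
    case (Src n)
    then show ?thesis by (simp add: rows(1)) (simp add: w_def gV V_eq[OF u])
  next
    case (Sol m)
    have "w (Sol m) = conv (free_green \<zeta>) (\<lambda>j. w (Src j)) m"
      using fun_cong[OF ug, of m] by (simp add: w_def)
    also have "\<dots> = w Mean - (\<Sum>\<^sub>\<infinity>j. (\<Sum>l\<le>nat \<bar>m - j\<bar>. \<zeta> ^ l) / (1 + \<zeta>) * w (Src j))"
      unfolding conv_free_green_eq[OF \<zeta>(1,3) ws] by (simp add: w_def)
    finally show ?thesis using Sol by (simp only: rows(2)) simp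
  next
    case Mean
    have "(1 - \<zeta>\<^sup>2) * w Mean = (\<Sum>\<^sub>\<infinity>j. w (Src j))"
      using one_minus_sq_neq_0[OF \<zeta>(3)] by (simp add: w_def)
    then show ?thesis unfolding Mean rows(3) by (simp add: algebra_simps)
  qed
  then show ?thesis using that[OF ws] by (simp add: w_def)
qed

lemma resolvent_formula:
  obtains D :: "complex \<Rightarrow> complex" and H :: "(int \<Rightarrow> complex) \<Rightarrow> complex \<Rightarrow> int \<Rightarrow> complex" where
    "D holomorphic_on \<Omega>" "D 0 \<noteq> 0"
    "\<And>f n. f \<in> ell2 \<delta> \<Longrightarrow> (\<lambda>\<zeta>. H f \<zeta> n) holomorphic_on \<Omega>"
    "\<And>\<zeta>. \<zeta> \<in> \<Omega> \<Longrightarrow> \<zeta> \<noteq> 0 \<Longrightarrow> cmod \<zeta> < 1 \<Longrightarrow> D \<zeta> \<noteq> 0 \<Longrightarrow>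
       2 - \<zeta> - 1 / \<zeta> \<in> resolvent_set (HV V)"
    "\<And>\<zeta> f n. \<zeta> \<in> \<Omega> \<Longrightarrow> \<zeta> \<noteq> 0 \<Longrightarrow> cmod \<zeta> < 1 \<Longrightarrow> D \<zeta> \<noteq> 0 \<Longrightarrow> f \<in> ell2 \<delta> \<Longrightarrow>
       resolvent (HV V) (2 - \<zeta> - 1 / \<zeta>) f n = H f \<zeta> n / D \<zeta>"
proof -
  show ?thesis
  proof (rule fredholm_alternative)
    fix D :: "complex \<Rightarrow> complex" and c :: "complex \<Rightarrow> real"
    assume D: "D holomorphic_on \<Omega>"
      and sing: "\<And>z. z \<in> \<Omega> \<Longrightarrow> D z = 0 \<Longrightarrow>
         \<exists>g. wsum \<beta> g \<and> g \<noteq> (\<lambda>_. 0) \<and> (\<forall>i. g i + kapp (sys v z) g i = 0)"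
      and uniq: "\<And>z g. z \<in> \<Omega> \<Longrightarrow> D z \<noteq> 0 \<Longrightarrow> wsum \<beta> g \<Longrightarrow> (\<And>i. g i + kapp (sys v z) g i = 0) \<Longrightarrow>
         g = (\<lambda>_. 0)"
      and sol: "\<And>f. wsum \<beta> f \<Longrightarrow> \<exists>H. (\<forall>i. (\<lambda>z. H z i) holomorphic_on \<Omega>) \<and>
         (\<forall>z\<in>\<Omega>. wsum \<beta> (H z) \<and> wnorm \<beta> (H z) \<le> c z * wnorm \<beta> f \<and>
           (\<forall>i. H z i + kapp (sys v z) (H z) i = D z * f i))"
    define P where "P f H \<longleftrightarrow> (\<forall>i. (\<lambda>z. H z i) holomorphic_on \<Omega>) \<and>
      (\<forall>z\<in>\<Omega>. wsum \<beta> (H z) \<and> wnorm \<beta> (H z) \<le> c z * wnorm \<beta> f \<and>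
        (\<forall>i. H z i + kapp (sys v z) (H z) i = D z * f i))" for f and H :: "complex \<Rightarrow> idx \<Rightarrow> complex"
    define H where "H f = (SOME H. P f H)" for f
    have PH: "P f (H f)" if "wsum \<beta> f" for f
      unfolding H_def using sol[OF that, folded P_def] by (rule someI_ex)
    have Hh: "(\<lambda>z. H f z i) holomorphic_on \<Omega>" if "wsum \<beta> f" for f i
      using PH[OF that] by (simp add: P_def)
    have Hw: "wsum \<beta> (H f z)" and Hn: "wnorm \<beta> (H f z) \<le> c z * wnorm \<beta> f"
      and He: "H f z i + kapp (sys v z) (H f z) i = D z * f i" if "wsum \<beta> f" "z \<in> \<Omega>" for f z i
      using PH[OF that(1)] that(2) by (simp_all add: P_def)
    have "D 0 \<noteq> 0" using sing[OF \<Omega>_facts(3)] system_at_0 by blast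
    define \<phi> where "\<phi> f = (\<lambda>i. case i of Src n \<Rightarrow> f n | _ \<Rightarrow> (0 :: complex))" for f
    define \<psi> where "\<psi> b = (\<lambda>i. case i of Sol n \<Rightarrow> b n | _ \<Rightarrow> (0 :: complex))" for b
    have \<phi>: "wsum \<beta> (\<phi> f)" if "f \<in> ell2 \<delta>" for f
      unfolding \<phi>_def by (rule Src_rhs[OF that])
    have scaled: "wsum \<beta> (\<lambda>i. H f z i / D z)" "wnorm \<beta> (\<lambda>i. H f z i / D z) \<le> c z / cmod (D z) * wnorm \<beta> f"
      "(H f z i / D z) + kapp (sys v z) (\<lambda>i. H f z i / D z) i = f i"
      if f: "wsum \<beta> f" and z: "z \<in> \<Omega>" "D z \<noteq> 0" for f z i
    proof -
      note w = Hw[OF f z(1)]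
      have eq: "(\<lambda>i. H f z i / D z) = (\<lambda>i. (1 / D z) * H f z i + 0 * H f z i)" by auto
      show "wsum \<beta> (\<lambda>i. H f z i / D z)"
        unfolding eq by (rule wsum_lincomb(1)[OF w w \<beta>_pos])
      have "wnorm \<beta> (\<lambda>i. H f z i / D z) \<le> cmod (1 / D z) * wnorm \<beta> (H f z)"
        unfolding eq using wsum_lincomb(2)[OF w w \<beta>_pos, of "1 / D z" 0] by simp
      also have "\<dots> \<le> cmod (1 / D z) * (c z * wnorm \<beta> f)"
        using Hn[OF f z(1)] by (intro mult_left_mono) auto
      finally show "wnorm \<beta> (\<lambda>i. H f z i / D z) \<le> c z / cmod (D z) * wnorm \<beta> f"
        by (simp add: norm_divide)
      have "(H f z i / D z) + kapp (sys v z) (\<lambda>i. H f z i / D z) i = (H f z i + kapp (sys v z) (H f z) i) / D z"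
        unfolding eq dominated_kernel.kapp_lincomb[OF dominated[OF z(1)] w w] by (simp add: add_divide_distrib)
      then show "(H f z i / D z) + kapp (sys v z) (\<lambda>i. H f z i / D z) i = f i"
        using He[OF f z(1), of i] z(2) by simp
  qed
    {
      fix \<zeta> assume \<zeta>: "\<zeta> \<in> \<Omega>" "\<zeta> \<noteq> 0" "cmod \<zeta> < 1" "D \<zeta> \<noteq> 0"
      let ?z = "2 - \<zeta> - 1 / \<zeta>"
      define Ng where "Ng = (\<Sum>\<^sub>\<infinity>n. cmod (free_green \<zeta> n))"
      define Ne where "Ne = (\<Sum>\<^sub>\<infinity>m::int. exp (- \<delta> * real_of_int \<bar>m\<bar>))"
      have N0: "0 \<le> Ng" "0 \<le> Ne" unfolding Ng_def Ne_def by (auto intro: infsum_nonneg)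
      \<comment> \<open>The absolute value is taken because the sign of c is not known.\<close>
      define c' where "c' = \<bar>c \<zeta> / cmod (D \<zeta>)\<bar>"
      have inj: "u = (\<lambda>_. 0)" if u: "u \<in> ell2 0" "shift_op (HV V) ?z u = (\<lambda>_. 0)" for u
      proof -
        obtain w where w: "wsum \<beta> w" "\<And>i. w i + kapp (sys v \<zeta>) w i = 0" "\<And>n. w (Sol n) = u n"
          using null_solution[OF \<zeta>(1-3) u] by blast
        from uniq[OF \<zeta>(1,4) w(1,2)] w(3) show ?thesis by auto
      qed
      \<comment> \<open>The constant combines the bound 2 Ng (|f| + |w|) for the solution with |w|
        <= c' Ne Ng |f|, where Ng comes from the free convolution and Ne from placing its result in
        the solution rows.\<close>
      have surj: "\<exists>u\<in>ell2 0. shift_op (HV V) ?z u = f \<and> ell2_norm 0 u \<le> (2 * Ng * (1 + c' * Ne * Ng)) * ell2_norm 0 f"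
        if f: "f \<in> ell2 0" for f
      proof -
        let ?b = "conv (free_green \<zeta>) f"
        note b = conv_ell2[OF free_green_summable[OF \<zeta>(3)] f]
        note \<psi> = Sol_rhs[OF b(1), folded \<psi>_def]
        let ?w = "\<lambda>i. H (\<psi> ?b) \<zeta> i / D \<zeta>"
        note w = scaled[OF \<psi>(1) \<zeta>(1,4)]
        have "w' (Src n) + kapp (sys v \<zeta>) w' (Src n) = 0"
          "w' (Sol n) + kapp (sys v \<zeta>) w' (Sol n) = ?b n"
          "w' Mean + kapp (sys v \<zeta>) w' Mean = 0" if "w' = ?w" for w' n
          using w(3) that by (simp_all add: \<psi>_def)
        note s = solution_solves[OF \<zeta>(1-3) w(1) f this, OF refl refl refl]
        have "wnorm \<beta> ?w \<le> c' * wnorm \<beta> (\<psi> ?b)"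
          using w(2) mult_right_mono[OF abs_ge_self wnorm_nonneg[OF \<beta>_pos, where g = "\<psi> ?b"]]
          unfolding c'_def by (rule order_trans)
        also have "\<dots> \<le> c' * (Ne * (Ng * ell2_norm 0 f))"
          using \<psi>(2) b(2) N0 unfolding Ne_def[symmetric] Ng_def[symmetric]
          by (intro mult_left_mono) (auto simp: c'_def intro: order_trans mult_left_mono)
        finally have "2 * Ng * (ell2_norm 0 f + wnorm \<beta> ?w) \<le>
            2 * Ng * (ell2_norm 0 f + c' * (Ne * (Ng * ell2_norm 0 f)))"
          using N0 by (intro mult_left_mono add_left_mono) auto
        then have "ell2_norm 0 (\<lambda>n. ?w (Sol n)) \<le> (2 * Ng * (1 + c' * Ne * Ng)) * ell2_norm 0 f"
          using s(3) unfolding Ng_def[symmetric] by (simp add: algebra_simps)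
        then show ?thesis using s(1,2) by (intro bexI[of _ "\<lambda>n. ?w (Sol n)"]) auto
      qed
      have inv: "bij_betw (shift_op (HV V) ?z) (ell2 0) (ell2 0)"
        "bounded_op 0 0 (inv_into (ell2 0) (shift_op (HV V) ?z))"
        "\<And>u. u \<in> ell2 0 \<Longrightarrow> inv_into (ell2 0) (shift_op (HV V) ?z) (shift_op (HV V) ?z u) = u"
        by (rule bounded_op_inv_into[where T = "shift_op (HV V) ?z" and C = "2 * Ng * (1 + c' * Ne * Ng)"];
            (rule shift_op_HV_ell2 shift_op_HV_lincomb inj surj)?; assumption)+
      have rs: "?z \<in> resolvent_set (HV V)"
        unfolding resolvent_set_def resolvent_def using inv(1,2) by simp
      have rf: "resolvent (HV V) ?z f n = H (\<phi> f) \<zeta> (Sol n) / D \<zeta>" if f: "f \<in> ell2 \<delta>" for f n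
      proof -
        let ?w = "\<lambda>i. H (\<phi> f) \<zeta> i / D \<zeta>"
        have z0: "(\<lambda>_. 0) \<in> ell2 0" by (simp add: ell2_def)
        have c0: "conv (free_green \<zeta>) (\<lambda>_. 0) m = 0" for m by (simp add: conv_def)
        note w = scaled[OF \<phi>[OF f] \<zeta>(1,4)]
        have "w' (Src n) + kapp (sys v \<zeta>) w' (Src n) = f n"
          "w' (Sol n) + kapp (sys v \<zeta>) w' (Sol n) = conv (free_green \<zeta>) (\<lambda>_. 0) n"
          "w' Mean + kapp (sys v \<zeta>) w' Mean = 0" if "w' = ?w" for w' n
          using w(3) that by (simp_all add: \<phi>_def c0)
        note s = solution_solves[OF \<zeta>(1-3) w(1) z0 this, OF refl refl refl]
        have "inv_into (ell2 0) (shift_op (HV V) ?z) (shift_op (HV V) ?z (\<lambda>n. ?w (Sol n))) = (\<lambda>n. ?w (Sol n))"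
          by (rule inv(3)[OF s(1)])
        then show ?thesis unfolding s(2) by (simp add: resolvent_def)
      qed
      note rs rf
    } note facts = this
    show ?thesis
      by (rule that[of D "\<lambda>f \<zeta> n. H (\<phi> f) \<zeta> (Sol n)"])
        (use D \<open>D 0 \<noteq> 0\<close> Hh \<phi> facts in auto)
  qed
qed

text \<open>Pull H / D back to k by the uniformizer: it is holomorphic on a punctured disc about k =
  0, possibly singular at k = 0 itself, and equals the matrix elements of the resolvent on an open
  set.\<close>

lemma no_pole_near_0:
  assumes "\<epsilon> > 0"
  obtains \<epsilon>' where "0 < \<epsilon>'" "\<epsilon>' \<le> \<epsilon>" "\<And>k. k \<in> punctured_disc \<epsilon>' \<Longrightarrow> \<not> pole_of_extension \<delta> \<epsilon> V k"
proof -
  obtain D :: "complex \<Rightarrow> complex" and H where D: "D holomorphic_on \<Omega>" "D 0 \<noteq> 0"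
    and H: "\<And>f n. f \<in> ell2 \<delta> \<Longrightarrow> (\<lambda>\<zeta>. H f \<zeta> n) holomorphic_on \<Omega>"
    and rs: "\<And>\<zeta>. \<zeta> \<in> \<Omega> \<Longrightarrow> \<zeta> \<noteq> 0 \<Longrightarrow> cmod \<zeta> < 1 \<Longrightarrow> D \<zeta> \<noteq> 0 \<Longrightarrow>
       2 - \<zeta> - 1 / \<zeta> \<in> resolvent_set (HV V)"
    and rf: "\<And>\<zeta> f n. \<zeta> \<in> \<Omega> \<Longrightarrow> \<zeta> \<noteq> 0 \<Longrightarrow> cmod \<zeta> < 1 \<Longrightarrow> D \<zeta> \<noteq> 0 \<Longrightarrow> f \<in> ell2 \<delta> \<Longrightarrow>
       resolvent (HV V) (2 - \<zeta> - 1 / \<zeta>) f n = H f \<zeta> n / D \<zeta>"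
    by (rule resolvent_formula) blast
  have "\<forall>\<^sub>F \<zeta> in at 1. D \<zeta> \<noteq> 0 \<and> \<zeta> \<in> \<Omega>"
    using D \<Omega>_facts by (intro non_zero_neighbour_alt) auto
  then obtain \<rho> where \<rho>: "\<rho> > 0" "\<And>\<zeta>. \<zeta> \<noteq> 1 \<Longrightarrow> dist \<zeta> 1 < \<rho> \<Longrightarrow> D \<zeta> \<noteq> 0 \<and> \<zeta> \<in> \<Omega>"
    unfolding eventually_at by auto
  have jc: "continuous_on (ball 0 1) uniformizer"
    using uniformizer_holomorphic by (rule holomorphic_on_imp_continuous_on)
  then have "isCont uniformizer 0"
    by (simp add: continuous_on_eq_continuous_at)
  then obtain d where d: "d > 0" "\<And>k. dist k 0 < d \<Longrightarrow> dist (uniformizer k) 1 < \<rho>"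
    using \<rho>(1) unfolding continuous_at_eps_delta uniformizer_0 by blast
  \<comment> \<open>The bound 1 keeps k off the branch cut of the uniformizer, and the bound d keeps
    zeta so close to 1 that D is nonzero and zeta lies in \<open>\<Omega>\<close>.\<close>
  define \<epsilon>' where "\<epsilon>' = min (min \<epsilon> 1) d"
  have \<epsilon>': "0 < \<epsilon>'" "\<epsilon>' \<le> \<epsilon>" "\<epsilon>' \<le> 1" "\<epsilon>' \<le> d"
    using assms d(1) by (auto simp: \<epsilon>'_def)
  let ?W = "punctured_disc \<epsilon>'"
  have jW: "D (uniformizer k) \<noteq> 0" "uniformizer k \<in> \<Omega>" if "k \<in> ?W" for k
    using that \<rho>(2)[of "uniformizer k"] d(2)[of k] uniformizer_neq_1[of k] \<epsilon>'(4)
    by (auto simp: punctured_disc_def)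
  have W1: "?W \<subseteq> ball 0 1" using \<epsilon>'(3) by (auto simp: punctured_disc_def)
  have jh: "uniformizer holomorphic_on ?W" using uniformizer_holomorphic W1 by (rule holomorphic_on_subset)
  have Wo: "open ?W" by (auto simp: punctured_disc_def intro: open_delete)
  have Wc: "connected ?W"
    unfolding punctured_disc_def by (intro connected_open_delete) (auto simp: DIM_complex)
  \<comment> \<open>On U the definition of the extension and the formula H / D both apply. It is
    nonempty because it contains a point of the positive imaginary axis.\<close>
  define U where "U = {k \<in> ?W. 0 < Im k \<and> cmod (uniformizer k) < 1}"
  have "open U"
  proof -
    have "open (?W \<inter> uniformizer -` ball 0 1)"
      using jh Wo holomorphic_on_imp_continuous_on continuous_open_preimage open_ball by blast
    moreover have "open {k. 0 < Im k}" by (rule open_halfspace_Im_gt)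
    moreover have "U = (?W \<inter> uniformizer -` ball 0 1) \<inter> {k. 0 < Im k}" by (auto simp: U_def)
    ultimately show ?thesis by (metis open_Int)
  qed
  have "\<i> * of_real (\<epsilon>' / 2) \<in> U"
    using \<epsilon>'(1) norm_uniformizer_imaginary[of "\<epsilon>' / 2"]
    by (auto simp: U_def punctured_disc_def norm_mult)
  have "\<not> pole_of_extension \<delta> \<epsilon> V k0" if k0: "k0 \<in> ?W" for k0
  proof
    assume "pole_of_extension \<delta> \<epsilon> V k0"
    then obtain R where R: "meromorphic_resolvent_extension \<delta> \<epsilon> V R" "op_is_pole \<delta> (- \<delta>) R k0"
      unfolding pole_of_extension_def by blast
    have "\<not> op_is_pole \<delta> (- \<delta>) R k0"
    proof (rule not_op_is_pole[OF _ Wo Wc _ _ k0])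
      show "op_meromorphic_on \<delta> (- \<delta>) R (punctured_disc \<epsilon>)"
        using R(1) by (simp add: meromorphic_resolvent_extension_def)
      show "?W \<subseteq> punctured_disc \<epsilon>" using \<epsilon>'(2) by (auto simp: punctured_disc_def)
    next
      fix x n assume x: "x \<in> ell2 \<delta>"
      define F where "F k = H x (uniformizer k) n / D (uniformizer k)" for k
      have "(\<lambda>k. H x (uniformizer k) n) holomorphic_on ?W"
        using holomorphic_on_compose_gen[OF jh H[OF x, of n]] jW(2) by (auto simp: o_def)
      moreover have "(\<lambda>k. D (uniformizer k)) holomorphic_on ?W"
        using holomorphic_on_compose_gen[OF jh D(1)] jW(2) by (auto simp: o_def)
      ultimately have "F holomorphic_on ?W"
        unfolding F_def using jW(1) by (intro holomorphic_on_divide) auto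
      moreover have "R k x n = F k" if k: "k \<in> U" for k
      proof -
        let ?\<zeta> = "uniformizer k"
        have kW: "k \<in> ?W" and Im: "0 < Im k" and lt: "cmod ?\<zeta> < 1" using k by (auto simp: U_def)
        have "k\<^sup>2 \<in> resolvent_set (HV V)"
          unfolding uniformizer_eq(2)[of k] by (rule rs[OF jW(2)[OF kW] uniformizer_eq(1) lt jW(1)[OF kW]])
        moreover have "k \<in> punctured_disc \<epsilon>" using kW \<epsilon>'(2) by (auto simp: punctured_disc_def)
        ultimately have "R k x = resolvent (HV V) (k\<^sup>2) x"
          using R(1) Im x unfolding meromorphic_resolvent_extension_def by blast
        then show ?thesis
          unfolding F_def using rf[OF jW(2)[OF kW] uniformizer_eq(1) lt jW(1)[OF kW] x, of n]
          by (simp flip: uniformizer_eq(2))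
      qed
      moreover have "U \<noteq> {}" using \<open>\<i> * of_real (\<epsilon>' / 2) \<in> U\<close> by blast
      moreover have "U \<subseteq> ?W" by (auto simp: U_def)
      ultimately show "\<exists>F V. F holomorphic_on ?W \<and> open V \<and> V \<noteq> {} \<and> V \<subseteq> ?W \<and> (\<forall>k\<in>V. R k x n = F k)"
        using \<open>open U\<close> by blast
    qed
    then show False using R(2) by blast
  qed
  then show ?thesis using that \<epsilon>'(1,2) by blast
qed

end

lemma decaying_potentialI:
  assumes "bounded_op 0 0 V" "\<delta> > 0"
    and B: "bdd_above (range (\<lambda>(n, m). exp (\<delta> * (real_of_int \<bar>n\<bar> + real_of_int \<bar>m\<bar>)) * cmod (matrix_entry V n m)))"
  obtains C where "decaying_potential V \<delta> C"
proof -
  obtain C where C: "exp (\<delta> * (real_of_int \<bar>n\<bar> + real_of_int \<bar>m\<bar>)) * cmod (matrix_entry V n m) \<le> C" for n m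
    using B unfolding bdd_above_def by force
  have "cmod (matrix_entry V n m) \<le> C * (exp (- \<delta> * real_of_int \<bar>n\<bar>) * exp (- \<delta> * real_of_int \<bar>m\<bar>))" for n m
  proof -
    have "cmod (matrix_entry V n m) \<le> C * exp (- (\<delta> * (real_of_int \<bar>n\<bar> + real_of_int \<bar>m\<bar>)))"
      using C[of n m] by (simp only: exp_minus) (simp add: field_simps)
    then show ?thesis by (simp add: distrib_left flip: exp_add)
  qed
  then have "decaying_potential V \<delta> C"
    unfolding decaying_potential_def using assms(1,2) by blast
  then show ?thesis by (rule that)
qed

theorem theorem2p4:
  fixes V :: "(int \<Rightarrow> complex) \<Rightarrow> int \<Rightarrow> complex" and \<delta> \<epsilon>0 :: real
  assumes "bounded_op 0 0 V"
    and "\<delta> > 0"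
    and "bdd_above (range (\<lambda>(n, m).
           exp (\<delta> * (real_of_int \<bar>n\<bar> + real_of_int \<bar>m\<bar>)) * cmod (matrix_entry V n m)))"
    and "0 < \<epsilon>0" and "\<epsilon>0 \<le> \<delta> / 8"
    and "\<exists>R. meromorphic_resolvent_extension \<delta> \<epsilon>0 V R"
    and "\<exists>R. meromorphic_resolvent_extension \<delta> \<epsilon>0 (neg_conj_J V) R"
  shows "\<exists>\<epsilon>0'. 0 < \<epsilon>0' \<and> \<epsilon>0' \<le> \<epsilon>0 \<and>
           (\<forall>\<mu>\<in>{0, 4}. \<forall>k\<in>punctured_disc \<epsilon>0'. \<not> is_resonance \<delta> \<epsilon>0 V \<mu> k)"
proof -
  obtain C where "decaying_potential V \<delta> C"
    using decaying_potentialI[OF assms(1-3)] by blast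
  then obtain \<epsilon>1 where \<epsilon>1: "0 < \<epsilon>1" "\<epsilon>1 \<le> \<epsilon>0"
    "\<And>k. k \<in> punctured_disc \<epsilon>1 \<Longrightarrow> \<not> pole_of_extension \<delta> \<epsilon>0 V k"
    using decaying_potential.no_pole_near_0 assms(4) by blast
  have "bdd_above (range (\<lambda>(n, m).
      exp (\<delta> * (real_of_int \<bar>n\<bar> + real_of_int \<bar>m\<bar>)) * cmod (matrix_entry (neg_conj_J V) n m)))"
    using assms(3) unfolding norm_matrix_entry_neg_conj_J[OF assms(1)] .
  then obtain C' where "decaying_potential (neg_conj_J V) \<delta> C'"
    using decaying_potentialI[OF bounded_op_neg_conj_J[OF assms(1)] assms(2)] by blast
  then obtain \<epsilon>2 where \<epsilon>2: "0 < \<epsilon>2" "\<epsilon>2 \<le> \<epsilon>0"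
    "\<And>k. k \<in> punctured_disc \<epsilon>2 \<Longrightarrow> \<not> pole_of_extension \<delta> \<epsilon>0 (neg_conj_J V) k"
    using decaying_potential.no_pole_near_0 assms(4) by blast
  have "\<not> is_resonance \<delta> \<epsilon>0 V \<mu> k" if "k \<in> punctured_disc (min \<epsilon>1 \<epsilon>2)" for \<mu> k
    using that \<epsilon>1(3)[of k] \<epsilon>2(3)[of k] by (auto simp: is_resonance_def punctured_disc_def)
  then show ?thesis
    using \<epsilon>1(1,2) \<epsilon>2(1) by (intro exI[of _ "min \<epsilon>1 \<epsilon>2"]) auto
qed

end
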